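(* Let $R$ be a commutative ring. For the free Rota-Baxter monad $T(M)=\mathsf{Sh}(\mathsf{Sym}(M))\otimes\mathsf{Sym}(M)$ on the category $\mathsf{MOD}_R$ of $R$-modules, with its algebra modality structure, the natural transformation $$1\otimes\mathsf{d}:\ \mathsf{Sh}(\mathsf{Sym}(M))\otimes\mathsf{Sym}(M)\to\mathsf{Sh}(\mathsf{Sym}(M))\otimes\mathsf{Sym}(M)\otimes M$$ is a deriving transformation, where $\mathsf{d}:\mathsf{Sym}(M)\to\mathsf{Sym}(M)\otimes M$ is the linear map with $\mathsf{d}(a_1\cdots a_n)=\sum_{i=1}^n(a_1\cdots a_{i-1}a_{i+1}\cdots a_n)\otimes a_i$ for $a_1,\dots,a_n\in M$.
   Context: Composition is in diagrammatic order ($fg$ means first $f$, then $g$). $\otimes$ is the tensor product over $R$, with symmetry $\sigma$; associators and unitors are suppressed. An algebra modality on $\mathsf{MOD}_R$ (the dual of a coalgebra modality) is a monad $(T,\nu,\alpha)$, $\nu:TTM\to TM$, $\alpha:M\to TM$, with natural transformations $\nabla^T:TM\otimes TM\to TM$, $u^T:R\to TM$ making each $TM$ a commutative $R$-algebra such that $\nabla^T\nu=(\nu\otimes\nu)\nabla^T$. A deriving transformation for it is a natural transformation $\mathsf{b}:TM\to TM\otimes M$ satisfying: constant rule $u^T\mathsf{b}=0$; product rule $\nabla^T\mathsf{b}=\big((1\otimes\mathsf{b})+(\mathsf{b}\otimes1)(1\otimes\sigma)\big)(\nabla^T\otimes1)$; linear rule $\alpha\mathsf{b}=u^T\otimes1$;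 chain rule $\nu\mathsf{b}=\mathsf{b}(\nu\otimes\mathsf{b})(\nabla^T\otimes1):TTM\to TM\otimes M$ (first $\mathsf{b}$ on the right at $TM$); interchange rule $\mathsf{b}(\mathsf{b}\otimes1)=\mathsf{b}(\mathsf{b}\otimes1)(1\otimes\sigma)$. Free Rota-Baxter algebras. A commutative Rota-Baxter algebra (of weight $0$) is a commutative $R$-algebra $B$ with an $R$-linear map $\mathsf{Q}:B\to B$ with $\mathsf{Q}(a)\mathsf{Q}(b)=\mathsf{Q}(a\mathsf{Q}(b))+\mathsf{Q}(\mathsf{Q}(a)b)$. For an $R$-module $N$, the shuffle algebra is $\mathsf{Sh}(N)=\bigoplus_{n\ge0}N^{\otimes n}$ with the commutative shuffle product $*$, determined by unit $1_R\in N^{\otimes 0}=R$ and $(a\otimes w')*(b\otimes v')=a\otimes(w'*(b\otimes v'))+b\otimes((a\otimes w')*v')$. For a commutative algebra $A$, $\mathsf{RB}(A)=\mathsf{Sh}(A)\otimes A$ is the tensor product algebra, with Rota-Baxter operator $\mathsf{P}(w\otimes b)=(w\otimes b)\otimes1_A$ for $w\in A^{\otimes n}$, $n\geq 1$ (with $w\otimes b\in A^{\otimes(n+1)}$), and $\mathsf{P}(w\otimes b)=(w\cdot b)\otimes1_A$ for $w\in R$. $\mathsf{RB}$ is left adjoint to the forgetful functor from commutative Rota-Baxter algebras to commutative algebras; the unit is $a\mapsto1\otimes a$ and the counit at $(B,\mathsf{Q})$ is $\omega:\mathsf{Sh}(B)\otimes B\to B$, $\omega((b_1\otimes\cdots\otimes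 b_n)\otimes b)=\mathsf{Q}(\cdots\mathsf{Q}(\mathsf{Q}(b_1)b_2)\cdots b_n)b$. The free Rota-Baxter monad on $\mathsf{MOD}_R$ is the monad $T=\mathsf{RB}\circ\mathsf{Sym}$ of the composite of the free symmetric algebra adjunction ($\mathsf{MOD}_R$ to commutative algebras) with this adjunction. Thus $T(M)=\mathsf{Sh}(\mathsf{Sym}(M))\otimes\mathsf{Sym}(M)$; its unit is $m\mapsto1\otimes m$; its multiplication $TTM\to TM$ is $(\mathsf{Sh}(\epsilon)\otimes\epsilon)\,\omega$, where $\epsilon:\mathsf{Sym}(TM)\to TM$ is the algebra map extending the identity of $TM$ and $\omega$ is the counit at the Rota-Baxter algebra $(TM,\mathsf{P})$. The algebra structure on $T(M)$ is that of the tensor product of the shuffle algebra $\mathsf{Sh}(\mathsf{Sym}(M))$ and the algebra $\mathsf{Sym}(M)$. *)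

theory Defs
  imports "HOL-Algebra.Module" "HOL-Algebra.AbelCoset"
begin

text \<open>
  Modules over a commutative ring are those of HOL-Algebra; a commutative algebra is a module record
  whose \<open>mult\<close> and \<open>one\<close> fields carry the algebra structure (locale \<^locale>\<open>algebra\<close>).
  For a plain module these two fields are ignored, and the constructions below that only produce
  modules leave them \<open>undefined\<close>.

  Maps between modules are HOL functions that matter only on carriers. Composition is written in
  diagrammatic order: \<open>f \<circ>> g\<close> is first \<open>f\<close>, then \<open>g\<close>.
\<close>

notation fcomp (infixl "\<circ>>" 60)

definition linear_maps :: "'r ring \<Rightarrow> ('r, 'a) module \<Rightarrow> ('r, 'b) module \<Rightarrow> ('a \<Rightarrow> 'b) set" where
  "linear_maps R M N =
    {f \<in> carrier M \<rightarrow> carrier N.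
       (\<forall>x\<in>carrier M. \<forall>y\<in>carrier M. f (x \<oplus>\<^bsub>M\<^esub> y) = f x \<oplus>\<^bsub>N\<^esub> f y) \<and>
       (\<forall>r\<in>carrier R. \<forall>x\<in>carrier M. f (r \<odot>\<^bsub>M\<^esub> x) = r \<odot>\<^bsub>N\<^esub> f x)}"

definition regular_module :: "'r ring \<Rightarrow> ('r, 'r) module" where
  "regular_module R =
    \<lparr>carrier = carrier R, mult = mult R, one = one R, zero = zero R, add = add R, smult = mult R\<rparr>"


section \<open>Modules given by generators and relations\<close>

definition free_module :: "'r ring \<Rightarrow> 'x set \<Rightarrow> ('r, 'x \<Rightarrow> 'r) module" where
  "free_module R X =
    \<lparr>carrier = {v. (\<forall>x\<in>X. v x \<in> carrier R) \<and> (\<forall>x. x \<notin> X \<longrightarrow> v x = \<zero>\<^bsub>R\<^esub>) \<and> finite {x. v x \<noteq> \<zero>\<^bsub>R\<^esub>}},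
     mult = undefined, one = undefined,
     zero = (\<lambda>_. \<zero>\<^bsub>R\<^esub>),
     add = (\<lambda>v w x. v x \<oplus>\<^bsub>R\<^esub> w x),
     smult = (\<lambda>r v x. r \<otimes>\<^bsub>R\<^esub> v x)\<rparr>"

definition basis_vec :: "'r ring \<Rightarrow> 'x \<Rightarrow> 'x \<Rightarrow> 'r" where
  "basis_vec R x = (\<lambda>y. if y = x then \<one>\<^bsub>R\<^esub> else \<zero>\<^bsub>R\<^esub>)"

definition submodule_span :: "'r ring \<Rightarrow> ('r, 'a) module \<Rightarrow> 'a set \<Rightarrow> 'a set" where
  "submodule_span R M X = \<Inter> {H. submodule H R M \<and> X \<subseteq> H}"

definition quotient_module :: "'r ring \<Rightarrow> ('r, 'a) module \<Rightarrow> 'a set \<Rightarrow> ('r, 'a set) module" where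
  "quotient_module R M H =
    \<lparr>carrier = a_rcosets\<^bsub>M\<^esub> H,
     mult = undefined, one = undefined,
     zero = H,
     add = set_add M,
     smult = (\<lambda>r C. \<Union>c\<in>C. H +>\<^bsub>M\<^esub> (r \<odot>\<^bsub>M\<^esub> c))\<rparr>"

type_synonym ('r, 'x) pres = "('x \<Rightarrow> 'r) set"

definition pres_module :: "'r ring \<Rightarrow> 'x set \<Rightarrow> ('x \<Rightarrow> 'r) set \<Rightarrow> ('r, ('r, 'x) pres) module" where
  "pres_module R X E = quotient_module R (free_module R X) (submodule_span R (free_module R X) E)"

definition pres_gen :: "'r ring \<Rightarrow> 'x set \<Rightarrow> ('x \<Rightarrow> 'r) set \<Rightarrow> 'x \<Rightarrow> ('r, 'x) pres" where
  "pres_gen R X E x = submodule_span R (free_module R X) E +>\<^bsub>free_module R X\<^esub> basis_vec R x"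

text \<open>
  The linear map into \<open>L\<close> sending each generator \<open>x\<close> to \<open>\<phi> x\<close>. It is well defined when the linear
  extension of \<open>\<phi>\<close> kills the relations; it is then constant on each coset \<open>C\<close>.
\<close>
definition pres_lift :: "'r ring \<Rightarrow> ('r, 'b) module \<Rightarrow> ('x \<Rightarrow> 'b) \<Rightarrow> ('r, 'x) pres \<Rightarrow> 'b" where
  "pres_lift R L \<phi> C =
    the_elem ((\<lambda>v. \<Oplus>\<^bsub>L\<^esub>x\<in>{x. v x \<noteq> \<zero>\<^bsub>R\<^esub>}. v x \<odot>\<^bsub>L\<^esub> \<phi> x) ` C)"


section \<open>Tensor products\<close>

definition bilinear_rels ::
  "'r ring \<Rightarrow> ('r, 'a) module \<Rightarrow> ('r, 'b) module \<Rightarrow> ('a \<times> 'b \<Rightarrow> 'r) set" where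
  "bilinear_rels R M N =
    (let F = free_module R (carrier M \<times> carrier N); e = (\<lambda>a b. basis_vec R (a, b)) in
      {e (a \<oplus>\<^bsub>M\<^esub> a') b \<ominus>\<^bsub>F\<^esub> (e a b \<oplus>\<^bsub>F\<^esub> e a' b) | a a' b.
         a \<in> carrier M \<and> a' \<in> carrier M \<and> b \<in> carrier N} \<union>
      {e a (b \<oplus>\<^bsub>N\<^esub> b') \<ominus>\<^bsub>F\<^esub> (e a b \<oplus>\<^bsub>F\<^esub> e a b') | a b b'.
         a \<in> carrier M \<and> b \<in> carrier N \<and> b' \<in> carrier N} \<union>
      {e (r \<odot>\<^bsub>M\<^esub> a) b \<ominus>\<^bsub>F\<^esub> (r \<odot>\<^bsub>F\<^esub> e a b) | r a b.
         r \<in> carrier R \<and> a \<in> carrier M \<and> b \<in> carrier N} \<union>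
      {e a (r \<odot>\<^bsub>N\<^esub> b) \<ominus>\<^bsub>F\<^esub> (r \<odot>\<^bsub>F\<^esub> e a b) | r a b.
         r \<in> carrier R \<and> a \<in> carrier M \<and> b \<in> carrier N})"

type_synonym ('r, 'a, 'b) tensor = "('r, 'a \<times> 'b) pres"

definition tensor_module ::
  "'r ring \<Rightarrow> ('r, 'a) module \<Rightarrow> ('r, 'b) module \<Rightarrow> ('r, ('r, 'a, 'b) tensor) module" where
  "tensor_module R M N = pres_module R (carrier M \<times> carrier N) (bilinear_rels R M N)"

definition tens ::
  "'r ring \<Rightarrow> ('r, 'a) module \<Rightarrow> ('r, 'b) module \<Rightarrow> 'a \<Rightarrow> 'b \<Rightarrow> ('r, 'a, 'b) tensor" where
  "tens R M N a b = pres_gen R (carrier M \<times> carrier N) (bilinear_rels R M N) (a, b)"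

definition tensor_lift ::
  "'r ring \<Rightarrow> ('r, 'c) module \<Rightarrow> ('a \<Rightarrow> 'b \<Rightarrow> 'c) \<Rightarrow> ('r, 'a, 'b) tensor \<Rightarrow> 'c" where
  "tensor_lift R L \<phi> = pres_lift R L (\<lambda>(a, b). \<phi> a b)"

text \<open>The modules passed to \<open>tensor_map\<close> are the two factors of the codomain.\<close>
definition tensor_map ::
  "'r ring \<Rightarrow> ('r, 'c) module \<Rightarrow> ('r, 'd) module \<Rightarrow> ('a \<Rightarrow> 'c) \<Rightarrow> ('b \<Rightarrow> 'd) \<Rightarrow>
     ('r, 'a, 'b) tensor \<Rightarrow> ('r, 'c, 'd) tensor" where
  "tensor_map R M' N' f g = tensor_lift R (tensor_module R M' N') (\<lambda>a b. tens R M' N' (f a) (g b))"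

definition tensor_swap ::
  "'r ring \<Rightarrow> ('r, 'a) module \<Rightarrow> ('r, 'b) module \<Rightarrow> ('r, 'a, 'b) tensor \<Rightarrow> ('r, 'b, 'a) tensor" where
  "tensor_swap R M N = tensor_lift R (tensor_module R N M) (\<lambda>a b. tens R N M b a)"

definition tensor_assoc ::
  "'r ring \<Rightarrow> ('r, 'a) module \<Rightarrow> ('r, 'b) module \<Rightarrow> ('r, 'c) module \<Rightarrow>
     ('r, ('r, 'a, 'b) tensor, 'c) tensor \<Rightarrow> ('r, 'a, ('r, 'b, 'c) tensor) tensor" where
  "tensor_assoc R M N L =
    (let NL = tensor_module R N L; W = tensor_module R M NL in
      tensor_lift R W (\<lambda>t c. tensor_lift R W (\<lambda>a b. tens R M NL a (tens R N L b c)) t))"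

definition tensor_assoc_inv ::
  "'r ring \<Rightarrow> ('r, 'a) module \<Rightarrow> ('r, 'b) module \<Rightarrow> ('r, 'c) module \<Rightarrow>
     ('r, 'a, ('r, 'b, 'c) tensor) tensor \<Rightarrow> ('r, ('r, 'a, 'b) tensor, 'c) tensor" where
  "tensor_assoc_inv R M N L =
    (let MN = tensor_module R M N; W = tensor_module R MN L in
      tensor_lift R W (\<lambda>a t. tensor_lift R W (\<lambda>b c. tens R MN L (tens R M N a b) c) t))"

definition tensor_lunit_inv :: "'r ring \<Rightarrow> ('r, 'a) module \<Rightarrow> 'a \<Rightarrow> ('r, 'r, 'a) tensor" where
  "tensor_lunit_inv R M m = tens R (regular_module R) M \<one>\<^bsub>R\<^esub> m"

definition tensor_algebra_prod ::
  "'r ring \<Rightarrow> ('r, 'a) module \<Rightarrow> ('r, 'b) module \<Rightarrow> ('r, ('r, 'a, 'b) tensor) module" where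
  "tensor_algebra_prod R A B =
    (let W = tensor_module R A B in
      W\<lparr>mult := (\<lambda>x y. tensor_lift R W
            (\<lambda>a b. tensor_lift R W (\<lambda>c d. tens R A B (a \<otimes>\<^bsub>A\<^esub> c) (b \<otimes>\<^bsub>B\<^esub> d)) y) x),
        one := tens R A B \<one>\<^bsub>A\<^esub> \<one>\<^bsub>B\<^esub>\<rparr>)"

definition alg_mult_map ::
  "'r ring \<Rightarrow> ('r, 'a) module \<Rightarrow> ('r, 'a, 'a) tensor \<Rightarrow> 'a" where
  "alg_mult_map R A = tensor_lift R A (\<lambda>x y. x \<otimes>\<^bsub>A\<^esub> y)"

definition alg_unit_map :: "('r, 'a) module \<Rightarrow> 'r \<Rightarrow> 'a" where
  "alg_unit_map A r = r \<odot>\<^bsub>A\<^esub> \<one>\<^bsub>A\<^esub>"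


section \<open>Tensor powers and the shuffle algebra\<close>

definition multilinear_rels :: "'r ring \<Rightarrow> ('r, 'n) module \<Rightarrow> ('n list \<Rightarrow> 'r) set" where
  "multilinear_rels R N =
    (let F = free_module R (lists (carrier N)); e = basis_vec R in
      {e (xs @ (a \<oplus>\<^bsub>N\<^esub> b) # ys) \<ominus>\<^bsub>F\<^esub> (e (xs @ a # ys) \<oplus>\<^bsub>F\<^esub> e (xs @ b # ys)) | xs a b ys.
         xs \<in> lists (carrier N) \<and> a \<in> carrier N \<and> b \<in> carrier N \<and> ys \<in> lists (carrier N)} \<union>
      {e (xs @ (r \<odot>\<^bsub>N\<^esub> a) # ys) \<ominus>\<^bsub>F\<^esub> (r \<odot>\<^bsub>F\<^esub> e (xs @ a # ys)) | xs r a ys.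
         xs \<in> lists (carrier N) \<and> r \<in> carrier R \<and> a \<in> carrier N \<and> ys \<in> lists (carrier N)})"

type_synonym ('r, 'n) words = "('r, 'n list) pres"

text \<open>
  The direct sum over \<open>n\<close> of the \<open>n\<close>-fold tensor powers of \<open>N\<close>: the relations preserve the length of
  words, the words of length \<open>n\<close> present the \<open>n\<close>-th tensor power, and the empty word spans the
  \<open>0\<close>-th power \<open>R\<close>.
\<close>
definition sh_module :: "'r ring \<Rightarrow> ('r, 'n) module \<Rightarrow> ('r, ('r, 'n) words) module" where
  "sh_module R N = pres_module R (lists (carrier N)) (multilinear_rels R N)"

definition sh_word :: "'r ring \<Rightarrow> ('r, 'n) module \<Rightarrow> 'n list \<Rightarrow> ('r, 'n) words" where
  "sh_word R N = pres_gen R (lists (carrier N)) (multilinear_rels R N)"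

definition sh_prepend :: "'r ring \<Rightarrow> ('r, 'n) module \<Rightarrow> 'n \<Rightarrow> ('r, 'n) words \<Rightarrow> ('r, 'n) words" where
  "sh_prepend R N a = pres_lift R (sh_module R N) (\<lambda>w. sh_word R N (a # w))"

definition sh_append :: "'r ring \<Rightarrow> ('r, 'n) module \<Rightarrow> ('r, 'n) words \<Rightarrow> 'n \<Rightarrow> ('r, 'n) words" where
  "sh_append R N w b = pres_lift R (sh_module R N) (\<lambda>u. sh_word R N (u @ [b])) w"

fun shuffle_words ::
  "'r ring \<Rightarrow> ('r, 'n) module \<Rightarrow> 'n list \<Rightarrow> 'n list \<Rightarrow> ('r, 'n) words" where
  "shuffle_words R N [] v = sh_word R N v"
| "shuffle_words R N w [] = sh_word R N w"
| "shuffle_words R N (a # w) (b # v) =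
     sh_prepend R N a (shuffle_words R N w (b # v)) \<oplus>\<^bsub>sh_module R N\<^esub>
     sh_prepend R N b (shuffle_words R N (a # w) v)"

definition Sh :: "'r ring \<Rightarrow> ('r, 'n) module \<Rightarrow> ('r, ('r, 'n) words) module" where
  "Sh R N =
    (sh_module R N)
      \<lparr>mult := (\<lambda>x y. pres_lift R (sh_module R N)
                  (\<lambda>w. pres_lift R (sh_module R N) (\<lambda>v. shuffle_words R N w v) y) x),
       one := sh_word R N []\<rparr>"

definition Sh_map ::
  "'r ring \<Rightarrow> ('r, 'm) module \<Rightarrow> ('n \<Rightarrow> 'm) \<Rightarrow> ('r, 'n) words \<Rightarrow> ('r, 'm) words" where
  "Sh_map R N' f = pres_lift R (Sh R N') (\<lambda>w. sh_word R N' (map f w))"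


section \<open>The free symmetric algebra\<close>

definition commutation_rels :: "'r ring \<Rightarrow> ('r, 'a) module \<Rightarrow> ('a list \<Rightarrow> 'r) set" where
  "commutation_rels R M =
    (let F = free_module R (lists (carrier M)); e = basis_vec R in
      {e (xs @ a # b # ys) \<ominus>\<^bsub>F\<^esub> e (xs @ b # a # ys) | xs a b ys.
         xs \<in> lists (carrier M) \<and> a \<in> carrier M \<and> b \<in> carrier M \<and> ys \<in> lists (carrier M)})"

abbreviation sym_rels :: "'r ring \<Rightarrow> ('r, 'a) module \<Rightarrow> ('a list \<Rightarrow> 'r) set" where
  "sym_rels R M \<equiv> multilinear_rels R M \<union> commutation_rels R M"

text \<open>\<open>sym_word R M [a\<^sub>1, \<dots>, a\<^sub>n]\<close> is the product of the \<open>a\<^sub>i\<close> in \<open>Sym(M)\<close>.\<close>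
definition sym_word :: "'r ring \<Rightarrow> ('r, 'a) module \<Rightarrow> 'a list \<Rightarrow> ('r, 'a) words" where
  "sym_word R M = pres_gen R (lists (carrier M)) (sym_rels R M)"

definition Sym :: "'r ring \<Rightarrow> ('r, 'a) module \<Rightarrow> ('r, ('r, 'a) words) module" where
  "Sym R M =
    (let S = pres_module R (lists (carrier M)) (sym_rels R M) in
      S\<lparr>mult := (\<lambda>x y. pres_lift R S (\<lambda>u. pres_lift R S (\<lambda>v. sym_word R M (u @ v)) y) x),
        one := sym_word R M []\<rparr>)"

definition Sym_map ::
  "'r ring \<Rightarrow> ('r, 'b) module \<Rightarrow> ('a \<Rightarrow> 'b) \<Rightarrow> ('r, 'a) words \<Rightarrow> ('r, 'b) words" where
  "Sym_map R N f = pres_lift R (Sym R N) (\<lambda>u. sym_word R N (map f u))"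

text \<open>The algebra map \<open>Sym(A) \<rightarrow> A\<close> extending the identity of the commutative algebra \<open>A\<close>.\<close>
definition Sym_counit :: "'r ring \<Rightarrow> ('r, 'a) module \<Rightarrow> ('r, 'a) words \<Rightarrow> 'a" where
  "Sym_counit R A = pres_lift R A (\<lambda>u. foldr (\<lambda>x y. x \<otimes>\<^bsub>A\<^esub> y) u \<one>\<^bsub>A\<^esub>)"

definition sym_deriv ::
  "'r ring \<Rightarrow> ('r, 'a) module \<Rightarrow> ('r, 'a) words \<Rightarrow> ('r, ('r, 'a) words, 'a) tensor" where
  "sym_deriv R M = pres_lift R (tensor_module R (Sym R M) M)
     (\<lambda>u. \<Oplus>\<^bsub>tensor_module R (Sym R M) M\<^esub>i\<in>{..<length u}.
            tens R (Sym R M) M (sym_word R M (take i u @ drop (Suc i) u)) (u ! i))"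


section \<open>Free Rota-Baxter algebras\<close>

type_synonym ('r, 'a) rb = "('r, ('r, 'a) words, 'a) tensor"

definition RB :: "'r ring \<Rightarrow> ('r, 'a) module \<Rightarrow> ('r, ('r, 'a) rb) module" where
  "RB R A = tensor_algebra_prod R (Sh R A) A"

text \<open>
  On \<open>w \<otimes> b\<close> with \<open>w\<close> a word this is \<open>(w \<otimes> b) \<otimes> 1\<close>. For \<open>w = r\<close> in degree \<open>0\<close>, appending \<open>b\<close> to
  \<open>r\<close> times the empty word gives the degree \<open>1\<close> element \<open>r \<cdot> b\<close>.
\<close>
definition RB_op :: "'r ring \<Rightarrow> ('r, 'a) module \<Rightarrow> ('r, 'a) rb \<Rightarrow> ('r, 'a) rb" where
  "RB_op R A = tensor_lift R (RB R A) (\<lambda>w b. tens R (Sh R A) A (sh_append R A w b) \<one>\<^bsub>A\<^esub>)"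

text \<open>The fold computes \<open>Q (\<dots> Q (Q (b\<^sub>1) b\<^sub>2) \<dots> b\<^sub>n)\<close>, and \<open>1\<close> on the empty word.\<close>
definition RB_counit :: "'r ring \<Rightarrow> ('r, 'b) module \<Rightarrow> ('b \<Rightarrow> 'b) \<Rightarrow> ('r, 'b) rb \<Rightarrow> 'b" where
  "RB_counit R B Q =
    tensor_lift R B (\<lambda>w b. pres_lift R B (foldl (\<lambda>c x. Q (c \<otimes>\<^bsub>B\<^esub> x)) \<one>\<^bsub>B\<^esub>) w \<otimes>\<^bsub>B\<^esub> b)"


section \<open>The free Rota-Baxter monad\<close>

type_synonym ('r, 'a) rbsym = "('r, ('r, 'a) words) rb"

definition RBSym :: "'r ring \<Rightarrow> ('r, 'a) module \<Rightarrow> ('r, ('r, 'a) rbsym) module" where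
  "RBSym R M = RB R (Sym R M)"

definition RBSym_map ::
  "'r ring \<Rightarrow> ('r, 'b) module \<Rightarrow> ('a \<Rightarrow> 'b) \<Rightarrow> ('r, 'a) rbsym \<Rightarrow> ('r, 'b) rbsym" where
  "RBSym_map R N f =
    tensor_map R (Sh R (Sym R N)) (Sym R N) (Sh_map R (Sym R N) (Sym_map R N f)) (Sym_map R N f)"

definition RBSym_unit :: "'r ring \<Rightarrow> ('r, 'a) module \<Rightarrow> 'a \<Rightarrow> ('r, 'a) rbsym" where
  "RBSym_unit R M m = tens R (Sh R (Sym R M)) (Sym R M) \<one>\<^bsub>Sh R (Sym R M)\<^esub> (sym_word R M [m])"

definition RBSym_mult ::
  "'r ring \<Rightarrow> ('r, 'a) module \<Rightarrow> ('r, ('r, 'a) rbsym) rbsym \<Rightarrow> ('r, 'a) rbsym" where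
  "RBSym_mult R M =
    (let TM = RBSym R M; \<epsilon> = Sym_counit R TM in
      tensor_map R (Sh R TM) TM (Sh_map R TM \<epsilon>) \<epsilon> \<circ>> RB_counit R TM (RB_op R (Sym R M)))"

text \<open>\<open>1 \<otimes> d\<close>, followed by the associator that makes its codomain \<open>T(M) \<otimes> M\<close>.\<close>
definition RBSym_deriv ::
  "'r ring \<Rightarrow> ('r, 'a) module \<Rightarrow> ('r, 'a) rbsym \<Rightarrow> ('r, ('r, 'a) rbsym, 'a) tensor" where
  "RBSym_deriv R M =
    tensor_map R (Sh R (Sym R M)) (tensor_module R (Sym R M) M) id (sym_deriv R M) \<circ>>
    tensor_assoc_inv R (Sh R (Sym R M)) (Sym R M) M"


section \<open>The axioms of a deriving transformation\<close>

text \<open>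
  Stated at a module \<open>M\<close>. Here \<open>A\<close> stands for the commutative algebra \<open>TM\<close>, whose \<open>mult\<close> and \<open>one\<close>
  give \<open>\<nabla>\<close> and \<open>u\<close>; \<open>B\<close> stands for \<open>TTM\<close>; \<open>b\<close> and \<open>bT\<close> are the components at \<open>M\<close> and at \<open>TM\<close>;
  \<open>A'\<close> and \<open>bN\<close> are the algebra and the component at a second module \<open>N\<close>. A component of a natural transformation of functors on
  modules is a linear map, and naturality is quantified over all linear maps \<open>f\<close>.
\<close>

definition deriv_natural ::
  "'r ring \<Rightarrow> ('r, 'a) module \<Rightarrow> ('r, 'b) module \<Rightarrow> ('r, 't) module \<Rightarrow> ('r, 's) module \<Rightarrow>
     (('a \<Rightarrow> 'b) \<Rightarrow> 't \<Rightarrow> 's) \<Rightarrow>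
     ('t \<Rightarrow> ('r, 't, 'a) tensor) \<Rightarrow> ('s \<Rightarrow> ('r, 's, 'b) tensor) \<Rightarrow> bool" where
  "deriv_natural R M N A A' Tmap b bN \<longleftrightarrow>
    (\<forall>f\<in>linear_maps R M N. \<forall>x\<in>carrier A.
       (Tmap f \<circ>> bN) x = (b \<circ>> tensor_map R A' N (Tmap f) f) x)"

definition constant_rule ::
  "'r ring \<Rightarrow> ('r, 'a) module \<Rightarrow> ('r, 't) module \<Rightarrow> ('t \<Rightarrow> ('r, 't, 'a) tensor) \<Rightarrow> bool" where
  "constant_rule R M A b \<longleftrightarrow>
    (\<forall>r\<in>carrier R. (alg_unit_map A \<circ>> b) r = \<zero>\<^bsub>tensor_module R A M\<^esub>)"

definition product_rule ::
  "'r ring \<Rightarrow> ('r, 'a) module \<Rightarrow> ('r, 't) module \<Rightarrow> ('t \<Rightarrow> ('r, 't, 'a) tensor) \<Rightarrow> bool" where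
  "product_rule R M A b \<longleftrightarrow>
    (let AM = tensor_module R A M; AA = tensor_module R A A; MA = tensor_module R M A;
         mlt = alg_mult_map R A
     in \<forall>x\<in>carrier AA.
       (mlt \<circ>> b) x =
       (tensor_map R A AM id b \<circ>> tensor_assoc_inv R A A M \<circ>> tensor_map R A M mlt id) x
         \<oplus>\<^bsub>AM\<^esub>
       (tensor_map R AM A b id \<circ>> tensor_assoc R A M A \<circ>> tensor_map R A AM id (tensor_swap R M A)
          \<circ>> tensor_assoc_inv R A A M \<circ>> tensor_map R A M mlt id) x)"

definition linear_rule ::
  "'r ring \<Rightarrow> ('r, 'a) module \<Rightarrow> ('r, 't) module \<Rightarrow> ('a \<Rightarrow> 't) \<Rightarrow>
     ('t \<Rightarrow> ('r, 't, 'a) tensor) \<Rightarrow> bool" where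
  "linear_rule R M A \<alpha> b \<longleftrightarrow>
    (\<forall>m\<in>carrier M.
       (\<alpha> \<circ>> b) m = (tensor_lunit_inv R M \<circ>> tensor_map R A M (alg_unit_map A) id) m)"

definition chain_rule ::
  "'r ring \<Rightarrow> ('r, 'a) module \<Rightarrow> ('r, 't) module \<Rightarrow> ('r, 'u) module \<Rightarrow> ('u \<Rightarrow> 't) \<Rightarrow>
     ('t \<Rightarrow> ('r, 't, 'a) tensor) \<Rightarrow> ('u \<Rightarrow> ('r, 'u, 't) tensor) \<Rightarrow> bool" where
  "chain_rule R M A B \<nu> b bT \<longleftrightarrow>
    (\<forall>x\<in>carrier B.
       (\<nu> \<circ>> b) x =
       (bT \<circ>> tensor_map R A (tensor_module R A M) \<nu> b \<circ>> tensor_assoc_inv R A A M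
          \<circ>> tensor_map R A M (alg_mult_map R A) id) x)"

definition interchange_rule ::
  "'r ring \<Rightarrow> ('r, 'a) module \<Rightarrow> ('r, 't) module \<Rightarrow> ('t \<Rightarrow> ('r, 't, 'a) tensor) \<Rightarrow> bool" where
  "interchange_rule R M A b \<longleftrightarrow>
    (let AM = tensor_module R A M; MM = tensor_module R M M
     in \<forall>x\<in>carrier A.
       (b \<circ>> tensor_map R AM M b id) x =
       (b \<circ>> tensor_map R AM M b id \<circ>> tensor_assoc R A M M \<circ>> tensor_map R A MM id (tensor_swap R M M)
          \<circ>> tensor_assoc_inv R A M M) x)"

end

theory Submission
  imports Defs
begin

text \<open>
  Writing \<open>J\<^sub>x u = x \<otimes> u\<close> for \<open>x \<in> Sh(Sym M)\<close>, the map \<open>b = 1 \<otimes> d\<close> satisfies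
  \<open>b (J\<^sub>x u) = (J\<^sub>x \<otimes> 1) (d u)\<close>. So naturality, the linear rule, the interchange rule and the Leibniz rule
  for \<open>b\<close> reduce to those for \<open>d\<close> on \<open>Sym M\<close>, where they follow by induction on words from
  \<open>d (a u) = u \<otimes> a + a \<cdot> d u\<close>. The constant and the product rule only use that \<open>b\<close> is a derivation
  with respect to the action of \<open>TM\<close> on the first factor of \<open>TM \<otimes> M\<close>.

  For the chain rule, the multiplication of the monad sends \<open>w \<otimes> t\<^sub>1 \<cdots> t\<^sub>n\<close> to \<open>c t\<^sub>1 \<cdots> t\<^sub>n\<close>, where \<open>c\<close> is a
  combination of \<open>1\<close> and of values of the Rota-Baxter operator. The latter have the form \<open>x \<otimes> 1\<close>, hence
  \<open>b c = 0\<close>, and what remains is the Leibniz rule for \<open>t\<^sub>1 \<cdots> t\<^sub>n\<close>.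
\<close>

section \<open>Linear maps\<close>

text \<open>The maps of the theorem are lifts out of presented modules. A lift is
  \<open>the_elem\<close> of the image of a coset, so none of its values is known until the
  relations have been checked. This check is made for each presentation; after it an identity
  becomes an equality of two linear maps compared on generators, and the composite terms passed to
  the \<open>_ext\<close> lemmas are the linearity proofs of its two sides. The obstacle is a lift
  with another lift in its body, as in the multiplications and the associators: the relations of the
  outer lift must then be respected for every value of the second argument and not only for
  generators, which requires the inner value to be linear in that argument. The Leibniz form of the
  product rule is an identity over a commutative algebra. Hence the ring axioms are also proved for
  the shuffle product, for concatenation in \<open>Sym\<close> and for tensor products of
  algebras.\<close>

lemma linear_mapsI:
  assumes "\<And>x. x \<in> carrier M \<Longrightarrow> f x \<in> carrier N"
    and "\<And>x y. x \<in> carrier M \<Longrightarrow> y \<in> carrier M \<Longrightarrow> f (x \<oplus>\<^bsub>M\<^esub> y) = f x \<oplus>\<^bsub>N\<^esub> f y"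
    and "\<And>r x. r \<in> carrier R \<Longrightarrow> x \<in> carrier M \<Longrightarrow> f (r \<odot>\<^bsub>M\<^esub> x) = r \<odot>\<^bsub>N\<^esub> f x"
  shows "f \<in> linear_maps R M N"
  using assms by (auto simp: linear_maps_def)

lemma linear_maps_closed: "f \<in> linear_maps R M N \<Longrightarrow> x \<in> carrier M \<Longrightarrow> f x \<in> carrier N"
  by (auto simp: linear_maps_def)

lemma linear_maps_add:
  "f \<in> linear_maps R M N \<Longrightarrow> x \<in> carrier M \<Longrightarrow> y \<in> carrier M \<Longrightarrow> f (x \<oplus>\<^bsub>M\<^esub> y) = f x \<oplus>\<^bsub>N\<^esub> f y"
  by (auto simp: linear_maps_def)

lemma linear_maps_smult:
  "f \<in> linear_maps R M N \<Longrightarrow> r \<in> carrier R \<Longrightarrow> x \<in> carrier M \<Longrightarrow> f (r \<odot>\<^bsub>M\<^esub> x) = r \<odot>\<^bsub>N\<^esub> f x"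
  by (auto simp: linear_maps_def)

lemma linear_maps_zero:
  assumes "module R M" "module R N" "f \<in> linear_maps R M N"
  shows "f \<zero>\<^bsub>M\<^esub> = \<zero>\<^bsub>N\<^esub>"
proof -
  interpret M: module R M by fact
  interpret N: module R N by fact
  have "f (\<zero>\<^bsub>R\<^esub> \<odot>\<^bsub>M\<^esub> \<zero>\<^bsub>M\<^esub>) = \<zero>\<^bsub>R\<^esub> \<odot>\<^bsub>N\<^esub> f \<zero>\<^bsub>M\<^esub>"
    using assms(3) by (intro linear_maps_smult) auto
  then show ?thesis
    using linear_maps_closed[OF assms(3), of "\<zero>\<^bsub>M\<^esub>"] by simp
qed

lemma linear_maps_a_inv:
  assumes "module R M" "module R N" "f \<in> linear_maps R M N" "x \<in> carrier M"
  shows "f (\<ominus>\<^bsub>M\<^esub> x) = \<ominus>\<^bsub>N\<^esub> f x"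
proof -
  interpret M: module R M by fact
  interpret N: module R N by fact
  have "f (\<ominus>\<^bsub>M\<^esub> x) \<oplus>\<^bsub>N\<^esub> f x = f (\<ominus>\<^bsub>M\<^esub> x \<oplus>\<^bsub>M\<^esub> x)"
    using assms(4) by (simp add: linear_maps_add[OF assms(3)])
  also have "\<dots> = \<zero>\<^bsub>N\<^esub>"
    using assms(4) by (simp add: M.l_neg linear_maps_zero[OF assms(1-3)])
  finally have "f (\<ominus>\<^bsub>M\<^esub> x) \<oplus>\<^bsub>N\<^esub> f x = \<zero>\<^bsub>N\<^esub>" .
  then show ?thesis
    using assms(4) by (intro N.minus_equality[symmetric] linear_maps_closed[OF assms(3)]) auto
qed

lemma linear_maps_minus:
  assumes "module R M" "module R N" "f \<in> linear_maps R M N" "x \<in> carrier M" "y \<in> carrier M"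
  shows "f (x \<ominus>\<^bsub>M\<^esub> y) = f x \<ominus>\<^bsub>N\<^esub> f y"
proof -
  interpret M: module R M by fact
  show ?thesis
    using assms by (simp add: a_minus_def linear_maps_add[OF assms(3)] linear_maps_a_inv)
qed

lemma linear_maps_finsum:
  assumes "module R M" "module R N" "f \<in> linear_maps R M N" "finite A" "g \<in> A \<rightarrow> carrier M"
  shows "f (\<Oplus>\<^bsub>M\<^esub>i\<in>A. g i) = (\<Oplus>\<^bsub>N\<^esub>i\<in>A. f (g i))"
proof -
  interpret M: module R M by fact
  interpret N: module R N by fact
  show ?thesis using assms(4,5)
  proof (induction A rule: finite_induct)
    case empty
    show ?case using assms(1-3) by (simp add: linear_maps_zero)
  next
    case (insert a A)
    then show ?case
      using assms(3) by (auto simp: linear_maps_add[OF assms(3)] linear_maps_closed Pi_iff)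
  qed
qed

lemma linear_maps_comp:
  "f \<in> linear_maps R M N \<Longrightarrow> g \<in> linear_maps R N L \<Longrightarrow> (\<lambda>x. g (f x)) \<in> linear_maps R M L"
  by (auto simp: linear_maps_def Pi_iff)

lemma linear_maps_id: "id \<in> linear_maps R M M" "(\<lambda>x. x) \<in> linear_maps R M M"
  by (auto simp: linear_maps_def)

lemma linear_maps_const_zero:
  assumes "module R N" shows "(\<lambda>_. \<zero>\<^bsub>N\<^esub>) \<in> linear_maps R M N"
proof -
  interpret N: module R N by fact
  show ?thesis by (auto simp: linear_maps_def)
qed

lemma linear_maps_plus:
  assumes "module R N" "f \<in> linear_maps R M N" "g \<in> linear_maps R M N"
  shows "(\<lambda>x. f x \<oplus>\<^bsub>N\<^esub> g x) \<in> linear_maps R M N"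
proof -
  interpret N: module R N by fact
  show ?thesis
    using assms(2,3)
    by (intro linear_mapsI)
       (auto simp: linear_maps_closed linear_maps_add linear_maps_smult N.smult_r_distr N.a_ac)
qed

lemma linear_maps_scale:
  assumes "module R N" "f \<in> linear_maps R M N" "r \<in> carrier R"
  shows "(\<lambda>x. r \<odot>\<^bsub>N\<^esub> f x) \<in> linear_maps R M N"
proof -
  interpret N: module R N by fact
  \<comment> \<open>Here commutativity of \<open>R\<close> enters: a scalar multiple of a linear map
    is linear only because \<open>r\<close> and \<open>s\<close> commute.\<close>
  have "r \<odot>\<^bsub>N\<^esub> (s \<odot>\<^bsub>N\<^esub> y) = s \<odot>\<^bsub>N\<^esub> (r \<odot>\<^bsub>N\<^esub> y)" if "s \<in> carrier R" "y \<in> carrier N" for s y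
    using that assms(3) by (simp flip: N.smult_assoc1 add: N.R.m_comm)
  then show ?thesis
    using assms(2,3)
    by (intro linear_mapsI)
       (auto simp: linear_maps_closed linear_maps_add linear_maps_smult N.smult_r_distr)
qed

text \<open>Only values on the carrier count, so a map defined through a lift may be exchanged for
  the formula that computes it there. The inductions over elements below use this to reach the
  closure rules for zero, sums and multiples of linear maps.\<close>

lemma linear_maps_cong:
  assumes "module R M" "g \<in> linear_maps R M N" "\<And>x. x \<in> carrier M \<Longrightarrow> f x = g x"
  shows "f \<in> linear_maps R M N"
proof -
  interpret M: module R M by fact
  show ?thesis using assms(2,3) by (simp add: linear_maps_def Pi_iff)
qed


text \<open>
  The constants above take \<open>R\<close> of the closed record type \<open>'r ring\<close>, so they cannot be used in
  \<^locale>\<open>cring\<close> and \<^locale>\<open>module\<close> directly, whose \<open>R\<close> is of an extensible record type.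
\<close>
locale base_ring = cring R for R :: "'r ring" (structure)

locale base_module = module R M for R :: "'r ring" (structure) and M :: "('r, 'a) module" (structure)


section \<open>Modules given by generators and relations\<close>

lemma free_module_simps [simp]:
  "zero (free_module R X) = (\<lambda>_. \<zero>\<^bsub>R\<^esub>)"
  "add (free_module R X) = (\<lambda>v w x. v x \<oplus>\<^bsub>R\<^esub> w x)"
  "smult (free_module R X) = (\<lambda>r v x. r \<otimes>\<^bsub>R\<^esub> v x)"
  by (simp_all add: free_module_def)

lemma free_module_carrier:
  "v \<in> carrier (free_module R X) \<longleftrightarrow>
    (\<forall>x\<in>X. v x \<in> carrier R) \<and> (\<forall>x. x \<notin> X \<longrightarrow> v x = \<zero>\<^bsub>R\<^esub>) \<and> finite {x. v x \<noteq> \<zero>\<^bsub>R\<^esub>}"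
  by (simp add: free_module_def)

context base_ring
begin

lemma free_module_closed: "v \<in> carrier (free_module R X) \<Longrightarrow> v x \<in> carrier R"
  by (cases "x \<in> X") (simp_all add: free_module_carrier)

lemma free_module_module: "module R (free_module R X)"
proof (rule moduleI)
  let ?F = "free_module R X"
  show "cring R" by (rule is_cring)
  have add: "(\<lambda>x. v x \<oplus> w x) \<in> carrier ?F" if "v \<in> carrier ?F" "w \<in> carrier ?F" for v w
  proof -
    have "{x. v x \<oplus> w x \<noteq> \<zero>} \<subseteq> {x. v x \<noteq> \<zero>} \<union> {x. w x \<noteq> \<zero>}" by auto
    then show ?thesis using that by (auto simp: free_module_carrier intro: finite_subset)
  qed
  have smult: "(\<lambda>x. r \<otimes> v x) \<in> carrier ?F" if "r \<in> carrier R" "v \<in> carrier ?F" for r v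
  proof -
    have "{x. r \<otimes> v x \<noteq> \<zero>} \<subseteq> {x. v x \<noteq> \<zero>}" using that by auto
    then show ?thesis using that by (auto simp: free_module_carrier intro: finite_subset)
  qed
  show "abelian_group ?F"
  proof (rule abelian_groupI)
    fix v assume v: "v \<in> carrier ?F"
    \<comment> \<open>The additive inverse is taken as the multiple by
      \<open>\<ominus> \<one>\<close>, whose finite support is already known from
      \<open>smult\<close>.\<close>
    have "(\<lambda>x. (\<ominus> \<one>) \<otimes> v x) \<in> carrier ?F" using v by (intro smult) auto
    moreover have "(\<lambda>x. (\<ominus> \<one>) \<otimes> v x \<oplus> v x) = (\<lambda>_. \<zero>)"
      by (rule ext) (use free_module_closed[OF v] in \<open>simp add: l_minus l_neg\<close>)
    ultimately show "\<exists>w\<in>carrier ?F. w \<oplus>\<^bsub>?F\<^esub> v = \<zero>\<^bsub>?F\<^esub>" by auto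
  qed (use add in \<open>auto simp: a_ac free_module_closed free_module_carrier[of "\<lambda>_. \<zero>"]\<close>)
  show "r \<odot>\<^bsub>?F\<^esub> v \<in> carrier ?F" if "r \<in> carrier R" "v \<in> carrier ?F" for r v
    using smult[OF that] by simp
qed (auto simp: free_module_closed l_distr r_distr m_assoc)

lemma basis_vec_closed: "x \<in> X \<Longrightarrow> basis_vec R x \<in> carrier (free_module R X)"
  by (auto simp: free_module_carrier basis_vec_def)

text \<open>Induction on a finite set containing the support, for all vectors at once: one point
  \<open>s\<close> is removed by splitting \<open>v\<close> into \<open>v(s := \<zero>)\<close> and
  a multiple of the basis vector at \<open>s\<close>. It replaces computations with finite sums
  later on.\<close>

lemma free_module_induct [consumes 1, case_names zero basis add smult]:
  fixes v :: "'x \<Rightarrow> 'r"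
  assumes v: "v \<in> carrier (free_module R X)"
    and zero: "P (\<lambda>_. \<zero>)"
    and basis: "\<And>x. x \<in> X \<Longrightarrow> P (basis_vec R x)"
    and add: "\<And>v w. v \<in> carrier (free_module R X) \<Longrightarrow> w \<in> carrier (free_module R X) \<Longrightarrow>
      P v \<Longrightarrow> P w \<Longrightarrow> P (v \<oplus>\<^bsub>free_module R X\<^esub> w)"
    and smult: "\<And>r v. r \<in> carrier R \<Longrightarrow> v \<in> carrier (free_module R X) \<Longrightarrow> P v \<Longrightarrow>
      P (r \<odot>\<^bsub>free_module R X\<^esub> v)"
  shows "P v"
proof -
  let ?F = "free_module R X"
  interpret F: module R ?F by (rule free_module_module)
  have "\<forall>v. v \<in> carrier ?F \<longrightarrow> {x. v x \<noteq> \<zero>} \<subseteq> S \<longrightarrow> P v" if "finite S" for S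
    using that
  proof (induction S rule: finite_induct)
    case empty
    then have "v = (\<lambda>_. \<zero>)" if "{x. v x \<noteq> \<zero>} \<subseteq> {}" for v :: "'x \<Rightarrow> 'r"
      using that by auto
    then show ?case using zero by metis
  next
    case (insert s S)
    show ?case
    proof (intro allI impI)
      fix v assume v: "v \<in> carrier ?F" and sub: "{x. v x \<noteq> \<zero>} \<subseteq> insert s S"
      show "P v"
      proof (cases "v s = \<zero>")
        case True
        then show ?thesis using insert.IH v sub by blast
      next
        case False
        then have s: "s \<in> X" using v by (auto simp: free_module_carrier)
        let ?w = "v(s := \<zero>)"
        have w: "?w \<in> carrier ?F"
          using v by (auto simp: free_module_carrier elim: finite_subset[rotated])
        have "{x. ?w x \<noteq> \<zero>} \<subseteq> S" using sub by auto
        then have "P ?w" using insert.IH w by blast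
        moreover have "P (v s \<odot>\<^bsub>?F\<^esub> basis_vec R s)"
          using s v by (intro smult basis basis_vec_closed free_module_closed)
        moreover have "v = ?w \<oplus>\<^bsub>?F\<^esub> v s \<odot>\<^bsub>?F\<^esub> basis_vec R s"
          using free_module_closed[OF v] by (auto simp: basis_vec_def fun_eq_iff)
        ultimately show ?thesis
          using add[of ?w "v s \<odot>\<^bsub>?F\<^esub> basis_vec R s"] w s v
          by (metis F.smult_closed basis_vec_closed free_module_closed)
      qed
    qed
  qed
  then show ?thesis using v by (auto simp: free_module_carrier)
qed

text \<open>This is the function that \<open>pres_lift\<close> evaluates on the members of a coset,
  isolated so that its linearity on the free module can be stated.\<close>

definition linear_extension :: "('r, 'b) module \<Rightarrow> ('x \<Rightarrow> 'b) \<Rightarrow> ('x \<Rightarrow> 'r) \<Rightarrow> 'b" where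
  "linear_extension L \<phi> v = (\<Oplus>\<^bsub>L\<^esub>x\<in>{x. v x \<noteq> \<zero>}. v x \<odot>\<^bsub>L\<^esub> \<phi> x)"

text \<open>The support changes under addition and scaling. Padding with zero summands up to a
  common finite index set turns linearity into a computation with sums over one set.\<close>

lemma linear_extension_superset:
  assumes "module R L" "\<phi> \<in> X \<rightarrow> carrier L" "v \<in> carrier (free_module R X)"
    and "finite S" "{x. v x \<noteq> \<zero>} \<subseteq> S" "S \<subseteq> X"
  shows "linear_extension L \<phi> v = (\<Oplus>\<^bsub>L\<^esub>x\<in>S. v x \<odot>\<^bsub>L\<^esub> \<phi> x)"
proof -
  interpret L: module R L by fact
  show ?thesis unfolding linear_extension_def
    by (rule L.add.finprod_mono_neutral_cong_left)
       (use assms in \<open>auto simp: Pi_iff subset_iff free_module_closed\<close>)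
qed

lemma linear_extension_linear:
  assumes L: "module R L" and \<phi>: "\<phi> \<in> X \<rightarrow> carrier L"
  shows "linear_extension L \<phi> \<in> linear_maps R (free_module R X) L"
proof -
  let ?F = "free_module R X"
  interpret L: module R L by fact
  interpret F: module R ?F by (rule free_module_module)
  note sup = linear_extension_superset[OF L \<phi>]
  have supp: "finite {x. v x \<noteq> \<zero>}" "{x. v x \<noteq> \<zero>} \<subseteq> X" if "v \<in> carrier ?F" for v
    using that by (auto simp: free_module_carrier)
  note cl = \<phi>[THEN funcset_mem]
  show ?thesis
  proof (rule linear_mapsI)
    fix v assume v: "v \<in> carrier ?F"
    show "linear_extension L \<phi> v \<in> carrier L"
      unfolding linear_extension_def using supp[OF v]
      using free_module_closed[OF v] cl by (intro L.finsum_closed Pi_I L.smult_closed) blast+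
    {
      fix w assume w: "w \<in> carrier ?F"
      let ?S = "{x. v x \<noteq> \<zero>} \<union> {x. w x \<noteq> \<zero>}"
      have S: "finite ?S" "?S \<subseteq> X" using supp[OF v] supp[OF w] by auto
      have "linear_extension L \<phi> (v \<oplus>\<^bsub>?F\<^esub> w) = (\<Oplus>\<^bsub>L\<^esub>x\<in>?S. (v x \<oplus> w x) \<odot>\<^bsub>L\<^esub> \<phi> x)"
        using S F.a_closed[OF v w] by (subst sup[of _ ?S]) auto
      also have "\<dots> = (\<Oplus>\<^bsub>L\<^esub>x\<in>?S. v x \<odot>\<^bsub>L\<^esub> \<phi> x \<oplus>\<^bsub>L\<^esub> w x \<odot>\<^bsub>L\<^esub> \<phi> x)"
        using S free_module_closed[OF v] free_module_closed[OF w] cl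
        by (intro L.finsum_cong' Pi_I L.smult_l_distr L.a_closed L.smult_closed) blast+
      also have "\<dots> = (\<Oplus>\<^bsub>L\<^esub>x\<in>?S. v x \<odot>\<^bsub>L\<^esub> \<phi> x) \<oplus>\<^bsub>L\<^esub> (\<Oplus>\<^bsub>L\<^esub>x\<in>?S. w x \<odot>\<^bsub>L\<^esub> \<phi> x)"
        using S free_module_closed[OF v] free_module_closed[OF w] cl
        by (intro L.finsum_addf Pi_I L.smult_closed) blast+
      also have "\<dots> = linear_extension L \<phi> v \<oplus>\<^bsub>L\<^esub> linear_extension L \<phi> w"
        using sup[of v ?S] sup[of w ?S] S v w by simp
      finally show "linear_extension L \<phi> (v \<oplus>\<^bsub>?F\<^esub> w) =
        linear_extension L \<phi> v \<oplus>\<^bsub>L\<^esub> linear_extension L \<phi> w" .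
    }
    fix r assume r: "r \<in> carrier R"
    let ?S = "{x. v x \<noteq> \<zero>}"
    have "linear_extension L \<phi> (r \<odot>\<^bsub>?F\<^esub> v) = (\<Oplus>\<^bsub>L\<^esub>x\<in>?S. (r \<otimes> v x) \<odot>\<^bsub>L\<^esub> \<phi> x)"
      using supp[OF v] r F.smult_closed[OF r v] by (subst sup[of _ ?S]) auto
    also have "\<dots> = (\<Oplus>\<^bsub>L\<^esub>x\<in>?S. r \<odot>\<^bsub>L\<^esub> (v x \<odot>\<^bsub>L\<^esub> \<phi> x))"
      using supp[OF v] free_module_closed[OF v] r cl
      by (intro L.finsum_cong' Pi_I L.smult_assoc1 L.smult_closed) blast+
    also have "\<dots> = r \<odot>\<^bsub>L\<^esub> linear_extension L \<phi> v"
      unfolding linear_extension_def using supp[OF v] free_module_closed[OF v] r cl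
      by (intro L.finsum_smult_ldistr[symmetric] Pi_I L.smult_closed) blast+
    finally show "linear_extension L \<phi> (r \<odot>\<^bsub>?F\<^esub> v) = r \<odot>\<^bsub>L\<^esub> linear_extension L \<phi> v" .
  qed
qed

lemma linear_extension_basis:
  assumes "module R L" "\<phi> \<in> X \<rightarrow> carrier L" "x \<in> X"
  shows "linear_extension L \<phi> (basis_vec R x) = \<phi> x"
proof -
  interpret L: module R L by fact
  have "linear_extension L \<phi> (basis_vec R x) = (\<Oplus>\<^bsub>L\<^esub>y\<in>{x}. basis_vec R x y \<odot>\<^bsub>L\<^esub> \<phi> y)"
    using assms by (intro linear_extension_superset) (auto simp: basis_vec_closed, auto simp: basis_vec_def split: if_splits)
  also have "\<dots> = \<phi> x"
    using funcset_mem[OF assms(2,3)] by (subst L.finsum_insert) (auto simp: basis_vec_def)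
  finally show ?thesis .
qed

end

section \<open>Quotients by a submodule, and spans\<close>

lemma quotient_module_simps [simp]:
  "carrier (quotient_module R M H) = a_rcosets\<^bsub>M\<^esub> H"
  "zero (quotient_module R M H) = H"
  "add (quotient_module R M H) = set_add M"
  "smult (quotient_module R M H) = (\<lambda>r C. \<Union>c\<in>C. H +>\<^bsub>M\<^esub> (r \<odot>\<^bsub>M\<^esub> c))"
  by (simp_all add: quotient_module_def)

lemma (in base_module) submodule_abelian_subgroup:
  "submodule H R M \<Longrightarrow> abelian_subgroup H M"
  by (intro abelian_subgroupI3 additive_subgroupI M.abelian_group_axioms) (auto simp: submodule_def)

text \<open>Two representatives differ by some \<open>h \<in> H\<close>, and \<open>r\<close> times
  \<open>h\<close> is again in \<open>H\<close>; so all the sets in the union coincide. The union is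
  nonempty because \<open>x\<close> lies in its own coset.\<close>

lemma (in base_module) quotient_module_smult:
  assumes "submodule H R M" "r \<in> carrier R" "x \<in> carrier M"
  shows "(\<Union>c\<in>H +>\<^bsub>M\<^esub> x. H +>\<^bsub>M\<^esub> (r \<odot>\<^bsub>M\<^esub> c)) = H +>\<^bsub>M\<^esub> (r \<odot>\<^bsub>M\<^esub> x)"
proof -
  interpret H: abelian_subgroup H M using assms(1) by (rule submodule_abelian_subgroup)
  have "H +>\<^bsub>M\<^esub> (r \<odot>\<^bsub>M\<^esub> c) = H +>\<^bsub>M\<^esub> (r \<odot>\<^bsub>M\<^esub> x)" if "c \<in> H +>\<^bsub>M\<^esub> x" for c
  proof -
    from that obtain h where h: "h \<in> H" "c = h \<oplus>\<^bsub>M\<^esub> x" by (auto simp: a_r_coset_def')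
    have rh: "r \<odot>\<^bsub>M\<^esub> h \<in> H" using assms h by (simp add: submoduleE(4))
    have "r \<odot>\<^bsub>M\<^esub> c = r \<odot>\<^bsub>M\<^esub> h \<oplus>\<^bsub>M\<^esub> r \<odot>\<^bsub>M\<^esub> x"
      using assms h by (simp add: smult_r_distr)
    then have "r \<odot>\<^bsub>M\<^esub> c \<in> H +>\<^bsub>M\<^esub> (r \<odot>\<^bsub>M\<^esub> x)"
      using rh by (auto simp: a_r_coset_def')
    then show ?thesis
      using assms by (metis H.a_repr_independence' smult_closed)
  qed
  moreover have "x \<in> H +>\<^bsub>M\<^esub> x" using assms by (simp add: H.a_rcos_self)
  ultimately show ?thesis by blast
qed

lemma (in base_module) quotient_module_module:
  assumes H: "submodule H R M"
  shows "module R (quotient_module R M H)"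
proof -
  interpret H: abelian_subgroup H M using H by (rule submodule_abelian_subgroup)
  let ?Q = "quotient_module R M H"
  have sub: "H \<subseteq> carrier M" by (rule H.a_subset)
  have rep: "\<exists>x\<in>carrier M. C = H +>\<^bsub>M\<^esub> x" if "C \<in> carrier ?Q" for C
    using that by (auto simp: A_RCOSETS_def')
  have closed: "H +>\<^bsub>M\<^esub> x \<in> carrier ?Q" if "x \<in> carrier M" for x
    using that sub by (simp add: M.a_rcosetsI)
  have zero: "\<zero>\<^bsub>?Q\<^esub> = H +>\<^bsub>M\<^esub> \<zero>\<^bsub>M\<^esub>" using sub by simp
  have add: "(H +>\<^bsub>M\<^esub> x) \<oplus>\<^bsub>?Q\<^esub> (H +>\<^bsub>M\<^esub> y) = H +>\<^bsub>M\<^esub> (x \<oplus>\<^bsub>M\<^esub> y)"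
    if "x \<in> carrier M" "y \<in> carrier M" for x y
    using that by (simp add: H.a_rcos_sum)
  have smult: "r \<odot>\<^bsub>?Q\<^esub> (H +>\<^bsub>M\<^esub> x) = H +>\<^bsub>M\<^esub> (r \<odot>\<^bsub>M\<^esub> x)"
    if "r \<in> carrier R" "x \<in> carrier M" for r x
    using that H by (simp add: quotient_module_smult)
  note simps = zero add smult closed smult_l_distr smult_r_distr smult_assoc1
  show ?thesis
  proof (rule moduleI)
    show "cring R" by (rule is_cring)
    show "abelian_group ?Q"
    proof (rule abelian_groupI)
      fix C assume "C \<in> carrier ?Q"
      then obtain x where x: "x \<in> carrier M" "C = H +>\<^bsub>M\<^esub> x" using rep by auto
      show "\<exists>D\<in>carrier ?Q. D \<oplus>\<^bsub>?Q\<^esub> C = \<zero>\<^bsub>?Q\<^esub>"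
        using x
        by (intro bexI[of _ "H +>\<^bsub>M\<^esub> (\<ominus>\<^bsub>M\<^esub> x)"])
           (simp_all add: simps M.l_neg del: quotient_module_simps)
    next
      fix C D assume "C \<in> carrier ?Q" "D \<in> carrier ?Q"
      then obtain x y where "x \<in> carrier M" "C = H +>\<^bsub>M\<^esub> x" "y \<in> carrier M" "D = H +>\<^bsub>M\<^esub> y"
        using rep by metis
      then show "C \<oplus>\<^bsub>?Q\<^esub> D = D \<oplus>\<^bsub>?Q\<^esub> C"
        by (simp add: simps M.a_comm del: quotient_module_simps)
    qed (auto dest!: rep simp: simps M.a_assoc simp del: quotient_module_simps)
  qed (auto dest!: rep simp: simps simp del: quotient_module_simps)
qed

lemma (in base_module) quotient_map_linear:
  assumes H: "submodule H R M"
  shows "(\<lambda>x. H +>\<^bsub>M\<^esub> x) \<in> linear_maps R M (quotient_module R M H)"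
proof -
  interpret H: abelian_subgroup H M using H by (rule submodule_abelian_subgroup)
  show ?thesis
    by (rule linear_mapsI)
       (auto simp: H.a_rcos_sum quotient_module_smult[OF H] intro!: M.a_rcosetsI H.a_subset)
qed

lemma (in base_module) submodule_span_submodule:
  assumes "X \<subseteq> carrier M"
  shows "submodule (submodule_span R M X) R M"
  unfolding submodule_span_def
proof (rule submoduleI)
  \<comment> \<open>Since \<open>X\<close> lies in the carrier, the carrier is itself a member of
    the family; an empty family would have intersection \<open>UNIV\<close>.\<close>
  show "\<Inter> {H. submodule H R M \<and> X \<subseteq> H} \<subseteq> carrier M"
    using assms carrier_is_submodule by blast
  have "\<zero>\<^bsub>M\<^esub> \<in> H" if "submodule H R M" for H
  proof -
    interpret H: abelian_subgroup H M using that by (rule submodule_abelian_subgroup)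
    show ?thesis by simp
  qed
  then show "\<zero>\<^bsub>M\<^esub> \<in> \<Inter> {H. submodule H R M \<and> X \<subseteq> H}" by blast
qed (auto intro: submoduleE)

lemma submodule_span_incl: "X \<subseteq> submodule_span R M X"
  by (auto simp: submodule_span_def)

lemma submodule_span_least: "submodule H R M \<Longrightarrow> X \<subseteq> H \<Longrightarrow> submodule_span R M X \<subseteq> H"
  by (auto simp: submodule_span_def)

lemma linear_maps_kernel_submodule:
  assumes "module R M" "module R N" "f \<in> linear_maps R M N"
  shows "submodule {x \<in> carrier M. f x = \<zero>\<^bsub>N\<^esub>} R M"
proof -
  interpret M: module R M by fact
  interpret N: module R N by fact
  show ?thesis
    using assms
    by (intro M.submoduleI)
       (auto simp: linear_maps_zero linear_maps_a_inv linear_maps_add[OF assms(3)] linear_maps_smult[OF assms(3)])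
qed

section \<open>Presented modules and their universal property\<close>

context base_ring
begin

context
  fixes X :: "'x set" and E :: "('x \<Rightarrow> 'r) set"
  assumes E: "E \<subseteq> carrier (free_module R X)"
begin

lemma pres_module_module: "module R (pres_module R X E)"
  unfolding pres_module_def
  by (intro base_module.quotient_module_module base_module.submodule_span_submodule base_module.intro free_module_module E)

abbreviation (input) pres_quot where
  "pres_quot v \<equiv> submodule_span R (free_module R X) E +>\<^bsub>free_module R X\<^esub> v"

lemma pres_quot_linear: "pres_quot \<in> linear_maps R (free_module R X) (pres_module R X E)"
  unfolding pres_module_def
  by (intro base_module.quotient_map_linear base_module.submodule_span_submodule base_module.intro free_module_module E)

lemma pres_quot_rel:
  assumes "e \<in> E"
  shows "pres_quot e = \<zero>\<^bsub>pres_module R X E\<^esub>"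
proof -
  interpret F: base_module R "free_module R X" by (intro base_module.intro free_module_module)
  interpret H: abelian_subgroup "submodule_span R (free_module R X) E" "free_module R X"
    by (intro F.submodule_abelian_subgroup F.submodule_span_submodule E)
  have "e \<in> submodule_span R (free_module R X) E" using assms by (rule subsetD[OF submodule_span_incl])
  then show ?thesis unfolding pres_module_def
    unfolding quotient_module_simps by (rule H.a_rcos_const)
qed

lemma pres_gen_closed: "x \<in> X \<Longrightarrow> pres_gen R X E x \<in> carrier (pres_module R X E)"
  unfolding pres_gen_def by (rule linear_maps_closed[OF pres_quot_linear basis_vec_closed])

lemma pres_module_carrier: "carrier (pres_module R X E) = pres_quot ` carrier (free_module R X)"
  by (auto simp: pres_module_def A_RCOSETS_def')

text \<open>Pulled back along the quotient map from \<open>free_module_induct\<close>. Besides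
  equations it serves for properties such as linearity in a further argument, to which
  \<open>pres_module_ext\<close> does not apply directly.\<close>

lemma pres_module_induct [consumes 1, case_names zero gen add smult]:
  assumes c: "c \<in> carrier (pres_module R X E)"
    and zero: "P \<zero>\<^bsub>pres_module R X E\<^esub>"
    and gen: "\<And>x. x \<in> X \<Longrightarrow> P (pres_gen R X E x)"
    and add: "\<And>c d. c \<in> carrier (pres_module R X E) \<Longrightarrow> d \<in> carrier (pres_module R X E) \<Longrightarrow>
      P c \<Longrightarrow> P d \<Longrightarrow> P (c \<oplus>\<^bsub>pres_module R X E\<^esub> d)"
    and smult: "\<And>r c. r \<in> carrier R \<Longrightarrow> c \<in> carrier (pres_module R X E) \<Longrightarrow> P c \<Longrightarrow>
      P (r \<odot>\<^bsub>pres_module R X E\<^esub> c)"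
  shows "P c"
proof -
  note lin = pres_quot_linear
  from c obtain v where v: "v \<in> carrier (free_module R X)" "c = pres_quot v"
    using pres_module_carrier by auto
  from v(1) have "P (pres_quot v)"
  proof (induction rule: free_module_induct)
    case zero
    then show ?case
      using assms(2) linear_maps_zero[OF free_module_module pres_module_module lin] by simp
  next
    case (basis x)
    then show ?case using gen by (simp add: pres_gen_def)
  next
    case (add v w)
    then show ?case
      using assms(4) by (metis linear_maps_add[OF lin] linear_maps_closed[OF lin])
  next
    case (smult r v)
    then show ?case
      using assms(5) by (metis linear_maps_smult[OF lin] linear_maps_closed[OF lin])
  qed
  then show ?thesis using v by simp
qed

lemma pres_module_ext:
  assumes "module R L" "f \<in> linear_maps R (pres_module R X E) L" "g \<in> linear_maps R (pres_module R X E) L"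
    and "\<And>x. x \<in> X \<Longrightarrow> f (pres_gen R X E x) = g (pres_gen R X E x)"
    and "c \<in> carrier (pres_module R X E)"
  shows "f c = g c"
  using assms(5)
proof (induction rule: pres_module_induct)
  case zero
  then show ?case
    by (simp add: linear_maps_zero[OF pres_module_module assms(1,2)]
        linear_maps_zero[OF pres_module_module assms(1,3)])
next
  case (gen x)
  then show ?case by (rule assms(4))
next
  case (add c d)
  then show ?case by (simp add: linear_maps_add[OF assms(2)] linear_maps_add[OF assms(3)])
next
  case (smult r c)
  then show ?case by (simp add: linear_maps_smult[OF assms(2)] linear_maps_smult[OF assms(3)])
qed

end

text \<open>The condition that makes \<open>pres_lift\<close> well defined: the linear extension of
  \<open>\<phi>\<close> vanishes on the relations.\<close>

definition satisfies :: "'x set \<Rightarrow> ('x \<Rightarrow> 'r) set \<Rightarrow> ('r, 'b) module \<Rightarrow> ('x \<Rightarrow> 'b) \<Rightarrow> bool" where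
  "satisfies X E L \<phi> \<longleftrightarrow>
    \<phi> \<in> X \<rightarrow> carrier L \<and> (\<forall>e\<in>E. linear_extension L \<phi> e = \<zero>\<^bsub>L\<^esub>)"

context
  fixes X :: "'x set" and E :: "('x \<Rightarrow> 'r) set"
    and L :: "('r, 'b) module" and \<phi> :: "'x \<Rightarrow> 'b"
  assumes E: "E \<subseteq> carrier (free_module R X)" and L: "module R L" and sat: "satisfies X E L \<phi>"
begin

text \<open>The kernel of the linear extension is a submodule containing \<open>E\<close>, hence
  contains the span, which is the least such submodule. So the linear extension is constant on the
  coset, and \<open>the_elem\<close> returns that constant.\<close>

lemma pres_lift_quot:
  assumes v: "v \<in> carrier (free_module R X)"
  shows "pres_lift R L \<phi> (submodule_span R (free_module R X) E +>\<^bsub>free_module R X\<^esub> v) =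
    linear_extension L \<phi> v"
proof -
  let ?F = "free_module R X"
  let ?H = "submodule_span R ?F E"
  interpret L: module R L by (rule L)
  interpret F: base_module R ?F by (intro base_module.intro free_module_module)
  interpret H: abelian_subgroup ?H ?F
    by (intro F.submodule_abelian_subgroup F.submodule_span_submodule E)
  have lin: "linear_extension L \<phi> \<in> linear_maps R ?F L"
    using L sat by (intro linear_extension_linear) (auto simp: satisfies_def)
  have "?H \<subseteq> {v \<in> carrier ?F. linear_extension L \<phi> v = \<zero>\<^bsub>L\<^esub>}"
    using sat E by (intro submodule_span_least linear_maps_kernel_submodule free_module_module L lin)
      (auto simp: satisfies_def)
  then have "linear_extension L \<phi> (h \<oplus>\<^bsub>?F\<^esub> v) = linear_extension L \<phi> v" if "h \<in> ?H" for h
    using that v linear_maps_closed[OF lin v] by (subst linear_maps_add[OF lin]) auto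
  then have "linear_extension L \<phi> w = linear_extension L \<phi> v" if "w \<in> ?H +>\<^bsub>?F\<^esub> v" for w
    using that by (auto simp: a_r_coset_def')
  then have "linear_extension L \<phi> ` (?H +>\<^bsub>?F\<^esub> v) = (\<lambda>_. linear_extension L \<phi> v) ` (?H +>\<^bsub>?F\<^esub> v)"
    by (intro image_cong refl)
  \<comment> \<open>The coset contains \<open>v\<close>, so the image of the constant map is a
    singleton and not empty.\<close>
  also have "\<dots> = {linear_extension L \<phi> v}"
    using H.a_rcos_self[OF v] by (rule image_constant)
  finally have "linear_extension L \<phi> ` (?H +>\<^bsub>?F\<^esub> v) = {linear_extension L \<phi> v}" .
  then show ?thesis
    unfolding pres_lift_def linear_extension_def by simp
qed

lemma pres_lift_gen:
  assumes x: "x \<in> X"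
  shows "pres_lift R L \<phi> (pres_gen R X E x) = \<phi> x"
  unfolding pres_gen_def
  using sat unfolding satisfies_def
  by (subst pres_lift_quot) (auto intro: basis_vec_closed linear_extension_basis L x)

lemma pres_lift_linear: "pres_lift R L \<phi> \<in> linear_maps R (pres_module R X E) L"
proof -
  let ?F = "free_module R X"
  interpret F: module R ?F by (rule free_module_module)
  note q = pres_quot_linear[OF E]
  have lin: "linear_extension L \<phi> \<in> linear_maps R ?F L"
    using L sat by (intro linear_extension_linear) (auto simp: satisfies_def)
  show ?thesis
  proof (rule linear_mapsI)
    fix c assume "c \<in> carrier (pres_module R X E)"
    then obtain v where v: "v \<in> carrier ?F" "c = submodule_span R ?F E +>\<^bsub>?F\<^esub> v"
      using pres_module_carrier[OF E] by auto
    show "pres_lift R L \<phi> c \<in> carrier L"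
      using linear_maps_closed[OF lin] v by (simp add: pres_lift_quot)
    {
      fix d assume "d \<in> carrier (pres_module R X E)"
      then obtain w where w: "w \<in> carrier ?F" "d = submodule_span R ?F E +>\<^bsub>?F\<^esub> w"
        using pres_module_carrier[OF E] by auto
      show "pres_lift R L \<phi> (c \<oplus>\<^bsub>pres_module R X E\<^esub> d) = pres_lift R L \<phi> c \<oplus>\<^bsub>L\<^esub> pres_lift R L \<phi> d"
        using linear_maps_add[OF lin v(1) w(1)] v w F.a_closed[OF v(1) w(1)]
        by (simp add: pres_lift_quot linear_maps_add[OF q, symmetric])
    }
    fix r assume r: "r \<in> carrier R"
    show "pres_lift R L \<phi> (r \<odot>\<^bsub>pres_module R X E\<^esub> c) = r \<odot>\<^bsub>L\<^esub> pres_lift R L \<phi> c"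
      using linear_maps_smult[OF lin r v(1)] v r F.smult_closed[OF r v(1)]
      by (simp add: pres_lift_quot linear_maps_smult[OF q, symmetric])
  qed
qed

end

text \<open>Needed when the values being extended are themselves lifts evaluated at a variable
  argument \<open>y\<close>: the extension at a fixed vector is then linear in \<open>y\<close>, by
  induction on the vector.\<close>

lemma linear_extension_linear_in_map:
  fixes L :: "('r, 'c) module" and \<phi> :: "'k \<Rightarrow> 'x \<Rightarrow> 'c" and K :: "('r, 'k) module"
  assumes "module R L" "module R K" "\<And>y. y \<in> carrier K \<Longrightarrow> \<phi> y \<in> X \<rightarrow> carrier L"
    "\<And>x. x \<in> X \<Longrightarrow> (\<lambda>y. \<phi> y x) \<in> linear_maps R K L"
    and v: "v \<in> carrier (free_module R X)"
  shows "(\<lambda>y. linear_extension L (\<phi> y) v) \<in> linear_maps R K L"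
proof -
  interpret L: module R L by fact
  interpret K: module R K by fact
  note lin = linear_extension_linear[OF assms(1) assms(3)]
  show ?thesis using v
  proof (induction rule: free_module_induct)
    case zero
    have "linear_extension L \<psi> (\<lambda>_. \<zero>) = \<zero>\<^bsub>L\<^esub>" for \<psi> :: "'x \<Rightarrow> 'c"
      by (simp add: linear_extension_def)
    then show ?case by (simp add: linear_maps_const_zero assms)
  next
    case (basis x)
    show ?case
      by (rule linear_maps_cong[OF assms(2) assms(4)[OF basis]])
         (rule linear_extension_basis[OF assms(1) assms(3) basis])
  next
    case (add v w)
    show ?case
      by (rule linear_maps_cong[OF assms(2) linear_maps_plus[OF assms(1) add.IH]])
         (rule linear_maps_add[OF lin add.hyps])
  next
    case (smult r v)
    show ?case
      by (rule linear_maps_cong[OF assms(2) linear_maps_scale[OF assms(1) smult.IH smult.hyps(1)]])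
         (rule linear_maps_smult[OF lin smult.hyps])
  qed
qed

end

definition bilinear_maps ::
  "'r ring \<Rightarrow> ('r, 'a) module \<Rightarrow> ('r, 'b) module \<Rightarrow> ('r, 'c) module \<Rightarrow> ('a \<Rightarrow> 'b \<Rightarrow> 'c) set" where
  "bilinear_maps R M N L =
    {\<beta>. (\<forall>x\<in>carrier M. \<beta> x \<in> linear_maps R N L) \<and> (\<forall>y\<in>carrier N. (\<lambda>x. \<beta> x y) \<in> linear_maps R M L)}"

context base_ring
begin

text \<open>This is the well-definedness of a product given by a lift inside a lift. The inner lift
  respects \<open>D\<close> by \<open>l\<close>. For the outer one fix a relation
  \<open>e \<in> E\<close>: its value is linear in \<open>d\<close>, and on a generator
  \<open>d\<close> it vanishes by \<open>r\<close>; hence it vanishes for every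
  \<open>d\<close>.\<close>

lemma
  assumes E: "E \<subseteq> carrier (free_module R X)" and D: "D \<subseteq> carrier (free_module R Y)"
    and L: "module R L"
    and l: "\<And>x. x \<in> X \<Longrightarrow> satisfies Y D L (\<phi> x)"
    and r: "\<And>y. y \<in> Y \<Longrightarrow> satisfies X E L (\<lambda>x. \<phi> x y)"
  defines "\<beta> \<equiv> \<lambda>c d. pres_lift R L (\<lambda>x. pres_lift R L (\<phi> x) d) c"
  shows pres_bilift_bilinear: "\<beta> \<in> bilinear_maps R (pres_module R X E) (pres_module R Y D) L"
    and pres_bilift_gen: "x \<in> X \<Longrightarrow> y \<in> Y \<Longrightarrow> \<beta> (pres_gen R X E x) (pres_gen R Y D y) = \<phi> x y"
proof -
  let ?PX = "pres_module R X E" and ?PY = "pres_module R Y D"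
  interpret L: module R L by fact
  note lin = pres_lift_linear[OF D L l]
  have cl: "(\<lambda>x. pres_lift R L (\<phi> x) d) \<in> X \<rightarrow> carrier L" if "d \<in> carrier ?PY" for d
    using linear_maps_closed[OF lin that] by auto
  have sat: "satisfies X E L (\<lambda>x. pres_lift R L (\<phi> x) d)" if d: "d \<in> carrier ?PY" for d
  proof -
    have "linear_extension L (\<lambda>x. pres_lift R L (\<phi> x) d) e = \<zero>\<^bsub>L\<^esub>" if e: "e \<in> E" for e
    proof -
      have ev: "e \<in> carrier (free_module R X)" using e E by blast
      have supp: "{x. e x \<noteq> \<zero>} \<subseteq> X" using ev by (auto simp: free_module_carrier)
      have "(\<lambda>d. linear_extension L (\<lambda>x. pres_lift R L (\<phi> x) d) e) \<in> linear_maps R ?PY L"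
        using cl lin ev
        by (intro linear_extension_linear_in_map[where X = X] L pres_module_module D) auto
      moreover have "linear_extension L (\<lambda>x. pres_lift R L (\<phi> x) (pres_gen R Y D y)) e = \<zero>\<^bsub>L\<^esub>"
        if y: "y \<in> Y" for y
      proof -
        have "linear_extension L (\<lambda>x. pres_lift R L (\<phi> x) (pres_gen R Y D y)) e =
            linear_extension L (\<lambda>x. \<phi> x y) e"
          unfolding linear_extension_def
          using supp r[OF y] free_module_closed[OF ev] y
          by (intro L.finsum_cong') (auto simp: satisfies_def pres_lift_gen[OF D L l])
        also have "\<dots> = \<zero>\<^bsub>L\<^esub>" using r[OF y] e by (auto simp: satisfies_def)
        finally show ?thesis .
      qed
      ultimately show ?thesis
        using d pres_module_ext[OF D L _ linear_maps_const_zero[OF L]] by auto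
    qed
    then show ?thesis using cl d by (auto simp: satisfies_def)
  qed
  note lin' = pres_lift_linear[OF E L sat]
  have PY: "module R ?PY" by (rule pres_module_module[OF D])
  have \<beta>_gen: "\<beta> (pres_gen R X E x) d = pres_lift R L (\<phi> x) d" if "x \<in> X" "d \<in> carrier ?PY" for x d
    unfolding \<beta>_def using that by (simp add: pres_lift_gen[OF E L sat])
  show "\<beta> (pres_gen R X E x) (pres_gen R Y D y) = \<phi> x y" if "x \<in> X" "y \<in> Y" for x y
    using that by (simp add: \<beta>_gen pres_gen_closed D pres_lift_gen[OF D L l])
  \<comment> \<open>In \<open>\<beta> c d\<close> the argument \<open>d\<close> sits inside the
    lifted function, so linearity in \<open>d\<close> is obtained by induction on \<open>c\<close>,
    linear maps being closed under sums and multiples.\<close>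
  have "\<beta> c \<in> linear_maps R ?PY L" if "c \<in> carrier ?PX" for c
    using that
  proof (induction rule: pres_module_induct[OF E, consumes 1, case_names zero gen add smult])
    case zero
    have "\<beta> \<zero>\<^bsub>?PX\<^esub> d = \<zero>\<^bsub>L\<^esub>" if "d \<in> carrier ?PY" for d
      unfolding \<beta>_def using that by (intro linear_maps_zero[OF _ _ lin'] L pres_module_module E)
    then show ?case
      by (intro linear_maps_cong[OF PY linear_maps_const_zero[OF L]]) auto
  next
    case (gen x)
    show ?case
      by (rule linear_maps_cong[OF PY lin[OF gen] \<beta>_gen[OF gen]])
  next
    case (add c c')
    have "\<beta> (c \<oplus>\<^bsub>?PX\<^esub> c') d = \<beta> c d \<oplus>\<^bsub>L\<^esub> \<beta> c' d" if "d \<in> carrier ?PY" for d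
      unfolding \<beta>_def using add that by (intro linear_maps_add[OF lin'])
    then show ?case
      by (intro linear_maps_cong[OF PY linear_maps_plus[OF L add.IH]])
  next
    case (smult r c)
    have "\<beta> (r \<odot>\<^bsub>?PX\<^esub> c) d = r \<odot>\<^bsub>L\<^esub> \<beta> c d" if "d \<in> carrier ?PY" for d
      unfolding \<beta>_def using smult that by (intro linear_maps_smult[OF lin'])
    then show ?case
      using smult by (intro linear_maps_cong[OF PY linear_maps_scale[OF L smult.IH]])
  qed
  then show "\<beta> \<in> bilinear_maps R ?PX ?PY L"
    using lin' by (auto simp: bilinear_maps_def \<beta>_def)
qed

end

declare free_module_simps [simp del] quotient_module_simps [simp del]


section \<open>Relations of the shapes \<open>x - (y + z)\<close>, \<open>x - r y\<close> and
  \<open>x - y\<close>\<close>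

lemma (in abelian_group) minus_eq_zero_iff:
  "x \<in> carrier G \<Longrightarrow> y \<in> carrier G \<Longrightarrow> x \<ominus> y = \<zero> \<longleftrightarrow> x = y"
  by (metis a_inv_closed minus_eq minus_equality minus_minus r_neg a_comm)

context base_ring
begin

text \<open>Every relation in the presentations of tensor products, tensor powers and symmetric
  algebras has one of these shapes. Thus \<open>satisfies\<close> reduces to additivity, homogeneity
  and, for \<open>Sym\<close>, invariance under a swap.\<close>

lemma
  assumes L: "module R L" and \<phi>: "\<phi> \<in> X \<rightarrow> carrier L" and X: "x \<in> X" "y \<in> X"
  shows linear_extension_rel_add: "z \<in> X \<Longrightarrow>
      linear_extension L \<phi> (basis_vec R x \<ominus>\<^bsub>free_module R X\<^esub>
        (basis_vec R y \<oplus>\<^bsub>free_module R X\<^esub> basis_vec R z)) = \<zero>\<^bsub>L\<^esub> \<longleftrightarrow> \<phi> x = \<phi> y \<oplus>\<^bsub>L\<^esub> \<phi> z"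
    and linear_extension_rel_smult: "r \<in> carrier R \<Longrightarrow>
      linear_extension L \<phi> (basis_vec R x \<ominus>\<^bsub>free_module R X\<^esub>
        (r \<odot>\<^bsub>free_module R X\<^esub> basis_vec R y)) = \<zero>\<^bsub>L\<^esub> \<longleftrightarrow> \<phi> x = r \<odot>\<^bsub>L\<^esub> \<phi> y"
    and linear_extension_rel_eq:
      "linear_extension L \<phi> (basis_vec R x \<ominus>\<^bsub>free_module R X\<^esub> basis_vec R y) = \<zero>\<^bsub>L\<^esub> \<longleftrightarrow> \<phi> x = \<phi> y"
proof -
  let ?F = "free_module R X"
  interpret L: module R L by (rule L)
  interpret F: module R ?F by (rule free_module_module)
  note lin = linear_extension_linear[OF L \<phi>]
  note simps = linear_maps_minus[OF free_module_module L lin] linear_maps_add[OF lin]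
    linear_maps_smult[OF lin] basis_vec_closed linear_extension_basis[OF L \<phi>] L.minus_eq_zero_iff
  have cl: "\<phi> w \<in> carrier L" if "w \<in> X" for w using \<phi> that by (rule funcset_mem)
  show "z \<in> X \<Longrightarrow> linear_extension L \<phi> (basis_vec R x \<ominus>\<^bsub>?F\<^esub>
      (basis_vec R y \<oplus>\<^bsub>?F\<^esub> basis_vec R z)) = \<zero>\<^bsub>L\<^esub> \<longleftrightarrow> \<phi> x = \<phi> y \<oplus>\<^bsub>L\<^esub> \<phi> z"
    using X cl by (simp add: simps)
  show "r \<in> carrier R \<Longrightarrow> linear_extension L \<phi> (basis_vec R x \<ominus>\<^bsub>?F\<^esub>
        (r \<odot>\<^bsub>?F\<^esub> basis_vec R y)) = \<zero>\<^bsub>L\<^esub> \<longleftrightarrow> \<phi> x = r \<odot>\<^bsub>L\<^esub> \<phi> y"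
    using X cl by (simp add: simps)
  show "linear_extension L \<phi> (basis_vec R x \<ominus>\<^bsub>?F\<^esub> basis_vec R y) = \<zero>\<^bsub>L\<^esub> \<longleftrightarrow> \<phi> x = \<phi> y"
    using X cl by (simp add: simps)
qed

lemma
  assumes X: "x \<in> X" "y \<in> X"
  shows free_rel_add_closed: "z \<in> X \<Longrightarrow> basis_vec R x \<ominus>\<^bsub>free_module R X\<^esub>
        (basis_vec R y \<oplus>\<^bsub>free_module R X\<^esub> basis_vec R z) \<in> carrier (free_module R X)"
    and free_rel_smult_closed: "r \<in> carrier R \<Longrightarrow> basis_vec R x \<ominus>\<^bsub>free_module R X\<^esub>
        (r \<odot>\<^bsub>free_module R X\<^esub> basis_vec R y) \<in> carrier (free_module R X)"
    and free_rel_eq_closed: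
      "basis_vec R x \<ominus>\<^bsub>free_module R X\<^esub> basis_vec R y \<in> carrier (free_module R X)"
proof -
  let ?F = "free_module R X"
  interpret F: module R ?F by (rule free_module_module)
  show "z \<in> X \<Longrightarrow> basis_vec R x \<ominus>\<^bsub>?F\<^esub>
        (basis_vec R y \<oplus>\<^bsub>?F\<^esub> basis_vec R z) \<in> carrier (?F)"
    "r \<in> carrier R \<Longrightarrow> basis_vec R x \<ominus>\<^bsub>?F\<^esub>
        (r \<odot>\<^bsub>?F\<^esub> basis_vec R y) \<in> carrier (?F)"
    "basis_vec R x \<ominus>\<^bsub>?F\<^esub> basis_vec R y \<in> carrier (?F)"
    using X by (simp_all add: basis_vec_closed)
qed

text \<open>The counterpart on the side of the presented module: the quotient map kills the
  relation, so the generators obey the corresponding identity.\<close>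

lemma
  assumes E: "E \<subseteq> carrier (free_module R X)" and X: "x \<in> X" "y \<in> X"
  shows pres_gen_add: "z \<in> X \<Longrightarrow> basis_vec R x \<ominus>\<^bsub>free_module R X\<^esub>
      (basis_vec R y \<oplus>\<^bsub>free_module R X\<^esub> basis_vec R z) \<in> E \<Longrightarrow>
      pres_gen R X E x = pres_gen R X E y \<oplus>\<^bsub>pres_module R X E\<^esub> pres_gen R X E z"
    and pres_gen_smult: "r \<in> carrier R \<Longrightarrow> basis_vec R x \<ominus>\<^bsub>free_module R X\<^esub>
      (r \<odot>\<^bsub>free_module R X\<^esub> basis_vec R y) \<in> E \<Longrightarrow>
      pres_gen R X E x = r \<odot>\<^bsub>pres_module R X E\<^esub> pres_gen R X E y"
    and pres_gen_eq: "basis_vec R x \<ominus>\<^bsub>free_module R X\<^esub> basis_vec R y \<in> E \<Longrightarrow>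
      pres_gen R X E x = pres_gen R X E y"
proof -
  let ?F = "free_module R X" and ?P = "pres_module R X E"
  interpret P: module R ?P by (rule pres_module_module[OF E])
  interpret F: module R ?F by (rule free_module_module)
  note lin = pres_quot_linear[OF E]
  note simps = pres_gen_def linear_maps_minus[OF free_module_module pres_module_module[OF E] lin]
    linear_maps_add[OF lin] linear_maps_smult[OF lin] linear_maps_closed[OF lin]
    basis_vec_closed P.minus_eq_zero_iff
  show "z \<in> X \<Longrightarrow> basis_vec R x \<ominus>\<^bsub>?F\<^esub>
      (basis_vec R y \<oplus>\<^bsub>?F\<^esub> basis_vec R z) \<in> E \<Longrightarrow>
      pres_gen R X E x = pres_gen R X E y \<oplus>\<^bsub>?P\<^esub> pres_gen R X E z"
    using X by (drule_tac pres_quot_rel[OF E]) (simp add: simps)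
  show "r \<in> carrier R \<Longrightarrow> basis_vec R x \<ominus>\<^bsub>?F\<^esub>
      (r \<odot>\<^bsub>?F\<^esub> basis_vec R y) \<in> E \<Longrightarrow>
      pres_gen R X E x = r \<odot>\<^bsub>?P\<^esub> pres_gen R X E y"
    using X by (drule_tac pres_quot_rel[OF E]) (simp add: simps)
  show "basis_vec R x \<ominus>\<^bsub>?F\<^esub> basis_vec R y \<in> E \<Longrightarrow>
      pres_gen R X E x = pres_gen R X E y"
    using X by (drule_tac pres_quot_rel[OF E]) (simp add: simps)
qed

end


section \<open>Bilinear maps and tensor products\<close>

lemma bilinear_mapsI:
  assumes "\<And>x. x \<in> carrier M \<Longrightarrow> \<beta> x \<in> linear_maps R N L"
    and "\<And>y. y \<in> carrier N \<Longrightarrow> (\<lambda>x. \<beta> x y) \<in> linear_maps R M L"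
  shows "\<beta> \<in> bilinear_maps R M N L"
  using assms by (simp add: bilinear_maps_def)

lemma bilinear_maps_right: "\<beta> \<in> bilinear_maps R M N L \<Longrightarrow> x \<in> carrier M \<Longrightarrow> \<beta> x \<in> linear_maps R N L"
  by (simp add: bilinear_maps_def)

lemma bilinear_maps_left:
  "\<beta> \<in> bilinear_maps R M N L \<Longrightarrow> y \<in> carrier N \<Longrightarrow> (\<lambda>x. \<beta> x y) \<in> linear_maps R M L"
  by (simp add: bilinear_maps_def)

lemma bilinear_maps_closed:
  "\<beta> \<in> bilinear_maps R M N L \<Longrightarrow> x \<in> carrier M \<Longrightarrow> y \<in> carrier N \<Longrightarrow> \<beta> x y \<in> carrier L"
  by (rule linear_maps_closed[OF bilinear_maps_right])

lemma bilinear_maps_flip: "\<beta> \<in> bilinear_maps R M N L \<Longrightarrow> (\<lambda>x y. \<beta> y x) \<in> bilinear_maps R N M L"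
  by (simp add: bilinear_maps_def)

lemma bilinear_maps_comp:
  assumes "\<beta> \<in> bilinear_maps R M' N' L" "f \<in> linear_maps R M M'" "g \<in> linear_maps R N N'"
  shows "(\<lambda>x y. \<beta> (f x) (g y)) \<in> bilinear_maps R M N L"
  by (intro bilinear_mapsI linear_maps_comp[OF assms(3) bilinear_maps_right[OF assms(1)]]
      linear_maps_comp[OF assms(2) bilinear_maps_left[OF assms(1)]]
      linear_maps_closed[OF assms(2)] linear_maps_closed[OF assms(3)])

lemma linear_maps_bilinear_comp:
  assumes "\<beta> \<in> bilinear_maps R M N L" "h \<in> linear_maps R L L'"
  shows "(\<lambda>x y. h (\<beta> x y)) \<in> bilinear_maps R M N L'"
  by (intro bilinear_mapsI linear_maps_comp[OF bilinear_maps_right[OF assms(1)] assms(2)]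
      linear_maps_comp[OF bilinear_maps_left[OF assms(1)] assms(2)])

context base_ring
begin

lemma bilinear_rels_closed:
  assumes "module R M" "module R N"
  shows "bilinear_rels R M N \<subseteq> carrier (free_module R (carrier M \<times> carrier N))"
proof -
  interpret M: module R M by fact
  interpret N: module R N by fact
  show ?thesis
    unfolding bilinear_rels_def Let_def
    by (intro Un_least subsetI)
       (elim CollectE exE conjE; simp add: free_rel_add_closed free_rel_smult_closed)+
qed

lemma bilinear_maps_satisfies:
  assumes M: "module R M" and N: "module R N" and L: "module R L"
    and \<phi>: "\<phi> \<in> bilinear_maps R M N L"
  shows "satisfies (carrier M \<times> carrier N) (bilinear_rels R M N) L (\<lambda>(a, b). \<phi> a b)"
proof -
  interpret M: module R M by fact
  interpret N: module R N by fact
  have cl: "(\<lambda>(a, b). \<phi> a b) \<in> carrier M \<times> carrier N \<rightarrow> carrier L"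
    using bilinear_maps_closed[OF \<phi>] by auto
  note l = bilinear_maps_left[OF \<phi>] and r = bilinear_maps_right[OF \<phi>]
  have "linear_extension L (\<lambda>(a, b). \<phi> a b) e = \<zero>\<^bsub>L\<^esub>" if "e \<in> bilinear_rels R M N" for e
    using that unfolding bilinear_rels_def Let_def
    by (elim UnE CollectE exE conjE;
        simp add: linear_extension_rel_add[OF L cl] linear_extension_rel_smult[OF L cl]
          linear_maps_add[OF l] linear_maps_smult[OF l] linear_maps_add[OF r] linear_maps_smult[OF r])
  then show ?thesis using cl by (simp add: satisfies_def)
qed

lemma tensor_module_module: "module R M \<Longrightarrow> module R N \<Longrightarrow> module R (tensor_module R M N)"
  unfolding tensor_module_def by (intro pres_module_module bilinear_rels_closed)

lemma tens_bilinear: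
  assumes M: "module R M" and N: "module R N"
  shows "tens R M N \<in> bilinear_maps R M N (tensor_module R M N)"
proof -
  interpret M: module R M by fact
  interpret N: module R N by fact
  let ?E = "bilinear_rels R M N"
  let ?F = "free_module R (carrier M \<times> carrier N)"
  note E = bilinear_rels_closed[OF M N]
  have rel1: "basis_vec R (a \<oplus>\<^bsub>M\<^esub> a', b) \<ominus>\<^bsub>?F\<^esub> (basis_vec R (a, b) \<oplus>\<^bsub>?F\<^esub> basis_vec R (a', b)) \<in> ?E"
    if "a \<in> carrier M" "a' \<in> carrier M" "b \<in> carrier N" for a a' b
    using that unfolding bilinear_rels_def Let_def by blast
  have rel2: "basis_vec R (a, b \<oplus>\<^bsub>N\<^esub> b') \<ominus>\<^bsub>?F\<^esub> (basis_vec R (a, b) \<oplus>\<^bsub>?F\<^esub> basis_vec R (a, b')) \<in> ?E"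
    if "a \<in> carrier M" "b \<in> carrier N" "b' \<in> carrier N" for a b b'
    using that unfolding bilinear_rels_def Let_def by blast
  have rel3: "basis_vec R (r \<odot>\<^bsub>M\<^esub> a, b) \<ominus>\<^bsub>?F\<^esub> (r \<odot>\<^bsub>?F\<^esub> basis_vec R (a, b)) \<in> ?E"
    if "r \<in> carrier R" "a \<in> carrier M" "b \<in> carrier N" for r a b
    using that unfolding bilinear_rels_def Let_def by blast
  have rel4: "basis_vec R (a, r \<odot>\<^bsub>N\<^esub> b) \<ominus>\<^bsub>?F\<^esub> (r \<odot>\<^bsub>?F\<^esub> basis_vec R (a, b)) \<in> ?E"
    if "r \<in> carrier R" "a \<in> carrier M" "b \<in> carrier N" for r a b
    using that unfolding bilinear_rels_def Let_def by blast
  show ?thesis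
    unfolding tens_def tensor_module_def
    by (intro bilinear_mapsI linear_mapsI pres_gen_add[OF E] pres_gen_smult[OF E] pres_gen_closed[OF E]
        rel1 rel2 rel3 rel4) auto
qed

lemma
  assumes M: "module R M" and N: "module R N" and L: "module R L"
    and \<phi>: "\<phi> \<in> bilinear_maps R M N L"
  shows tensor_lift_linear: "tensor_lift R L \<phi> \<in> linear_maps R (tensor_module R M N) L"
    and tensor_lift_tens: "a \<in> carrier M \<Longrightarrow> b \<in> carrier N \<Longrightarrow> tensor_lift R L \<phi> (tens R M N a b) = \<phi> a b"
  unfolding tensor_lift_def tensor_module_def tens_def
  using pres_lift_linear[OF bilinear_rels_closed[OF M N] L bilinear_maps_satisfies[OF M N L \<phi>]]
    pres_lift_gen[OF bilinear_rels_closed[OF M N] L bilinear_maps_satisfies[OF M N L \<phi>], of "(a, b)"]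
  by simp_all

lemma tensor_induct [consumes 3, case_names zero tens add smult]:
  assumes M: "module R M" and N: "module R N"
    and t: "t \<in> carrier (tensor_module R M N)"
    and zero: "P \<zero>\<^bsub>tensor_module R M N\<^esub>"
    and tens: "\<And>a b. a \<in> carrier M \<Longrightarrow> b \<in> carrier N \<Longrightarrow> P (tens R M N a b)"
    and add: "\<And>s t. s \<in> carrier (tensor_module R M N) \<Longrightarrow> t \<in> carrier (tensor_module R M N) \<Longrightarrow>
      P s \<Longrightarrow> P t \<Longrightarrow> P (s \<oplus>\<^bsub>tensor_module R M N\<^esub> t)"
    and smult: "\<And>r t. r \<in> carrier R \<Longrightarrow> t \<in> carrier (tensor_module R M N) \<Longrightarrow> P t \<Longrightarrow>
      P (r \<odot>\<^bsub>tensor_module R M N\<^esub> t)"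
  shows "P t"
proof -
  note * = t zero add smult tens
  note * = *[unfolded tensor_module_def tens_def]
  show ?thesis
  proof (rule pres_module_induct[OF bilinear_rels_closed[OF M N] *(1,2) _ *(3,4)])
    show "P (pres_gen R (carrier M \<times> carrier N) (bilinear_rels R M N) x)"
      if "x \<in> carrier M \<times> carrier N" for x
      using that *(5)[of "fst x" "snd x"] by auto
  qed
qed

lemma tensor_ext:
  assumes M: "module R M" and N: "module R N" and L: "module R L"
    and f: "f \<in> linear_maps R (tensor_module R M N) L" and g: "g \<in> linear_maps R (tensor_module R M N) L"
    and eq: "\<And>a b. a \<in> carrier M \<Longrightarrow> b \<in> carrier N \<Longrightarrow> f (tens R M N a b) = g (tens R M N a b)"
    and t: "t \<in> carrier (tensor_module R M N)"
  shows "f t = g t"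
proof -
  note * = f g t eq
  note * = *[unfolded tensor_module_def tens_def]
  show ?thesis
    by (rule pres_module_ext[OF bilinear_rels_closed[OF M N] L *(1,2) _ *(3)]) (auto intro: *(4))
qed

lemma tens_closed:
  "module R M \<Longrightarrow> module R N \<Longrightarrow> a \<in> carrier M \<Longrightarrow> b \<in> carrier N \<Longrightarrow>
    tens R M N a b \<in> carrier (tensor_module R M N)"
  by (rule bilinear_maps_closed[OF tens_bilinear])

text \<open>The tensor version of a lift depending on a parameter. It supplies the bilinearity of
  the outer function wherever a tensor lift occurs in the body of another: associators, the product
  of a tensor product of algebras, and the action \<open>tensor_act\<close>. Linearity in
  \<open>k\<close> for fixed \<open>t\<close> goes by induction on \<open>t\<close>.\<close>

lemma tensor_lift_param_bilinear:
  assumes M: "module R M" and N: "module R N" and L: "module R L" and K: "module R K"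
    and l: "\<And>k. k \<in> carrier K \<Longrightarrow> \<phi> k \<in> bilinear_maps R M N L"
    and r: "\<And>a b. a \<in> carrier M \<Longrightarrow> b \<in> carrier N \<Longrightarrow> (\<lambda>k. \<phi> k a b) \<in> linear_maps R K L"
  shows "(\<lambda>t k. tensor_lift R L (\<phi> k) t) \<in> bilinear_maps R (tensor_module R M N) K L"
proof (rule bilinear_mapsI)
  let ?MN = "tensor_module R M N"
  note lin = tensor_lift_linear[OF M N L l]
  show "(\<lambda>t. tensor_lift R L (\<phi> k) t) \<in> linear_maps R ?MN L" if "k \<in> carrier K" for k
    using lin[OF that] .
  show "(\<lambda>k. tensor_lift R L (\<phi> k) t) \<in> linear_maps R K L" if t: "t \<in> carrier ?MN" for t
    using M N t
  proof (induction rule: tensor_induct)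
    case zero
    show ?case
      by (rule linear_maps_cong[OF K linear_maps_const_zero[OF L]])
         (rule linear_maps_zero[OF tensor_module_module[OF M N] L lin])
  next
    case (tens a b)
    then show ?case
      by (intro linear_maps_cong[OF K r[OF tens]]) (simp add: tensor_lift_tens[OF M N L l])
  next
    case (add s t)
    show ?case
      by (rule linear_maps_cong[OF K linear_maps_plus[OF L add.IH]]) (rule linear_maps_add[OF lin add.hyps])
  next
    case (smult c t)
    show ?case
      by (rule linear_maps_cong[OF K linear_maps_scale[OF L smult.IH smult.hyps(1)]])
         (rule linear_maps_smult[OF lin smult.hyps])
  qed
qed

lemma
  assumes "module R M" "module R N" "module R M'" "module R N'"
    and f: "f \<in> linear_maps R M M'" and g: "g \<in> linear_maps R N N'"
  shows tensor_map_linear: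
      "tensor_map R M' N' f g \<in> linear_maps R (tensor_module R M N) (tensor_module R M' N')"
    and tensor_map_tens: "a \<in> carrier M \<Longrightarrow> b \<in> carrier N \<Longrightarrow>
      tensor_map R M' N' f g (tens R M N a b) = tens R M' N' (f a) (g b)"
proof -
  have b: "(\<lambda>a b. tens R M' N' (f a) (g b)) \<in> bilinear_maps R M N (tensor_module R M' N')"
    using assms by (intro bilinear_maps_comp[OF _ f g] tens_bilinear)
  show "tensor_map R M' N' f g \<in> linear_maps R (tensor_module R M N) (tensor_module R M' N')"
    unfolding tensor_map_def using assms b by (intro tensor_lift_linear tensor_module_module)
  show "tensor_map R M' N' f g (tens R M N a b) = tens R M' N' (f a) (g b)"
    if "a \<in> carrier M" "b \<in> carrier N"
    unfolding tensor_map_def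
    by (rule tensor_lift_tens[OF _ _ _ b]) (use assms that in \<open>auto intro: tensor_module_module\<close>)
qed

lemma
  assumes "module R M" "module R N"
  shows tensor_swap_linear:
      "tensor_swap R M N \<in> linear_maps R (tensor_module R M N) (tensor_module R N M)"
    and tensor_swap_tens: "a \<in> carrier M \<Longrightarrow> b \<in> carrier N \<Longrightarrow>
      tensor_swap R M N (tens R M N a b) = tens R N M b a"
proof -
  have b: "(\<lambda>a b. tens R N M b a) \<in> bilinear_maps R M N (tensor_module R N M)"
    by (rule bilinear_maps_flip[OF tens_bilinear[OF assms(2,1)]])
  show "tensor_swap R M N \<in> linear_maps R (tensor_module R M N) (tensor_module R N M)"
    unfolding tensor_swap_def using assms b by (intro tensor_lift_linear tensor_module_module)
  show "tensor_swap R M N (tens R M N a b) = tens R N M b a"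
    if "a \<in> carrier M" "b \<in> carrier N"
    unfolding tensor_swap_def
    by (rule tensor_lift_tens[OF _ _ _ b]) (use assms that in \<open>auto intro: tensor_module_module\<close>)
qed

lemma
  assumes M: "module R M" and N: "module R N" and L: "module R L"
  defines "MN \<equiv> tensor_module R M N" and "NL \<equiv> tensor_module R N L"
  shows tensor_assoc_linear:
      "tensor_assoc R M N L \<in> linear_maps R (tensor_module R MN L) (tensor_module R M NL)"
    and tensor_assoc_tens: "a \<in> carrier M \<Longrightarrow> b \<in> carrier N \<Longrightarrow> c \<in> carrier L \<Longrightarrow>
      tensor_assoc R M N L (tens R MN L (tens R M N a b) c) = tens R M NL a (tens R N L b c)"
    and tensor_assoc_inv_linear:
      "tensor_assoc_inv R M N L \<in> linear_maps R (tensor_module R M NL) (tensor_module R MN L)"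
    and tensor_assoc_inv_tens: "a \<in> carrier M \<Longrightarrow> b \<in> carrier N \<Longrightarrow> c \<in> carrier L \<Longrightarrow>
      tensor_assoc_inv R M N L (tens R M NL a (tens R N L b c)) = tens R MN L (tens R M N a b) c"
proof -
  have MN: "module R MN" and NL: "module R NL"
    unfolding MN_def NL_def by (intro tensor_module_module M N L)+
  let ?W = "tensor_module R M NL" and ?V = "tensor_module R MN L"
  have W: "module R ?W" and V: "module R ?V" by (intro tensor_module_module M N L NL MN)+
  note bil = tens_bilinear[OF M NL] tens_bilinear[OF N L] tens_bilinear[OF MN L] tens_bilinear[OF M N]
  have b1: "(\<lambda>a b. tens R M NL a (tens R N L b c)) \<in> bilinear_maps R M N ?W" if c: "c \<in> carrier L" for c
    unfolding NL_def
    by (rule bilinear_maps_comp[OF bil(1)[unfolded NL_def] linear_maps_id(2) bilinear_maps_left[OF bil(2) c]])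
  have l1: "(\<lambda>c. tens R M NL a (tens R N L b c)) \<in> linear_maps R L ?W"
    if a: "a \<in> carrier M" and b: "b \<in> carrier N" for a b
    unfolding NL_def
    by (rule linear_maps_comp[OF bilinear_maps_right[OF bil(2) b] bilinear_maps_right[OF bil(1)[unfolded NL_def] a]])
  have b2: "(\<lambda>b c. tens R MN L (tens R M N a b) c) \<in> bilinear_maps R N L ?V" if a: "a \<in> carrier M" for a
    unfolding MN_def
    by (rule bilinear_maps_comp[OF bil(3)[unfolded MN_def] bilinear_maps_right[OF bil(4) a] linear_maps_id(2)])
  have l2: "(\<lambda>a. tens R MN L (tens R M N a b) c) \<in> linear_maps R M ?V"
    if b: "b \<in> carrier N" and c: "c \<in> carrier L" for b c
    unfolding MN_def
    by (rule linear_maps_comp[OF bilinear_maps_left[OF bil(4) b] bilinear_maps_left[OF bil(3)[unfolded MN_def] c]])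
  have B1: "(\<lambda>t c. tensor_lift R ?W (\<lambda>a b. tens R M NL a (tens R N L b c)) t) \<in> bilinear_maps R MN L ?W"
    unfolding MN_def by (intro tensor_lift_param_bilinear M N W L b1 l1)
  have B2: "(\<lambda>a t. tensor_lift R ?V (\<lambda>b c. tens R MN L (tens R M N a b) c) t) \<in> bilinear_maps R M NL ?V"
    unfolding NL_def
    by (rule bilinear_maps_flip[OF tensor_lift_param_bilinear]) (intro L N V M b2 l2 | assumption)+
  show "tensor_assoc R M N L \<in> linear_maps R (tensor_module R MN L) ?W"
    unfolding tensor_assoc_def Let_def NL_def[symmetric]
    by (intro tensor_lift_linear MN L W B1)
  show "tensor_assoc_inv R M N L \<in> linear_maps R ?W ?V"
    unfolding tensor_assoc_inv_def Let_def MN_def[symmetric]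
    by (intro tensor_lift_linear M NL V B2)
  assume abc: "a \<in> carrier M" "b \<in> carrier N" "c \<in> carrier L"
  have cl: "tens R M N a b \<in> carrier MN" "tens R N L b c \<in> carrier NL"
    unfolding MN_def NL_def using abc by (simp_all add: tens_closed M N L)
  show "tensor_assoc R M N L (tens R MN L (tens R M N a b) c) = tens R M NL a (tens R N L b c)"
    unfolding tensor_assoc_def Let_def NL_def[symmetric]
    using abc cl by (simp add: tensor_lift_tens[OF MN L W B1] tensor_lift_tens[OF M N W b1])
  show "tensor_assoc_inv R M N L (tens R M NL a (tens R N L b c)) = tens R MN L (tens R M N a b) c"
    unfolding tensor_assoc_inv_def Let_def MN_def[symmetric]
    using abc cl by (simp add: tensor_lift_tens[OF M NL V B2] tensor_lift_tens[OF N L V b2])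
qed

end


section \<open>Algebras and their tensor products\<close>

text \<open>Distributivity and compatibility with scalars are contained in bilinearity. What remains
  are equations that are linear in each variable, so they can be verified on generators.\<close>

lemma algebra_bilinearI:
  assumes A: "module R A" and bil: "mult A \<in> bilinear_maps R A A A"
    and one: "\<one>\<^bsub>A\<^esub> \<in> carrier A" and l_one: "\<And>x. x \<in> carrier A \<Longrightarrow> \<one>\<^bsub>A\<^esub> \<otimes>\<^bsub>A\<^esub> x = x"
    and comm: "\<And>x y. x \<in> carrier A \<Longrightarrow> y \<in> carrier A \<Longrightarrow> x \<otimes>\<^bsub>A\<^esub> y = y \<otimes>\<^bsub>A\<^esub> x"
    and assoc: "\<And>x y z. x \<in> carrier A \<Longrightarrow> y \<in> carrier A \<Longrightarrow> z \<in> carrier A \<Longrightarrow>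
      (x \<otimes>\<^bsub>A\<^esub> y) \<otimes>\<^bsub>A\<^esub> z = x \<otimes>\<^bsub>A\<^esub> (y \<otimes>\<^bsub>A\<^esub> z)"
  shows "algebra R A"
proof -
  interpret A: module R A by fact
  note l = bilinear_maps_left[OF bil]
  have "comm_monoid A"
    by (intro comm_monoidI bilinear_maps_closed[OF bil] one l_one comm assoc)
  then have "cring A"
    by (intro cringI A.M.abelian_group_axioms) (auto simp: linear_maps_add[OF l])
  then show ?thesis
    by (intro algebra.intro A algebra_axioms.intro) (auto simp: linear_maps_smult[OF l])
qed

lemma algebra_mult_bilinear:
  assumes "algebra R A"
  shows "mult A \<in> bilinear_maps R A A A"
proof -
  interpret A: algebra R A by fact
  have "x \<otimes>\<^bsub>A\<^esub> (r \<odot>\<^bsub>A\<^esub> y) = r \<odot>\<^bsub>A\<^esub> (x \<otimes>\<^bsub>A\<^esub> y)"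
    if "x \<in> carrier A" "y \<in> carrier A" "r \<in> carrier R" for x y r
    using that A.smult_assoc2[of r y x] by (simp add: A.m_comm)
  then show ?thesis
    by (intro bilinear_mapsI linear_mapsI) (simp_all add: A.l_distr A.r_distr A.smult_assoc2)
qed

text \<open>Algebra structures are put on a module by updating \<open>mult\<close> and
  \<open>one\<close>. This group of rules says that the module-theoretic notions do not see the
  update, so that an algebra may stand wherever its underlying module is meant.\<close>

lemma abelian_group_update [simp]:
  "abelian_group (M\<lparr>mult := m, one := u\<rparr>) \<longleftrightarrow> abelian_group M"
  for M :: "('r, 'a) module"
  by (simp add: abelian_group_def abelian_monoid_def abelian_group_axioms_def)

lemma module_update [simp]:
  "module R (M\<lparr>mult := m, one := u\<rparr>) \<longleftrightarrow> module R M" for M :: "('r, 'a) module"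
  by (simp add: module_def module_axioms_def)

lemma linear_maps_update [simp]:
  "linear_maps R (M\<lparr>mult := m, one := u\<rparr>) N = linear_maps R M N"
  "linear_maps R K (M\<lparr>mult := m, one := u\<rparr>) = linear_maps R K M"
  by (simp_all add: linear_maps_def)

lemma finsum_update [simp]:
  "finsum (M\<lparr>mult := m, one := u\<rparr>) = finsum M" for M :: "('r, 'a) module"
  by (simp add: finsum_def)

lemma pres_lift_update [simp]:
  "pres_lift R (M\<lparr>mult := m, one := u\<rparr>) = pres_lift R M"
  by (simp add: pres_lift_def fun_eq_iff)

lemma tensor_lift_update [simp]:
  "tensor_lift R (M\<lparr>mult := m, one := u\<rparr>) = tensor_lift R M"
  by (simp add: tensor_lift_def fun_eq_iff)

lemma bilinear_rels_update [simp]: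
  "bilinear_rels R (M\<lparr>mult := m, one := u\<rparr>) N = bilinear_rels R M N"
  "bilinear_rels R N (M\<lparr>mult := m, one := u\<rparr>) = bilinear_rels R N M"
  by (simp_all add: bilinear_rels_def)

lemma tensor_update [simp]:
  "tensor_module R (M\<lparr>mult := m, one := u\<rparr>) N = tensor_module R M N"
  "tensor_module R N (M\<lparr>mult := m, one := u\<rparr>) = tensor_module R N M"
  "tens R (M\<lparr>mult := m, one := u\<rparr>) N = tens R M N"
  "tens R N (M\<lparr>mult := m, one := u\<rparr>) = tens R N M"
  by (simp_all add: tensor_module_def tens_def fun_eq_iff)

lemma tensor_algebra_prod_module_simps [simp]:
  "carrier (tensor_algebra_prod R A B) = carrier (tensor_module R A B)"
  "add (tensor_algebra_prod R A B) = add (tensor_module R A B)"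
  "zero (tensor_algebra_prod R A B) = zero (tensor_module R A B)"
  "smult (tensor_algebra_prod R A B) = smult (tensor_module R A B)"
  "one (tensor_algebra_prod R A B) = tens R A B \<one>\<^bsub>A\<^esub> \<one>\<^bsub>B\<^esub>"
  "module R (tensor_algebra_prod R A B) = module R (tensor_module R A B)"
  "linear_maps R (tensor_algebra_prod R A B) K = linear_maps R (tensor_module R A B) K"
  "linear_maps R K (tensor_algebra_prod R A B) = linear_maps R K (tensor_module R A B)"
  "tensor_module R (tensor_algebra_prod R A B) N = tensor_module R (tensor_module R A B) N"
  "tensor_module R N (tensor_algebra_prod R A B) = tensor_module R N (tensor_module R A B)"
  "tens R (tensor_algebra_prod R A B) N = tens R (tensor_module R A B) N"
  "tens R N (tensor_algebra_prod R A B) = tens R N (tensor_module R A B)"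
  by (simp_all add: tensor_algebra_prod_def Let_def)

lemma (in base_ring)
  assumes A: "algebra R A" and B: "algebra R B"
  shows tensor_algebra_prod_algebra: "algebra R (tensor_algebra_prod R A B)"
    and tensor_algebra_prod_mult: "a \<in> carrier A \<Longrightarrow> b \<in> carrier B \<Longrightarrow> c \<in> carrier A \<Longrightarrow> d \<in> carrier B \<Longrightarrow>
      tens R A B a b \<otimes>\<^bsub>tensor_algebra_prod R A B\<^esub> tens R A B c d =
        tens R A B (a \<otimes>\<^bsub>A\<^esub> c) (b \<otimes>\<^bsub>B\<^esub> d)"
proof -
  interpret A: algebra R A by fact
  interpret B: algebra R B by fact
  let ?T = "tensor_algebra_prod R A B" and ?W = "tensor_module R A B"
  note mA = A.module and mB = B.module
  note W = tensor_module_module[OF mA mB]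
  \<comment> \<open>\<open>\<phi> y a b\<close> is the product of \<open>a \<otimes> b\<close> with
    \<open>y\<close>. Varying \<open>y\<close> together with \<open>b\<close> or with
    \<open>a\<close> gives both the bilinearity of \<open>\<phi> y\<close> and the linearity in
    \<open>y\<close> that the outer lift requires.\<close>
  define \<phi> where "\<phi> = (\<lambda>y a b. tensor_lift R ?W
            (\<lambda>c d. tens R A B (a \<otimes>\<^bsub>A\<^esub> c) (b \<otimes>\<^bsub>B\<^esub> d)) y)"
  note t = tens_bilinear[OF mA mB]
  note bA = algebra_mult_bilinear[OF A] and bB = algebra_mult_bilinear[OF B]
  have in1: "(\<lambda>c d. tens R A B (a \<otimes>\<^bsub>A\<^esub> c) (b \<otimes>\<^bsub>B\<^esub> d)) \<in> bilinear_maps R A B ?W"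
    if a: "a \<in> carrier A" and b: "b \<in> carrier B" for a b
    by (rule bilinear_maps_comp[OF t bilinear_maps_right[OF bA a] bilinear_maps_right[OF bB b]])
  have in2: "(\<lambda>a b. tens R A B (a \<otimes>\<^bsub>A\<^esub> c) (b \<otimes>\<^bsub>B\<^esub> d)) \<in> bilinear_maps R A B ?W"
    if c: "c \<in> carrier A" and d: "d \<in> carrier B" for c d
    by (rule bilinear_maps_comp[OF t bilinear_maps_left[OF bA c] bilinear_maps_left[OF bB d]])
  have p1: "(\<lambda>y a. \<phi> y a b) \<in> bilinear_maps R ?W A ?W" if b: "b \<in> carrier B" for b
    unfolding \<phi>_def
    by (rule tensor_lift_param_bilinear[OF mA mB W mA in1[OF _ b]])
       (auto intro: bilinear_maps_left[OF in2 b])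
  have p2: "(\<lambda>y b. \<phi> y a b) \<in> bilinear_maps R ?W B ?W" if a: "a \<in> carrier A" for a
    unfolding \<phi>_def
    by (rule tensor_lift_param_bilinear[OF mA mB W mB in1[OF a]])
       (auto intro: bilinear_maps_right[OF in2 a])
  have \<phi>: "\<phi> y \<in> bilinear_maps R A B ?W" if y: "y \<in> carrier ?W" for y
    by (rule bilinear_mapsI[OF bilinear_maps_right[OF p2 y] bilinear_maps_right[OF p1 y]])
  have mult: "mult ?T = (\<lambda>x y. tensor_lift R ?W (\<phi> y) x)"
    by (simp add: tensor_algebra_prod_def Let_def \<phi>_def)
  have bil: "mult ?T \<in> bilinear_maps R ?W ?W ?W"
    unfolding mult
    by (rule tensor_lift_param_bilinear[OF mA mB W W]) (erule \<phi>, rule bilinear_maps_left[OF p1])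
  show tt: "tens R A B a b \<otimes>\<^bsub>?T\<^esub> tens R A B c d = tens R A B (a \<otimes>\<^bsub>A\<^esub> c) (b \<otimes>\<^bsub>B\<^esub> d)"
    if "a \<in> carrier A" "b \<in> carrier B" "c \<in> carrier A" "d \<in> carrier B" for a b c d
    unfolding mult using that
    by (simp add: tensor_lift_tens[OF mA mB W \<phi>] tens_closed mA mB)
       (simp add: \<phi>_def tensor_lift_tens[OF mA mB W in1])
  note ext = tensor_ext[OF mA mB W]
  note l = bilinear_maps_left[OF bil] and r = bilinear_maps_right[OF bil] and cl = bilinear_maps_closed[OF bil]
  note tc = tens_closed[OF mA mB]
  show "algebra R ?T"
  proof (rule algebra_bilinearI; (unfold tensor_algebra_prod_module_simps)?)
    show "module R ?W" by (rule W)
    show "mult ?T \<in> bilinear_maps R ?T ?T ?T"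
      using bil by (simp add: bilinear_maps_def)
    show "tens R A B \<one>\<^bsub>A\<^esub> \<one>\<^bsub>B\<^esub> \<in> carrier ?W" by (simp add: tc)
    show "tens R A B \<one>\<^bsub>A\<^esub> \<one>\<^bsub>B\<^esub> \<otimes>\<^bsub>?T\<^esub> x = x" if x: "x \<in> carrier ?W" for x
      by (rule ext[OF r linear_maps_id(2) _ x]) (simp_all add: tt tc)
    show "x \<otimes>\<^bsub>?T\<^esub> y = y \<otimes>\<^bsub>?T\<^esub> x" if x: "x \<in> carrier ?W" and y: "y \<in> carrier ?W" for x y
    proof (rule ext[OF l[OF y] r[OF y] _ x])
      fix a b assume ab: "a \<in> carrier A" "b \<in> carrier B"
      show "tens R A B a b \<otimes>\<^bsub>?T\<^esub> y = y \<otimes>\<^bsub>?T\<^esub> tens R A B a b"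
        by (rule ext[OF r l _ y]) (use ab in \<open>simp_all add: tt tc A.m_comm B.m_comm\<close>)
    qed
    show "(x \<otimes>\<^bsub>?T\<^esub> y) \<otimes>\<^bsub>?T\<^esub> z = x \<otimes>\<^bsub>?T\<^esub> (y \<otimes>\<^bsub>?T\<^esub> z)"
      if x: "x \<in> carrier ?W" and y: "y \<in> carrier ?W" and z: "z \<in> carrier ?W" for x y z
    proof (rule ext[OF linear_maps_comp[OF l[OF y] l[OF z]] l[OF cl[OF y z]] _ x])
      fix a b assume ab: "a \<in> carrier A" "b \<in> carrier B"
      let ?x = "tens R A B a b"
      have x: "?x \<in> carrier ?W" using ab by (rule tc)
      show "(?x \<otimes>\<^bsub>?T\<^esub> y) \<otimes>\<^bsub>?T\<^esub> z = ?x \<otimes>\<^bsub>?T\<^esub> (y \<otimes>\<^bsub>?T\<^esub> z)"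
      proof (rule ext[OF linear_maps_comp[OF r[OF x] l[OF z]] linear_maps_comp[OF l[OF z] r[OF x]] _ y])
        fix c d assume cd: "c \<in> carrier A" "d \<in> carrier B"
        let ?y = "tens R A B c d"
        have y: "?y \<in> carrier ?W" using cd by (rule tc)
        show "(?x \<otimes>\<^bsub>?T\<^esub> ?y) \<otimes>\<^bsub>?T\<^esub> z = ?x \<otimes>\<^bsub>?T\<^esub> (?y \<otimes>\<^bsub>?T\<^esub> z)"
          by (rule ext[OF r[OF cl[OF x y]] linear_maps_comp[OF r[OF y] r[OF x]] _ z])
             (use ab cd in \<open>simp add: tt A.m_assoc B.m_assoc\<close>)
      qed
    qed
  qed
qed


section \<open>Tensor powers\<close>

text \<open>One function on words of all lengths encodes a multilinear map on each tensor power. The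
  splitting \<open>xs @ a # ys\<close> is the one used in \<open>multilinear_rels\<close>; on the
  empty word only membership in the carrier is asked.\<close>

definition multilinear_maps :: "'r ring \<Rightarrow> ('r, 'n) module \<Rightarrow> ('r, 'b) module \<Rightarrow> ('n list \<Rightarrow> 'b) set" where
  "multilinear_maps R N L =
    {\<phi> \<in> lists (carrier N) \<rightarrow> carrier L.
      \<forall>xs\<in>lists (carrier N). \<forall>ys\<in>lists (carrier N). (\<lambda>a. \<phi> (xs @ a # ys)) \<in> linear_maps R N L}"

lemma multilinear_mapsI:
  assumes "\<And>w. w \<in> lists (carrier N) \<Longrightarrow> \<phi> w \<in> carrier L"
    and "\<And>xs ys. xs \<in> lists (carrier N) \<Longrightarrow> ys \<in> lists (carrier N) \<Longrightarrow>
      (\<lambda>a. \<phi> (xs @ a # ys)) \<in> linear_maps R N L"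
  shows "\<phi> \<in> multilinear_maps R N L"
  using assms unfolding multilinear_maps_def by blast

lemma multilinear_maps_closed:
  "\<phi> \<in> multilinear_maps R N L \<Longrightarrow> w \<in> lists (carrier N) \<Longrightarrow> \<phi> w \<in> carrier L"
  unfolding multilinear_maps_def by blast

lemma multilinear_maps_linear:
  "\<phi> \<in> multilinear_maps R N L \<Longrightarrow> xs \<in> lists (carrier N) \<Longrightarrow> ys \<in> lists (carrier N) \<Longrightarrow>
    (\<lambda>a. \<phi> (xs @ a # ys)) \<in> linear_maps R N L"
  unfolding multilinear_maps_def by blast

lemma map_in_lists: "f \<in> linear_maps R M N \<Longrightarrow> w \<in> lists (carrier M) \<Longrightarrow> map f w \<in> lists (carrier N)"
  by (induction w) (auto simp: linear_maps_closed)

lemma multilinear_maps_map: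
  assumes "\<phi> \<in> multilinear_maps R N L" "f \<in> linear_maps R M N"
  shows "(\<lambda>w. \<phi> (map f w)) \<in> multilinear_maps R M L"
proof (rule multilinear_mapsI)
  show "\<phi> (map f w) \<in> carrier L" if "w \<in> lists (carrier M)" for w
    by (rule multilinear_maps_closed[OF assms(1) map_in_lists[OF assms(2) that]])
  show "(\<lambda>a. \<phi> (map f (xs @ a # ys))) \<in> linear_maps R M L"
    if "xs \<in> lists (carrier M)" "ys \<in> lists (carrier M)" for xs ys
    using linear_maps_comp[OF assms(2)
        multilinear_maps_linear[OF assms(1) map_in_lists[OF assms(2) that(1)] map_in_lists[OF assms(2) that(2)]]]
    by simp
qed

context base_ring
begin

lemma multilinear_rels_closed:
  assumes "module R N"
  shows "multilinear_rels R N \<subseteq> carrier (free_module R (lists (carrier N)))"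
proof -
  interpret N: module R N by fact
  show ?thesis
    unfolding multilinear_rels_def Let_def
    by (intro Un_least subsetI)
       (elim CollectE exE conjE; simp add: free_rel_add_closed free_rel_smult_closed)+
qed

lemma multilinear_maps_satisfies:
  assumes N: "module R N" and L: "module R L" and \<phi>: "\<phi> \<in> multilinear_maps R N L"
  shows "satisfies (lists (carrier N)) (multilinear_rels R N) L \<phi>"
proof -
  interpret N: module R N by fact
  have cl: "\<phi> \<in> lists (carrier N) \<rightarrow> carrier L"
    using multilinear_maps_closed[OF \<phi>] by auto
  note lin = multilinear_maps_linear[OF \<phi>]
  have "linear_extension L \<phi> e = \<zero>\<^bsub>L\<^esub>" if "e \<in> multilinear_rels R N" for e
    using that unfolding multilinear_rels_def Let_def
    by (elim UnE CollectE exE conjE;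
        simp add: linear_extension_rel_add[OF L cl] linear_extension_rel_smult[OF L cl]
          linear_maps_add[OF lin] linear_maps_smult[OF lin])
  then show ?thesis using cl by (simp add: satisfies_def)
qed

lemma pres_gen_multilinear:
  assumes N: "module R N" and E: "E \<subseteq> carrier (free_module R (lists (carrier N)))"
    and "multilinear_rels R N \<subseteq> E"
  shows "pres_gen R (lists (carrier N)) E \<in> multilinear_maps R N (pres_module R (lists (carrier N)) E)"
proof -
  interpret N: module R N by fact
  let ?F = "free_module R (lists (carrier N))"
  have rel1: "basis_vec R (xs @ (a \<oplus>\<^bsub>N\<^esub> b) # ys) \<ominus>\<^bsub>?F\<^esub>
      (basis_vec R (xs @ a # ys) \<oplus>\<^bsub>?F\<^esub> basis_vec R (xs @ b # ys)) \<in> E"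
    if "xs \<in> lists (carrier N)" "a \<in> carrier N" "b \<in> carrier N" "ys \<in> lists (carrier N)" for xs a b ys
    by (rule subsetD[OF assms(3)]) (use that in \<open>unfold multilinear_rels_def Let_def, blast\<close>)
  have rel2: "basis_vec R (xs @ (r \<odot>\<^bsub>N\<^esub> a) # ys) \<ominus>\<^bsub>?F\<^esub> (r \<odot>\<^bsub>?F\<^esub> basis_vec R (xs @ a # ys)) \<in> E"
    if "xs \<in> lists (carrier N)" "r \<in> carrier R" "a \<in> carrier N" "ys \<in> lists (carrier N)" for xs r a ys
    by (rule subsetD[OF assms(3)]) (use that in \<open>unfold multilinear_rels_def Let_def, blast\<close>)
  show ?thesis
    by (intro multilinear_mapsI linear_mapsI pres_gen_add[OF E] pres_gen_smult[OF E] pres_gen_closed[OF E]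
        rel1 rel2) auto
qed

end

text \<open>The auxiliary maps are defined over \<open>sh_module\<close>, before the product exists.
  These rules make \<open>Sh\<close> the normal form.\<close>

lemma sh_module_simps [simp]:
  "carrier (sh_module R N) = carrier (Sh R N)"
  "add (sh_module R N) = add (Sh R N)"
  "zero (sh_module R N) = zero (Sh R N)"
  "smult (sh_module R N) = smult (Sh R N)"
  "module R (sh_module R N) = module R (Sh R N)"
  "pres_lift R (sh_module R N) = pres_lift R (Sh R N)"
  "linear_maps R K (sh_module R N) = linear_maps R K (Sh R N)"
  "linear_maps R (sh_module R N) K = linear_maps R (Sh R N) K"
  "multilinear_maps R K (sh_module R N) = multilinear_maps R K (Sh R N)"
  "bilinear_maps R (sh_module R N) (sh_module R N) (sh_module R N) =
    bilinear_maps R (Sh R N) (Sh R N) (Sh R N)"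
  by (simp_all add: Sh_def multilinear_maps_def bilinear_maps_def)

context base_ring
begin

context
  fixes N :: "('r, 'n) module"
  assumes N: "module R N"
begin

interpretation N: module R N by (rule N)

lemma Sh_module: "module R (Sh R N)"
  using pres_module_module[OF multilinear_rels_closed[OF N], folded sh_module_def] by simp

lemma sh_word_multilinear: "sh_word R N \<in> multilinear_maps R N (Sh R N)"
  using pres_gen_multilinear[OF N multilinear_rels_closed[OF N] subset_refl, folded sh_module_def sh_word_def]
  by simp

lemma sh_word_closed: "w \<in> lists (carrier N) \<Longrightarrow> sh_word R N w \<in> carrier (Sh R N)"
  by (rule multilinear_maps_closed[OF sh_word_multilinear])

lemma
  assumes L: "module R L" and \<phi>: "\<phi> \<in> multilinear_maps R N L"
  shows sh_lift_linear: "pres_lift R L \<phi> \<in> linear_maps R (Sh R N) L"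
    and sh_lift_word: "w \<in> lists (carrier N) \<Longrightarrow> pres_lift R L \<phi> (sh_word R N w) = \<phi> w"
  using pres_lift_linear[OF multilinear_rels_closed[OF N] L multilinear_maps_satisfies[OF N L \<phi>],
      folded sh_module_def]
    pres_lift_gen[OF multilinear_rels_closed[OF N] L multilinear_maps_satisfies[OF N L \<phi>], folded sh_word_def]
  by simp_all

lemma sh_ext:
  assumes "module R L" "f \<in> linear_maps R (Sh R N) L" "g \<in> linear_maps R (Sh R N) L"
    and "\<And>w. w \<in> lists (carrier N) \<Longrightarrow> f (sh_word R N w) = g (sh_word R N w)"
    and "x \<in> carrier (Sh R N)"
  shows "f x = g x"
  using pres_module_ext[OF multilinear_rels_closed[OF N] assms(1), folded sh_module_def sh_word_def, of f g x] assms
  by simp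

lemma
  assumes a: "a \<in> carrier N"
  shows sh_prepend_linear: "sh_prepend R N a \<in> linear_maps R (Sh R N) (Sh R N)"
    and sh_prepend_word: "w \<in> lists (carrier N) \<Longrightarrow> sh_prepend R N a (sh_word R N w) = sh_word R N (a # w)"
proof -
  have "(\<lambda>w. sh_word R N (a # w)) \<in> multilinear_maps R N (Sh R N)"
  proof (rule multilinear_mapsI)
    show "(\<lambda>b. sh_word R N (a # (xs @ b # ys))) \<in> linear_maps R N (Sh R N)"
      if "xs \<in> lists (carrier N)" "ys \<in> lists (carrier N)" for xs ys
      using multilinear_maps_linear[OF sh_word_multilinear, of "a # xs" ys] that a by simp
  qed (use a in \<open>simp add: sh_word_closed\<close>)
  note * = sh_lift_linear[OF Sh_module this] sh_lift_word[OF Sh_module this]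
  then show "sh_prepend R N a \<in> linear_maps R (Sh R N) (Sh R N)"
    "w \<in> lists (carrier N) \<Longrightarrow> sh_prepend R N a (sh_word R N w) = sh_word R N (a # w)"
    by (simp_all add: sh_prepend_def)
qed

text \<open>Linearity in the prepended letter is what makes shuffles linear in the first letter of a
  word.\<close>

lemma sh_prepend_bilinear: "sh_prepend R N \<in> bilinear_maps R N (Sh R N) (Sh R N)"
proof (intro bilinear_mapsI sh_prepend_linear linear_mapsI)
  interpret S: module R "Sh R N" by (rule Sh_module)
  note lin = multilinear_maps_linear[OF sh_word_multilinear, of "[]", simplified]
  fix x a assume x: "x \<in> carrier (Sh R N)" and a: "a \<in> carrier N"
  show "sh_prepend R N a x \<in> carrier (Sh R N)"
    by (rule linear_maps_closed[OF sh_prepend_linear[OF a] x])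
  show "sh_prepend R N (a \<oplus>\<^bsub>N\<^esub> b) x = sh_prepend R N a x \<oplus>\<^bsub>Sh R N\<^esub> sh_prepend R N b x"
    if b: "b \<in> carrier N" for b
    by (rule sh_ext[OF Sh_module sh_prepend_linear linear_maps_plus[OF Sh_module] _ x])
       (use a b in \<open>simp_all add: sh_prepend_linear sh_prepend_word linear_maps_add[OF lin]\<close>)
  show "sh_prepend R N (r \<odot>\<^bsub>N\<^esub> a) x = r \<odot>\<^bsub>Sh R N\<^esub> sh_prepend R N a x" if r: "r \<in> carrier R" for r
    by (rule sh_ext[OF Sh_module sh_prepend_linear linear_maps_scale[OF Sh_module] _ x])
       (use a r in \<open>simp_all add: sh_prepend_linear sh_prepend_word linear_maps_smult[OF lin]\<close>)
qed


section \<open>The shuffle algebra\<close>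


lemma shuffle_words_Nil2: "shuffle_words R N w [] = sh_word R N w"
  by (cases w) simp_all

lemma shuffle_words_closed:
  "w \<in> lists (carrier N) \<Longrightarrow> v \<in> lists (carrier N) \<Longrightarrow> shuffle_words R N w v \<in> carrier (Sh R N)"
proof (induction w arbitrary: v)
  case Nil
  then show ?case by (simp add: sh_word_closed)
next
  case (Cons a w)
  interpret S: module R "Sh R N" by (rule Sh_module)
  note cl = bilinear_maps_closed[OF sh_prepend_bilinear]
  from Cons.prems(2) show ?case
  proof (induction v)
    case Nil
    then show ?case using Cons.prems by (simp add: sh_word_closed)
  next
    case (Cons b v)
    then show ?case using \<open>a # w \<in> lists (carrier N)\<close> Cons.IH Cons.prems
      by (simp add: cl Cons.IH \<open>\<And>v. w \<in> lists (carrier N) \<Longrightarrow> v \<in> lists (carrier N) \<Longrightarrow>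
        shuffle_words R N w v \<in> carrier (Sh R N)\<close>)
  qed
qed

text \<open>Exchanging the two words exchanges the two summands of the recursion. The outer
  induction handles the summand that shortens \<open>w\<close>, the inner one the summand that
  shortens \<open>v\<close>.\<close>

lemma shuffle_words_commute:
  "w \<in> lists (carrier N) \<Longrightarrow> v \<in> lists (carrier N) \<Longrightarrow> shuffle_words R N w v = shuffle_words R N v w"
proof (induction w arbitrary: v)
  case Nil
  then show ?case by (simp add: shuffle_words_Nil2)
next
  case (Cons a w)
  interpret S: module R "Sh R N" by (rule Sh_module)
  note cl = bilinear_maps_closed[OF sh_prepend_bilinear]
  note IHw = Cons.IH and aw = Cons.prems(1)
  from Cons.prems(2) show ?case
  proof (induction v)
    case Nil
    then show ?case by simp
  next
    case (Cons b v)
    then have "shuffle_words R N (a # w) v = shuffle_words R N v (a # w)"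
      "shuffle_words R N w (b # v) = shuffle_words R N (b # v) w"
      using IHw[of "b # v"] aw by auto
    then show ?case using Cons.hyps aw
      by (simp add: cl shuffle_words_closed S.a_comm)
  qed
qed

text \<open>The recursion may shorten either word, hence an induction on \<open>v\<close> with
  \<open>xs\<close> arbitrary and, inside it, one on \<open>xs\<close>. Once the varying letter is
  in front, it is the prepended letter of one summand and stays inside the word of the other; the
  latter is covered by \<open>step\<close>.\<close>

lemma shuffle_words_multilinear:
  assumes "v \<in> lists (carrier N)"
  shows "(\<lambda>w. shuffle_words R N w v) \<in> multilinear_maps R N (Sh R N)"
proof (rule multilinear_mapsI)
  fix xs ys assume "xs \<in> lists (carrier N)" and ys: "ys \<in> lists (carrier N)"
  then show "(\<lambda>a. shuffle_words R N (xs @ a # ys) v) \<in> linear_maps R N (Sh R N)"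
    using assms
  proof (induction v arbitrary: xs)
    case Nil
    then show ?case
      using multilinear_maps_linear[OF sh_word_multilinear] by (simp add: shuffle_words_Nil2)
  next
    case (Cons c v)
    note IHv = Cons.IH
    have c: "c \<in> carrier N" and v: "v \<in> lists (carrier N)" using Cons.prems by auto
    have step: "(\<lambda>a. sh_prepend R N c (shuffle_words R N (xs @ a # ys) v)) \<in> linear_maps R N (Sh R N)"
      if "xs \<in> lists (carrier N)" for xs
      by (rule linear_maps_comp[OF IHv[OF that ys v] sh_prepend_linear[OF c]])
    from Cons.prems(1) show ?case
    proof (induction xs)
      case Nil
      have "(\<lambda>a. sh_prepend R N a (shuffle_words R N ys (c # v))) \<in> linear_maps R N (Sh R N)"
        using c v ys by (intro bilinear_maps_left[OF sh_prepend_bilinear] shuffle_words_closed) auto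
      from linear_maps_plus[OF Sh_module this step[of "[]"]] show ?case by simp
    next
      case (Cons x xs)
      then have x: "x \<in> carrier N" and xs: "xs \<in> lists (carrier N)"
        and IH: "(\<lambda>a. shuffle_words R N (xs @ a # ys) (c # v)) \<in> linear_maps R N (Sh R N)" by auto
      from linear_maps_plus[OF Sh_module linear_maps_comp[OF IH sh_prepend_linear[OF x]] step[of "x # xs"]]
      show ?case using x xs by simp
    qed
  qed
qed (use assms in \<open>simp add: shuffle_words_closed\<close>)

lemma shuffle_words_multilinear_right:
  assumes w: "w \<in> lists (carrier N)"
  shows "(\<lambda>v. shuffle_words R N w v) \<in> multilinear_maps R N (Sh R N)"
proof (rule multilinear_mapsI)
  fix xs ys assume l: "xs \<in> lists (carrier N)" "ys \<in> lists (carrier N)"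
  show "(\<lambda>a. shuffle_words R N w (xs @ a # ys)) \<in> linear_maps R N (Sh R N)"
    by (rule linear_maps_cong[OF N multilinear_maps_linear[OF shuffle_words_multilinear[OF w] l]])
       (use w l in \<open>simp add: shuffle_words_commute\<close>)
qed (use w in \<open>simp add: shuffle_words_closed\<close>)

lemma Sh_one: "\<one>\<^bsub>Sh R N\<^esub> = sh_word R N []"
  unfolding Sh_def by simp

lemma
  shows Sh_mult_bilinear: "mult (Sh R N) \<in> bilinear_maps R (Sh R N) (Sh R N) (Sh R N)"
    and Sh_mult_word: "w \<in> lists (carrier N) \<Longrightarrow> v \<in> lists (carrier N) \<Longrightarrow>
      sh_word R N w \<otimes>\<^bsub>Sh R N\<^esub> sh_word R N v = shuffle_words R N w v"
proof -
  note E = multilinear_rels_closed[OF N]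
  have m: "mult (Sh R N) = (\<lambda>x y. pres_lift R (sh_module R N)
      (\<lambda>w. pres_lift R (sh_module R N) (\<lambda>v. shuffle_words R N w v) y) x)"
    unfolding Sh_def by simp
  have sm: "module R (sh_module R N)" using Sh_module by simp
  have sat1: "satisfies (lists (carrier N)) (multilinear_rels R N) (sh_module R N) (shuffle_words R N w)"
    if "w \<in> lists (carrier N)" for w
    using that by (intro multilinear_maps_satisfies N sm) (simp add: shuffle_words_multilinear_right)
  have sat2: "satisfies (lists (carrier N)) (multilinear_rels R N) (sh_module R N) (\<lambda>w. shuffle_words R N w v)"
    if "v \<in> lists (carrier N)" for v
    using that by (intro multilinear_maps_satisfies N sm) (simp add: shuffle_words_multilinear)
  note * = pres_bilift_bilinear[OF E E sm sat1 sat2, folded sh_module_def]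
    pres_bilift_gen[OF E E sm sat1 sat2, folded sh_word_def]
  show "mult (Sh R N) \<in> bilinear_maps R (Sh R N) (Sh R N) (Sh R N)"
    using *(1) by (simp only: m sh_module_simps)
  show "sh_word R N w \<otimes>\<^bsub>Sh R N\<^esub> sh_word R N v = shuffle_words R N w v"
    if "w \<in> lists (carrier N)" "v \<in> lists (carrier N)"
    unfolding m by (rule *(2)[OF _ _ that])
qed

abbreviation (input) sh_mult (infixl "\<star>" 70) where "x \<star> y \<equiv> x \<otimes>\<^bsub>Sh R N\<^esub> y"
abbreviation (input) sh_add (infixl "\<boxplus>" 65) where "x \<boxplus> y \<equiv> x \<oplus>\<^bsub>Sh R N\<^esub> y"

text \<open>The shuffle recursion for elements in place of words. Associativity needs this form,
  because a product of two words is already a sum of words.\<close>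

lemma Sh_mult_prepend:
  assumes a: "a \<in> carrier N" and b: "b \<in> carrier N"
    and x: "x \<in> carrier (Sh R N)" and y: "y \<in> carrier (Sh R N)"
  shows "sh_prepend R N a x \<star> sh_prepend R N b y =
    sh_prepend R N a (x \<star> sh_prepend R N b y) \<boxplus>
    sh_prepend R N b (sh_prepend R N a x \<star> y)"
proof -
  note l = bilinear_maps_left[OF Sh_mult_bilinear] and r = bilinear_maps_right[OF Sh_mult_bilinear]
  note pa = sh_prepend_linear[OF a] and pb = sh_prepend_linear[OF b]
  note ext = sh_ext[OF Sh_module]
  note pbc = linear_maps_closed[OF pb]
  show ?thesis
  proof (rule ext[OF linear_maps_comp[OF pa l[OF pbc[OF y]]]
        linear_maps_plus[OF Sh_module linear_maps_comp[OF l[OF pbc[OF y]] pa]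
          linear_maps_comp[OF linear_maps_comp[OF pa l[OF y]] pb]] _ x])
    fix w assume w: "w \<in> lists (carrier N)"
    let ?w = "sh_word R N w"
    have x: "?w \<in> carrier (Sh R N)" by (rule sh_word_closed[OF w])
    note pax = linear_maps_closed[OF pa x]
    show "sh_prepend R N a ?w \<star> sh_prepend R N b y =
      sh_prepend R N a (?w \<star> sh_prepend R N b y) \<boxplus>
      sh_prepend R N b (sh_prepend R N a ?w \<star> y)"
      by (rule ext[OF linear_maps_comp[OF pb r[OF pax]]
        linear_maps_plus[OF Sh_module linear_maps_comp[OF linear_maps_comp[OF pb r[OF x]] pa]
          linear_maps_comp[OF r[OF pax] pb]] _ y])
        (use a b w in \<open>simp add: sh_prepend_word Sh_mult_word\<close>)
  qed
qed

text \<open>Induction on the total length. Expanding either bracketing yields terms grouped by their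
  first letter \<open>a\<close>, \<open>b\<close> or \<open>c\<close>; within each group the word
  that lost its first letter is shorter, and the induction hypothesis moves the brackets.\<close>

lemma Sh_mult_assoc_word:
  assumes "u \<in> lists (carrier N)" "v \<in> lists (carrier N)" "w \<in> lists (carrier N)"
  shows "(sh_word R N u \<star> sh_word R N v) \<star> sh_word R N w =
    sh_word R N u \<star> (sh_word R N v \<star> sh_word R N w)"
  using assms
proof (induction "length u + length v + length w" arbitrary: u v w rule: less_induct)
  case less
  interpret S: module R "Sh R N" by (rule Sh_module)
  note l = bilinear_maps_left[OF Sh_mult_bilinear] and r = bilinear_maps_right[OF Sh_mult_bilinear]
  have mc: "x \<star> y \<in> carrier (Sh R N)" if "x \<in> carrier (Sh R N)" "y \<in> carrier (Sh R N)" for x y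
    by (rule bilinear_maps_closed[OF Sh_mult_bilinear that])
  have nil1: "sh_word R N [] \<star> x = x" if x: "x \<in> carrier (Sh R N)" for x
    by (rule sh_ext[OF Sh_module r linear_maps_id(2) _ x]) (simp_all add: sh_word_closed Sh_mult_word)
  have nil2: "x \<star> sh_word R N [] = x" if x: "x \<in> carrier (Sh R N)" for x
    by (rule sh_ext[OF Sh_module l linear_maps_id(2) _ x])
       (simp_all add: sh_word_closed Sh_mult_word shuffle_words_Nil2)
  show ?case
  proof (cases "u = [] \<or> v = [] \<or> w = []")
    case True
    then show ?thesis using less.prems by (elim disjE) (simp_all add: nil1 nil2 sh_word_closed mc)
  next
    case False
    then obtain a u' b v' c w' where eq: "u = a # u'" "v = b # v'" "w = c # w'"
      by (metis neq_Nil_conv)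
    have abc: "a \<in> carrier N" "b \<in> carrier N" "c \<in> carrier N"
      and lists: "u' \<in> lists (carrier N)" "v' \<in> lists (carrier N)" "w' \<in> lists (carrier N)"
      using less.prems eq by auto
    define X Y Z where "X = sh_word R N u'" and "Y = sh_word R N v'" and "Z = sh_word R N w'"
    let ?A = "sh_prepend R N a" and ?B = "sh_prepend R N b" and ?C = "sh_prepend R N c"
    note pl = sh_prepend_linear[OF abc(1)] sh_prepend_linear[OF abc(2)] sh_prepend_linear[OF abc(3)]
    note pc = pl[THEN linear_maps_closed] and padd = pl[THEN linear_maps_add]
    have cl: "X \<in> carrier (Sh R N)" "Y \<in> carrier (Sh R N)" "Z \<in> carrier (Sh R N)"
      unfolding X_def Y_def Z_def using lists by (simp_all add: sh_word_closed)
    have words: "sh_word R N u = ?A X" "sh_word R N v = ?B Y" "sh_word R N w = ?C Z"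
      unfolding X_def Y_def Z_def eq using abc lists by (simp_all add: sh_prepend_word)
    have IH1: "(X \<star> ?B Y) \<star> ?C Z = X \<star> (?B Y \<star> ?C Z)"
      unfolding X_def words[symmetric] by (rule less.hyps) (use less.prems lists eq in auto)
    have IH2: "(?A X \<star> Y) \<star> ?C Z = ?A X \<star> (Y \<star> ?C Z)"
      unfolding Y_def words[symmetric] by (rule less.hyps) (use less.prems lists eq in auto)
    have IH3: "(?A X \<star> ?B Y) \<star> Z = ?A X \<star> (?B Y \<star> Z)"
      unfolding Z_def words[symmetric] by (rule less.hyps) (use less.prems lists eq in auto)
    have "(?A X \<star> ?B Y) \<star> ?C Z =
        ?A (X \<star> ?B Y) \<star> ?C Z \<boxplus> ?B (?A X \<star> Y) \<star> ?C Z"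
      using cl by (simp add: mc pc linear_maps_add[OF l] Sh_mult_prepend[OF abc(1,2) cl(1,2)])
    also have "\<dots> = (?A ((X \<star> ?B Y) \<star> ?C Z) \<boxplus> ?C (?A (X \<star> ?B Y) \<star> Z))
      \<boxplus> (?B ((?A X \<star> Y) \<star> ?C Z) \<boxplus> ?C (?B (?A X \<star> Y) \<star> Z))"
      using Sh_mult_prepend[OF abc(1,3) mc[OF cl(1) pc(2)[OF cl(2)]] cl(3)]
        Sh_mult_prepend[OF abc(2,3) mc[OF pc(1)[OF cl(1)] cl(2)] cl(3)] by simp
    also have "\<dots> = (?A (X \<star> (?B Y \<star> ?C Z)) \<boxplus> ?B (?A X \<star> (Y \<star> ?C Z)))
      \<boxplus> (?C (?A (X \<star> ?B Y) \<star> Z) \<boxplus> ?C (?B (?A X \<star> Y) \<star> Z))"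
      unfolding IH1 IH2 using cl by (simp add: mc pc S.a_ac)
    \<comment> \<open>The two terms beginning with \<open>c\<close> are the expansion of one
      product, so they must be recombined before the induction hypothesis applies. On the other side
      the same happens with the terms beginning with \<open>a\<close>.\<close>
    also have "?C (?A (X \<star> ?B Y) \<star> Z) \<boxplus> ?C (?B (?A X \<star> Y) \<star> Z) =
        ?C ((?A X \<star> ?B Y) \<star> Z)"
      using cl by (simp add: Sh_mult_prepend[OF abc(1,2) cl(1,2)] mc pc linear_maps_add[OF l] padd)
    also have "\<dots> = ?C (?A X \<star> (?B Y \<star> Z))" unfolding IH3 ..
    finally have lhs: "(?A X \<star> ?B Y) \<star> ?C Z =
      (?A (X \<star> (?B Y \<star> ?C Z)) \<boxplus> ?B (?A X \<star> (Y \<star> ?C Z)))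
      \<boxplus> ?C (?A X \<star> (?B Y \<star> Z))" .
    have BC: "?B Y \<star> ?C Z = ?B (Y \<star> ?C Z) \<boxplus> ?C (?B Y \<star> Z)"
      by (rule Sh_mult_prepend[OF abc(2,3) cl(2,3)])
    have "?A X \<star> (?B Y \<star> ?C Z) =
        ?A X \<star> ?B (Y \<star> ?C Z) \<boxplus> ?A X \<star> ?C (?B Y \<star> Z)"
      unfolding BC using cl by (simp add: linear_maps_add[OF r] mc pc)
    also have "\<dots> = (?A (X \<star> ?B (Y \<star> ?C Z)) \<boxplus> ?B (?A X \<star> (Y \<star> ?C Z)))
      \<boxplus> (?A (X \<star> ?C (?B Y \<star> Z)) \<boxplus> ?C (?A X \<star> (?B Y \<star> Z)))"
      using Sh_mult_prepend[OF abc(1,2) cl(1) mc[OF cl(2) pc(3)[OF cl(3)]]]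
        Sh_mult_prepend[OF abc(1,3) cl(1) mc[OF pc(2)[OF cl(2)] cl(3)]] by simp
    also have "\<dots> = ((?A (X \<star> ?B (Y \<star> ?C Z)) \<boxplus> ?A (X \<star> ?C (?B Y \<star> Z)))
      \<boxplus> ?B (?A X \<star> (Y \<star> ?C Z))) \<boxplus> ?C (?A X \<star> (?B Y \<star> Z))"
      using cl by (simp add: mc pc S.a_ac)
    also have "?A (X \<star> ?B (Y \<star> ?C Z)) \<boxplus> ?A (X \<star> ?C (?B Y \<star> Z)) =
        ?A (X \<star> (?B Y \<star> ?C Z))"
      unfolding BC using cl by (simp add: mc pc linear_maps_add[OF r] padd)
    finally show ?thesis unfolding words using lhs by simp
  qed
qed

lemma Sh_algebra: "algebra R (Sh R N)"
proof (rule algebra_bilinearI)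
  note l = bilinear_maps_left[OF Sh_mult_bilinear] and r = bilinear_maps_right[OF Sh_mult_bilinear]
  note cl = bilinear_maps_closed[OF Sh_mult_bilinear]
  note ext = sh_ext[OF Sh_module]
  show "module R (Sh R N)" by (rule Sh_module)
  show "mult (Sh R N) \<in> bilinear_maps R (Sh R N) (Sh R N) (Sh R N)" by (rule Sh_mult_bilinear)
  show one: "\<one>\<^bsub>Sh R N\<^esub> \<in> carrier (Sh R N)" by (simp add: Sh_one sh_word_closed)
  show "\<one>\<^bsub>Sh R N\<^esub> \<star> x = x" if x: "x \<in> carrier (Sh R N)" for x
    by (rule ext[OF r[OF one] linear_maps_id(2) _ x]) (simp add: Sh_one Sh_mult_word)
  show "x \<star> y = y \<star> x" if x: "x \<in> carrier (Sh R N)" and y: "y \<in> carrier (Sh R N)" for x y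
  proof (rule ext[OF l[OF y] r[OF y] _ x])
    fix w assume w: "w \<in> lists (carrier N)"
    show "sh_word R N w \<star> y = y \<star> sh_word R N w"
      by (rule ext[OF r l _ y]) (use w in \<open>simp_all add: sh_word_closed Sh_mult_word shuffle_words_commute\<close>)
  qed
  show "(x \<star> y) \<star> z = x \<star> (y \<star> z)"
    if x: "x \<in> carrier (Sh R N)" and y: "y \<in> carrier (Sh R N)" and z: "z \<in> carrier (Sh R N)" for x y z
  proof (rule ext[OF linear_maps_comp[OF l[OF y] l[OF z]] l[OF cl[OF y z]] _ x])
    fix u assume u: "u \<in> lists (carrier N)"
    let ?x = "sh_word R N u"
    have x: "?x \<in> carrier (Sh R N)" using u by (rule sh_word_closed)
    show "(?x \<star> y) \<star> z = ?x \<star> (y \<star> z)"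
    proof (rule ext[OF linear_maps_comp[OF r[OF x] l[OF z]] linear_maps_comp[OF l[OF z] r[OF x]] _ y])
      fix v assume v: "v \<in> lists (carrier N)"
      let ?y = "sh_word R N v"
      have y: "?y \<in> carrier (Sh R N)" using v by (rule sh_word_closed)
      show "(?x \<star> ?y) \<star> z = ?x \<star> (?y \<star> z)"
        by (rule ext[OF r[OF cl[OF x y]] linear_maps_comp[OF r[OF y] r[OF x]] _ z])
           (rule Sh_mult_assoc_word[OF u v])
    qed
  qed
qed

end

end


section \<open>The symmetric algebra\<close>

text \<open>Invariance under adjacent swaps suffices for invariance under all permutations, and it
  matches \<open>commutation_rels\<close> literally.\<close>

definition symmetric_maps :: "'r ring \<Rightarrow> ('r, 'n) module \<Rightarrow> ('r, 'b) module \<Rightarrow> ('n list \<Rightarrow> 'b) set" where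
  "symmetric_maps R N L =
    {\<phi> \<in> multilinear_maps R N L.
      \<forall>xs\<in>lists (carrier N). \<forall>a\<in>carrier N. \<forall>b\<in>carrier N. \<forall>ys\<in>lists (carrier N).
        \<phi> (xs @ a # b # ys) = \<phi> (xs @ b # a # ys)}"

lemma symmetric_mapsI:
  assumes "\<phi> \<in> multilinear_maps R N L"
    and "\<And>xs a b ys. xs \<in> lists (carrier N) \<Longrightarrow> a \<in> carrier N \<Longrightarrow> b \<in> carrier N \<Longrightarrow>
      ys \<in> lists (carrier N) \<Longrightarrow> \<phi> (xs @ a # b # ys) = \<phi> (xs @ b # a # ys)"
  shows "\<phi> \<in> symmetric_maps R N L"
  using assms unfolding symmetric_maps_def by blast

lemma symmetric_maps_multilinear: "\<phi> \<in> symmetric_maps R N L \<Longrightarrow> \<phi> \<in> multilinear_maps R N L"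
  unfolding symmetric_maps_def by blast

lemma symmetric_maps_swap:
  "\<phi> \<in> symmetric_maps R N L \<Longrightarrow> xs \<in> lists (carrier N) \<Longrightarrow> a \<in> carrier N \<Longrightarrow> b \<in> carrier N \<Longrightarrow>
    ys \<in> lists (carrier N) \<Longrightarrow> \<phi> (xs @ a # b # ys) = \<phi> (xs @ b # a # ys)"
  unfolding symmetric_maps_def by blast

lemma symmetric_maps_map:
  assumes "\<phi> \<in> symmetric_maps R N L" "f \<in> linear_maps R M N"
  shows "(\<lambda>w. \<phi> (map f w)) \<in> symmetric_maps R M L"
proof (rule symmetric_mapsI)
  show "(\<lambda>w. \<phi> (map f w)) \<in> multilinear_maps R M L"
    by (rule multilinear_maps_map[OF symmetric_maps_multilinear[OF assms(1)] assms(2)])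
  show "\<phi> (map f (xs @ a # b # ys)) = \<phi> (map f (xs @ b # a # ys))"
    if "xs \<in> lists (carrier M)" "a \<in> carrier M" "b \<in> carrier M" "ys \<in> lists (carrier M)" for xs a b ys
    using symmetric_maps_swap[OF assms(1) map_in_lists[OF assms(2) that(1)]
        linear_maps_closed[OF assms(2) that(2)] linear_maps_closed[OF assms(2) that(3)]
        map_in_lists[OF assms(2) that(4)]]
    by simp
qed

text \<open>The module underlying \<open>Sym\<close> is bound by a \<open>let\<close> and has no
  name, so its presentation is written out on the left-hand sides.\<close>

lemma Sym_pres_simps:
  "carrier (pres_module R (lists (carrier M)) (sym_rels R M)) = carrier (Sym R M)"
  "add (pres_module R (lists (carrier M)) (sym_rels R M)) = add (Sym R M)"
  "zero (pres_module R (lists (carrier M)) (sym_rels R M)) = zero (Sym R M)"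
  "smult (pres_module R (lists (carrier M)) (sym_rels R M)) = smult (Sym R M)"
  "module R (pres_module R (lists (carrier M)) (sym_rels R M)) = module R (Sym R M)"
  "pres_lift R (pres_module R (lists (carrier M)) (sym_rels R M)) = pres_lift R (Sym R M)"
  "linear_maps R K (pres_module R (lists (carrier M)) (sym_rels R M)) = linear_maps R K (Sym R M)"
  "linear_maps R (pres_module R (lists (carrier M)) (sym_rels R M)) K' = linear_maps R (Sym R M) K'"
  "multilinear_maps R K (pres_module R (lists (carrier M)) (sym_rels R M)) = multilinear_maps R K (Sym R M)"
  "bilinear_maps R (pres_module R (lists (carrier M)) (sym_rels R M))
      (pres_module R (lists (carrier M)) (sym_rels R M)) (pres_module R (lists (carrier M)) (sym_rels R M)) =
    bilinear_maps R (Sym R M) (Sym R M) (Sym R M)"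
  by (simp_all add: Sym_def Let_def multilinear_maps_def bilinear_maps_def)

lemma Sym_one: "\<one>\<^bsub>Sym R M\<^esub> = sym_word R M []"
  by (simp add: Sym_def Let_def)

lemma Sym_mult:
  "mult (Sym R M) = (\<lambda>x y. pres_lift R (pres_module R (lists (carrier M)) (sym_rels R M))
    (\<lambda>u. pres_lift R (pres_module R (lists (carrier M)) (sym_rels R M)) (\<lambda>v. sym_word R M (u @ v)) y) x)"
  by (simp add: Sym_def Let_def)

context base_ring
begin

context
  fixes M :: "('r, 'm) module"
  assumes M: "module R M"
begin

interpretation M: module R M by (rule M)

lemma sym_rels_closed: "sym_rels R M \<subseteq> carrier (free_module R (lists (carrier M)))"
proof -
  have "commutation_rels R M \<subseteq> carrier (free_module R (lists (carrier M)))"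
    unfolding commutation_rels_def Let_def
    by (rule subsetI, elim CollectE exE conjE) (simp add: free_rel_eq_closed)
  then show ?thesis using multilinear_rels_closed[OF M] by (rule Un_least[rotated])
qed

lemma symmetric_maps_satisfies:
  assumes L: "module R L" and \<phi>: "\<phi> \<in> symmetric_maps R M L"
  shows "satisfies (lists (carrier M)) (sym_rels R M) L \<phi>"
proof -
  have ml: "satisfies (lists (carrier M)) (multilinear_rels R M) L \<phi>"
    by (rule multilinear_maps_satisfies[OF M L symmetric_maps_multilinear[OF \<phi>]])
  then have cl: "\<phi> \<in> lists (carrier M) \<rightarrow> carrier L" by (simp add: satisfies_def)
  have "linear_extension L \<phi> e = \<zero>\<^bsub>L\<^esub>" if "e \<in> commutation_rels R M" for e
    using that unfolding commutation_rels_def Let_def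
    by (elim CollectE exE conjE) (simp add: linear_extension_rel_eq[OF L cl] symmetric_maps_swap[OF \<phi>])
  then show ?thesis using ml by (auto simp: satisfies_def)
qed

lemma Sym_module: "module R (Sym R M)"
  using pres_module_module[OF sym_rels_closed] unfolding Sym_pres_simps .

lemma sym_word_multilinear: "sym_word R M \<in> multilinear_maps R M (Sym R M)"
  using pres_gen_multilinear[OF M sym_rels_closed Un_upper1]
  unfolding Sym_pres_simps sym_word_def .

lemma sym_word_closed: "u \<in> lists (carrier M) \<Longrightarrow> sym_word R M u \<in> carrier (Sym R M)"
  by (rule multilinear_maps_closed[OF sym_word_multilinear])

lemma sym_word_symmetric: "sym_word R M \<in> symmetric_maps R M (Sym R M)"
proof (rule symmetric_mapsI[OF sym_word_multilinear])
  fix xs a b ys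
  assume *: "xs \<in> lists (carrier M)" "a \<in> carrier M" "b \<in> carrier M" "ys \<in> lists (carrier M)"
  let ?F = "free_module R (lists (carrier M))"
  have "basis_vec R (xs @ a # b # ys) \<ominus>\<^bsub>?F\<^esub> basis_vec R (xs @ b # a # ys) \<in> commutation_rels R M"
    using * unfolding commutation_rels_def Let_def by blast
  then show "sym_word R M (xs @ a # b # ys) = sym_word R M (xs @ b # a # ys)"
    unfolding sym_word_def by (intro pres_gen_eq[OF sym_rels_closed]) (use * in auto)
qed

lemma
  assumes L: "module R L" and \<phi>: "\<phi> \<in> symmetric_maps R M L"
  shows sym_lift_linear: "pres_lift R L \<phi> \<in> linear_maps R (Sym R M) L"
    and sym_lift_word: "u \<in> lists (carrier M) \<Longrightarrow> pres_lift R L \<phi> (sym_word R M u) = \<phi> u"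
  using pres_lift_linear[OF sym_rels_closed L symmetric_maps_satisfies[OF L \<phi>]]
    pres_lift_gen[OF sym_rels_closed L symmetric_maps_satisfies[OF L \<phi>], folded sym_word_def]
  unfolding Sym_pres_simps by simp_all

lemma sym_ext:
  assumes "module R L" "f \<in> linear_maps R (Sym R M) L" "g \<in> linear_maps R (Sym R M) L"
    and "\<And>u. u \<in> lists (carrier M) \<Longrightarrow> f (sym_word R M u) = g (sym_word R M u)"
    and "x \<in> carrier (Sym R M)"
  shows "f x = g x"
  using pres_module_ext[OF sym_rels_closed assms(1), of f g x] assms
  unfolding Sym_pres_simps sym_word_def by simp

text \<open>The letter \<open>a\<close> crosses \<open>xs\<close> by adjacent swaps. The prefix
  \<open>p\<close> is there for the induction: it absorbs the first letter of \<open>xs\<close>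
  while \<open>a\<close> crosses the others.\<close>

lemma sym_word_shift:
  assumes "p \<in> lists (carrier M)" "xs \<in> lists (carrier M)" "a \<in> carrier M" "ys \<in> lists (carrier M)"
  shows "sym_word R M (p @ xs @ a # ys) = sym_word R M (p @ a # xs @ ys)"
  using assms(2,1)
proof (induction xs arbitrary: p)
  case (Cons x xs)
  have "sym_word R M (p @ (x # xs) @ a # ys) = sym_word R M (p @ x # a # xs @ ys)"
    using Cons.IH[of "p @ [x]"] Cons.prems Cons.hyps by simp
  also have "\<dots> = sym_word R M (p @ a # x # xs @ ys)"
    using Cons.prems Cons.hyps assms by (intro symmetric_maps_swap[OF sym_word_symmetric]) auto
  finally show ?case by simp
qed simp

lemma sym_word_append_commute:
  assumes "p \<in> lists (carrier M)" "u \<in> lists (carrier M)" "v \<in> lists (carrier M)"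
  shows "sym_word R M (p @ u @ v) = sym_word R M (p @ v @ u)"
  using assms(2,1)
proof (induction u arbitrary: p)
  case (Cons a u)
  have "sym_word R M (p @ (a # u) @ v) = sym_word R M (p @ a # v @ u)"
    using Cons.IH[of "p @ [a]"] Cons.prems Cons.hyps by simp
  also have "\<dots> = sym_word R M (p @ v @ a # u)"
    using Cons.prems Cons.hyps assms by (intro sym_word_shift[symmetric]) auto
  finally show ?case .
qed simp

text \<open>Both conditions in \<open>symmetric_maps\<close> range over all surrounding words, so
  concatenation with a fixed word on either side only enlarges \<open>xs\<close> or
  \<open>ys\<close>.\<close>

lemma
  shows Sym_mult_bilinear: "mult (Sym R M) \<in> bilinear_maps R (Sym R M) (Sym R M) (Sym R M)"
    and Sym_mult_word: "u \<in> lists (carrier M) \<Longrightarrow> v \<in> lists (carrier M) \<Longrightarrow>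
      sym_word R M u \<otimes>\<^bsub>Sym R M\<^esub> sym_word R M v = sym_word R M (u @ v)"
proof -
  note E = sym_rels_closed
  let ?S = "pres_module R (lists (carrier M)) (sym_rels R M)"
  have S: "module R ?S" by (rule pres_module_module[OF E])
  have eq: "symmetric_maps R M ?S = symmetric_maps R M (Sym R M)"
    by (simp add: symmetric_maps_def Sym_pres_simps)
  have right: "(\<lambda>v. sym_word R M (u @ v)) \<in> symmetric_maps R M (Sym R M)" if u: "u \<in> lists (carrier M)" for u
  proof (intro symmetric_mapsI multilinear_mapsI sym_word_closed)
    fix xs ys assume "xs \<in> lists (carrier M)" "ys \<in> lists (carrier M)"
    then show "(\<lambda>a. sym_word R M (u @ xs @ a # ys)) \<in> linear_maps R M (Sym R M)"
      using multilinear_maps_linear[OF sym_word_multilinear, of "u @ xs" ys] u by simp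
  next
    fix xs a b ys
    assume "xs \<in> lists (carrier M)" "a \<in> carrier M" "b \<in> carrier M" "ys \<in> lists (carrier M)"
    then show "sym_word R M (u @ xs @ a # b # ys) = sym_word R M (u @ xs @ b # a # ys)"
      using symmetric_maps_swap[OF sym_word_symmetric, of "u @ xs" a b ys] u by simp
  qed (use u in simp)
  have left: "(\<lambda>u. sym_word R M (u @ v)) \<in> symmetric_maps R M (Sym R M)" if v: "v \<in> lists (carrier M)" for v
  proof (intro symmetric_mapsI multilinear_mapsI sym_word_closed)
    fix xs ys assume "xs \<in> lists (carrier M)" "ys \<in> lists (carrier M)"
    then show "(\<lambda>a. sym_word R M ((xs @ a # ys) @ v)) \<in> linear_maps R M (Sym R M)"
      using multilinear_maps_linear[OF sym_word_multilinear, of xs "ys @ v"] v by simp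
  next
    fix xs a b ys
    assume "xs \<in> lists (carrier M)" "a \<in> carrier M" "b \<in> carrier M" "ys \<in> lists (carrier M)"
    then show "sym_word R M ((xs @ a # b # ys) @ v) = sym_word R M ((xs @ b # a # ys) @ v)"
      using symmetric_maps_swap[OF sym_word_symmetric, of xs a b "ys @ v"] v by simp
  qed (use v in simp)
  have sat: "satisfies (lists (carrier M)) (sym_rels R M) ?S \<phi>"
    if "\<phi> \<in> symmetric_maps R M (Sym R M)" for \<phi>
    using that by (intro symmetric_maps_satisfies S) (simp add: eq)
  note * = pres_bilift_bilinear[OF E E S sat[OF right] sat[OF left]]
    pres_bilift_gen[OF E E S sat[OF right] sat[OF left], folded sym_word_def]
  show "mult (Sym R M) \<in> bilinear_maps R (Sym R M) (Sym R M) (Sym R M)"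
    using *(1) by (simp only: Sym_mult Sym_pres_simps)
  show "sym_word R M u \<otimes>\<^bsub>Sym R M\<^esub> sym_word R M v = sym_word R M (u @ v)"
    if "u \<in> lists (carrier M)" "v \<in> lists (carrier M)"
    unfolding Sym_mult by (rule *(2)[OF _ _ that])
qed

lemma Sym_algebra: "algebra R (Sym R M)"
proof (rule algebra_bilinearI)
  let ?S = "Sym R M"
  note l = bilinear_maps_left[OF Sym_mult_bilinear] and r = bilinear_maps_right[OF Sym_mult_bilinear]
  note cl = bilinear_maps_closed[OF Sym_mult_bilinear]
  note ext = sym_ext[OF Sym_module]
  show "module R (Sym R M)" by (rule Sym_module)
  show "mult (Sym R M) \<in> bilinear_maps R (Sym R M) (Sym R M) (Sym R M)" by (rule Sym_mult_bilinear)
  show one: "\<one>\<^bsub>Sym R M\<^esub> \<in> carrier (Sym R M)" by (simp add: Sym_one sym_word_closed)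
  show "\<one>\<^bsub>Sym R M\<^esub> \<otimes>\<^bsub>?S\<^esub> x = x" if x: "x \<in> carrier (Sym R M)" for x
    by (rule ext[OF r[OF one] linear_maps_id(2) _ x]) (simp add: Sym_one Sym_mult_word)
  show "x \<otimes>\<^bsub>?S\<^esub> y = y \<otimes>\<^bsub>?S\<^esub> x" if x: "x \<in> carrier (Sym R M)" and y: "y \<in> carrier (Sym R M)" for x y
  proof (rule ext[OF l[OF y] r[OF y] _ x])
    fix w assume w: "w \<in> lists (carrier M)"
    show "sym_word R M w \<otimes>\<^bsub>?S\<^esub> y = y \<otimes>\<^bsub>?S\<^esub> sym_word R M w"
      by (rule ext[OF r l _ y])
         (use w sym_word_append_commute[of "[]" w] in \<open>simp_all add: sym_word_closed Sym_mult_word\<close>)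
  qed
  show "(x \<otimes>\<^bsub>?S\<^esub> y) \<otimes>\<^bsub>?S\<^esub> z = x \<otimes>\<^bsub>?S\<^esub> (y \<otimes>\<^bsub>?S\<^esub> z)"
    if x: "x \<in> carrier (Sym R M)" and y: "y \<in> carrier (Sym R M)" and z: "z \<in> carrier (Sym R M)" for x y z
  proof (rule ext[OF linear_maps_comp[OF l[OF y] l[OF z]] l[OF cl[OF y z]] _ x])
    fix u assume u: "u \<in> lists (carrier M)"
    let ?x = "sym_word R M u"
    have x: "?x \<in> carrier (Sym R M)" using u by (rule sym_word_closed)
    show "(?x \<otimes>\<^bsub>?S\<^esub> y) \<otimes>\<^bsub>?S\<^esub> z = ?x \<otimes>\<^bsub>?S\<^esub> (y \<otimes>\<^bsub>?S\<^esub> z)"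
    proof (rule ext[OF linear_maps_comp[OF r[OF x] l[OF z]] linear_maps_comp[OF l[OF z] r[OF x]] _ y])
      fix v assume v: "v \<in> lists (carrier M)"
      let ?y = "sym_word R M v"
      have y: "?y \<in> carrier (Sym R M)" using v by (rule sym_word_closed)
      show "(?x \<otimes>\<^bsub>?S\<^esub> ?y) \<otimes>\<^bsub>?S\<^esub> z = ?x \<otimes>\<^bsub>?S\<^esub> (?y \<otimes>\<^bsub>?S\<^esub> z)"
        by (rule ext[OF r[OF cl[OF x y]] linear_maps_comp[OF r[OF y] r[OF x]] _ z])
           (use u v in \<open>simp add: Sym_mult_word\<close>)
    qed
  qed
qed

end


section \<open>Derivations\<close>

text \<open>The \<open>A\<close>-module structure of \<open>A \<otimes> M\<close> through its first
  factor, for which the product rule takes the form of a Leibniz rule.\<close>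

definition tensor_act ::
  "('r, 'a) module \<Rightarrow> ('r, 'm) module \<Rightarrow> 'a \<Rightarrow> ('r, 'a, 'm) tensor \<Rightarrow> ('r, 'a, 'm) tensor" where
  "tensor_act A M s = tensor_map R A M (mult A s) id"

text \<open>A derivation of \<open>A\<close> with values in the \<open>A\<close>-module
  \<open>A \<otimes> M\<close>. As \<open>A\<close> is commutative, both terms can use the left
  action, which removes the associators and the symmetry from the product rule.\<close>

definition derivation ::
  "('r, 'a) module \<Rightarrow> ('r, 'm) module \<Rightarrow> ('a \<Rightarrow> ('r, 'a, 'm) tensor) \<Rightarrow> bool" where
  "derivation A M d \<longleftrightarrow> d \<in> linear_maps R A (tensor_module R A M) \<and>
    (\<forall>x\<in>carrier A. \<forall>y\<in>carrier A.
      d (x \<otimes>\<^bsub>A\<^esub> y) = tensor_act A M x (d y) \<oplus>\<^bsub>tensor_module R A M\<^esub> tensor_act A M y (d x))"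

context
  fixes A :: "('r, 'a) module" and M :: "('r, 'm) module"
  assumes A: "algebra R A" and M: "module R M"
begin

interpretation A: algebra R A by (rule A)
interpretation M: module R M by (rule M)

lemma tensor_act_linear:
  "s \<in> carrier A \<Longrightarrow> tensor_act A M s \<in> linear_maps R (tensor_module R A M) (tensor_module R A M)"
  unfolding tensor_act_def
  by (intro tensor_map_linear A.module M linear_maps_id bilinear_maps_right[OF algebra_mult_bilinear[OF A]])

lemma tensor_act_tens:
  "s \<in> carrier A \<Longrightarrow> a \<in> carrier A \<Longrightarrow> m \<in> carrier M \<Longrightarrow>
    tensor_act A M s (tens R A M a m) = tens R A M (s \<otimes>\<^bsub>A\<^esub> a) m"
  unfolding tensor_act_def
  by (subst tensor_map_tens[OF A.module M A.module M
        bilinear_maps_right[OF algebra_mult_bilinear[OF A]] linear_maps_id(1)]) auto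

text \<open>Linearity in the acting element is used whenever the Leibniz rule is compared on
  generators, since \<open>x\<close> occurs there as the acting element.\<close>

lemma tensor_act_bilinear:
  "tensor_act A M \<in> bilinear_maps R A (tensor_module R A M) (tensor_module R A M)"
proof -
  note mA = A.module and bA = algebra_mult_bilinear[OF A]
  note t = tens_bilinear[OF mA M] and AM = tensor_module_module[OF mA M]
  have "(\<lambda>t s. tensor_act A M s t) \<in> bilinear_maps R (tensor_module R A M) A (tensor_module R A M)"
    unfolding tensor_act_def tensor_map_def
  proof (rule tensor_lift_param_bilinear[OF mA M AM mA])
    show "(\<lambda>a b. tens R A M (s \<otimes>\<^bsub>A\<^esub> a) (id b)) \<in> bilinear_maps R A M (tensor_module R A M)"
      if s: "s \<in> carrier A" for s
      by (rule bilinear_maps_comp[OF t bilinear_maps_right[OF bA s] linear_maps_id(1)])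
    show "(\<lambda>s. tens R A M (s \<otimes>\<^bsub>A\<^esub> a) (id b)) \<in> linear_maps R A (tensor_module R A M)"
      if a: "a \<in> carrier A" and b: "b \<in> carrier M" for a b
      using linear_maps_comp[OF bilinear_maps_left[OF bA a] bilinear_maps_left[OF t b]] by simp
  qed
  then show ?thesis by (rule bilinear_maps_flip)
qed

lemma tensor_act_closed:
  "s \<in> carrier A \<Longrightarrow> t \<in> carrier (tensor_module R A M) \<Longrightarrow>
    tensor_act A M s t \<in> carrier (tensor_module R A M)"
  by (rule bilinear_maps_closed[OF tensor_act_bilinear])

lemma tensor_act_mult:
  assumes s: "s \<in> carrier A" "s' \<in> carrier A" and t: "t \<in> carrier (tensor_module R A M)"
  shows "tensor_act A M (s \<otimes>\<^bsub>A\<^esub> s') t = tensor_act A M s (tensor_act A M s' t)"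
  by (rule tensor_ext[OF A.module M tensor_module_module[OF A.module M] tensor_act_linear
        linear_maps_comp[OF tensor_act_linear tensor_act_linear] _ t])
     (use s in \<open>simp_all add: tensor_act_tens A.m_assoc\<close>)

lemma tensor_act_one:
  assumes t: "t \<in> carrier (tensor_module R A M)"
  shows "tensor_act A M \<one>\<^bsub>A\<^esub> t = t"
  by (rule tensor_ext[OF A.module M tensor_module_module[OF A.module M] tensor_act_linear
        linear_maps_id(2) _ t])
     (simp_all add: tensor_act_tens)

text \<open>Apply the Leibniz rule to the unit times itself: \<open>d 1 = d 1 + d 1\<close>.\<close>

lemma derivation_one:
  assumes d: "derivation A M d"
  shows "d \<one>\<^bsub>A\<^esub> = \<zero>\<^bsub>tensor_module R A M\<^esub>"
proof -
  interpret AM: module R "tensor_module R A M" by (rule tensor_module_module[OF A.module M])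
  have "d \<in> linear_maps R A (tensor_module R A M)"
    using d by (simp add: derivation_def)
  then have cl: "d \<one>\<^bsub>A\<^esub> \<in> carrier (tensor_module R A M)"
    by (rule linear_maps_closed) simp
  have "d (\<one>\<^bsub>A\<^esub> \<otimes>\<^bsub>A\<^esub> \<one>\<^bsub>A\<^esub>) = tensor_act A M \<one>\<^bsub>A\<^esub> (d \<one>\<^bsub>A\<^esub>) \<oplus>\<^bsub>tensor_module R A M\<^esub> tensor_act A M \<one>\<^bsub>A\<^esub> (d \<one>\<^bsub>A\<^esub>)"
    using d unfolding derivation_def by blast
  then show ?thesis using cl by (simp add: tensor_act_one)
qed

lemma derivation_constant_rule:
  assumes d: "derivation A M d"
  shows "constant_rule R M A d"
proof -
  interpret AM: module R "tensor_module R A M" by (rule tensor_module_module[OF A.module M])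
  have "d \<in> linear_maps R A (tensor_module R A M)" using d by (simp add: derivation_def)
  then show ?thesis
    by (simp add: constant_rule_def alg_unit_map_def linear_maps_smult derivation_one[OF d])
qed

text \<open>\<open>F\<close> is the common tail of the product rule and of the chain rule. It is the
  action, read as a map out of \<open>A \<otimes> (A \<otimes> M)\<close>.\<close>

lemma
  defines "AM \<equiv> tensor_module R A M"
    and "F \<equiv> \<lambda>t. tensor_map R A M (alg_mult_map R A) id (tensor_assoc_inv R A A M t)"
  shows assoc_mult_linear: "F \<in> linear_maps R (tensor_module R A AM) AM"
    and assoc_mult_tens: "a \<in> carrier A \<Longrightarrow> t \<in> carrier AM \<Longrightarrow> F (tens R A AM a t) = tensor_act A M a t"
proof -
  note mA = A.module
  have AM: "module R AM" and AA: "module R (tensor_module R A A)"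
    unfolding AM_def by (rule tensor_module_module[OF mA M] tensor_module_module[OF mA mA])+
  note bil = algebra_mult_bilinear[OF A]
  have ml: "alg_mult_map R A \<in> linear_maps R (tensor_module R A A) A"
    unfolding alg_mult_map_def by (rule tensor_lift_linear[OF mA mA mA bil])
  have mt: "alg_mult_map R A (tens R A A a b) = a \<otimes>\<^bsub>A\<^esub> b" if "a \<in> carrier A" "b \<in> carrier A" for a b
    unfolding alg_mult_map_def by (rule tensor_lift_tens[OF mA mA mA bil that])
  show F: "F \<in> linear_maps R (tensor_module R A AM) AM"
    unfolding F_def AM_def
    by (rule linear_maps_comp[OF tensor_assoc_inv_linear[OF mA mA M]
          tensor_map_linear[OF AA M mA M ml linear_maps_id(1)]])
  show "F (tens R A AM a t) = tensor_act A M a t" if a: "a \<in> carrier A" and t: "t \<in> carrier AM"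
  proof (rule tensor_ext[OF mA M AM[unfolded AM_def] linear_maps_comp[OF bilinear_maps_right[OF tens_bilinear[OF mA AM] a] F, unfolded AM_def]
        tensor_act_linear[OF a] _ t[unfolded AM_def], folded AM_def])
    show "F (tens R A AM a (tens R A M b m)) = tensor_act A M a (tens R A M b m)"
      if "b \<in> carrier A" "m \<in> carrier M" for b m
      unfolding F_def AM_def using a that
      by (simp add: tensor_act_tens tensor_assoc_inv_tens[OF mA mA M] tens_closed[OF mA mA] mt
          tensor_map_tens[OF AA M mA M ml linear_maps_id(1)])
  qed
qed

lemma derivation_product_rule:
  assumes d: "derivation A M d"
  shows "product_rule R M A d"
proof -
  let ?AM = "tensor_module R A M" and ?AA = "tensor_module R A A" and ?MA = "tensor_module R M A"
  let ?m = "alg_mult_map R A"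
  note mA = A.module
  have AM: "module R ?AM" and AA: "module R ?AA" and MA: "module R ?MA"
    by (rule tensor_module_module[OF mA M] tensor_module_module[OF mA mA] tensor_module_module[OF M mA])+
  interpret AM: module R ?AM by (rule AM)
  have dl: "d \<in> linear_maps R A ?AM" using d by (simp add: derivation_def)
  note dc = linear_maps_closed[OF dl]
  have ml: "?m \<in> linear_maps R ?AA A"
    unfolding alg_mult_map_def by (rule tensor_lift_linear[OF mA mA mA algebra_mult_bilinear[OF A]])
  have mt: "?m (tens R A A a b) = a \<otimes>\<^bsub>A\<^esub> b" if "a \<in> carrier A" "b \<in> carrier A" for a b
    unfolding alg_mult_map_def by (rule tensor_lift_tens[OF mA mA mA algebra_mult_bilinear[OF A] that])
  let ?F = "\<lambda>t. tensor_map R A M ?m id (tensor_assoc_inv R A A M t)"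
  \<comment> \<open>The tail of the second summand of the product rule. The symmetry carries the
    right factor past \<open>M\<close>, so it multiplies the first factor from the right; by
    commutativity this is again the action, as \<open>G_act\<close> states.\<close>
  let ?G = "\<lambda>t. ?F (tensor_map R A ?AM id (tensor_swap R M A) (tensor_assoc R A M A t))"
  note m2 = tensor_map_linear[OF mA MA mA AM linear_maps_id(1) tensor_swap_linear[OF M mA]]
  note F = assoc_mult_linear and F_act = assoc_mult_tens
  have G: "?G \<in> linear_maps R (tensor_module R ?AM A) ?AM"
    by (rule linear_maps_comp[OF linear_maps_comp[OF tensor_assoc_linear[OF mA M mA] m2] F])
  note d1 = tensor_map_linear[OF mA mA mA AM linear_maps_id(1) dl]
  note d2 = tensor_map_linear[OF mA mA AM mA dl linear_maps_id(1)]
  have G_act: "?G (tens R ?AM A t a) = tensor_act A M a t" if a: "a \<in> carrier A" and t: "t \<in> carrier ?AM" for a t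
    by (rule tensor_ext[OF mA M AM linear_maps_comp[OF bilinear_maps_left[OF tens_bilinear[OF AM mA] a] G]
          tensor_act_linear[OF a] _ t])
       (use a in \<open>simp add: tensor_act_tens tensor_assoc_inv_tens[OF mA mA M] tensor_assoc_tens[OF mA M mA]
          tens_closed[OF mA mA] tens_closed[OF M mA] mt tensor_swap_tens[OF M mA] A.m_comm
          tensor_map_tens[OF mA MA mA AM linear_maps_id(1) tensor_swap_linear[OF M mA]]
          tensor_map_tens[OF AA M mA M ml linear_maps_id(1)]\<close>)
  have "d (?m x) = ?F (tensor_map R A ?AM id d x) \<oplus>\<^bsub>?AM\<^esub> ?G (tensor_map R ?AM A d id x)"
    if x: "x \<in> carrier ?AA" for x
  proof (rule tensor_ext[OF mA mA AM linear_maps_comp[OF ml dl]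
        linear_maps_plus[OF AM linear_maps_comp[OF d1 F] linear_maps_comp[OF d2 G]] _ x])
    fix a b assume ab: "a \<in> carrier A" "b \<in> carrier A"
    show "d (?m (tens R A A a b)) = ?F (tensor_map R A ?AM id d (tens R A A a b)) \<oplus>\<^bsub>?AM\<^esub>
        ?G (tensor_map R ?AM A d id (tens R A A a b))"
      using ab d
      by (simp add: mt F_act G_act dc derivation_def tensor_map_tens[OF mA mA mA AM linear_maps_id(1) dl]
          tensor_map_tens[OF mA mA AM mA dl linear_maps_id(1)])
  qed
  then show ?thesis
    by (simp add: product_rule_def Let_def)
qed

end

end


section \<open>The derivation of the symmetric algebra\<close>

context base_ring
begin

context
  fixes M :: "('r, 'm) module"
  assumes M: "module R M"
begin

interpretation M: module R M by (rule M)

abbreviation (input) "SM \<equiv> tensor_module R (Sym R M) M"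

text \<open>The function on words that \<open>sym_deriv\<close> lifts, named so that its
  multilinearity and symmetry can be stated.\<close>

definition sym_deriv_word :: "'m list \<Rightarrow> ('r, ('r, 'm) words, 'm) tensor" where
  "sym_deriv_word u = (\<Oplus>\<^bsub>SM\<^esub>i\<in>{..<length u}.
    tens R (Sym R M) M (sym_word R M (take i u @ drop (Suc i) u)) (u ! i))"

lemma SM_module: "module R SM"
  by (rule tensor_module_module[OF Sym_module[OF M] M])

lemma sym_deriv_word_Nil: "sym_deriv_word [] = \<zero>\<^bsub>SM\<^esub>"
proof -
  interpret SM: module R SM by (rule SM_module)
  show ?thesis by (simp add: sym_deriv_word_def)
qed

lemma sym_deriv_summand_closed:
  assumes u: "u \<in> lists (carrier M)" and i: "i < length u"
  shows "tens R (Sym R M) M (sym_word R M (take i u @ drop (Suc i) u)) (u ! i) \<in> carrier SM"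
proof -
  have "set (take i u) \<subseteq> set u" "set (drop (Suc i) u) \<subseteq> set u" "u ! i \<in> set u"
    using i by (simp_all add: set_take_subset set_drop_subset)
  then show ?thesis
    using u by (intro tens_closed[OF Sym_module[OF M] M] sym_word_closed[OF M]) auto
qed

text \<open>Index \<open>0\<close> is the summand in which \<open>a\<close> itself is deleted. At
  index \<open>Suc i\<close> the letter \<open>a\<close> stays in front of the remaining word, that
  is, it multiplies the \<open>i\<close>-th summand for \<open>u\<close>.\<close>

lemma sym_deriv_word_Cons:
  assumes a: "a \<in> carrier M" and u: "u \<in> lists (carrier M)"
  shows "sym_deriv_word (a # u) = tens R (Sym R M) M (sym_word R M u) a \<oplus>\<^bsub>SM\<^esub>
    tensor_act (Sym R M) M (sym_word R M [a]) (sym_deriv_word u)"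
proof -
  let ?S = "Sym R M"
  interpret SM: module R SM by (rule SM_module)
  note alg = Sym_algebra[OF M]
  let ?g = "\<lambda>u i. tens R (?S) M (sym_word R M (take i u @ drop (Suc i) u)) (u ! i)"
  have au: "a # u \<in> lists (carrier M)" using a u by simp
  note cl = sym_deriv_summand_closed[OF au] sym_deriv_summand_closed[OF u]
  have a1: "sym_word R M [a] \<in> carrier (?S)" using a by (simp add: sym_word_closed M)
  have "{..<length (a # u)} = insert 0 (Suc ` {..<length u})"
    by (simp add: lessThan_Suc_eq_insert_0)
  then have "sym_deriv_word (a # u) = (\<Oplus>\<^bsub>SM\<^esub>i\<in>insert 0 (Suc ` {..<length u}). ?g (a # u) i)"
    unfolding sym_deriv_word_def by (rule arg_cong)
  also have "\<dots> = ?g (a # u) 0 \<oplus>\<^bsub>SM\<^esub> (\<Oplus>\<^bsub>SM\<^esub>i\<in>Suc ` {..<length u}. ?g (a # u) i)"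
  proof (rule SM.finsum_insert)
    show "?g (a # u) \<in> Suc ` {..<length u} \<rightarrow> carrier SM"
      by (intro Pi_I cl(1)) auto
    show "?g (a # u) 0 \<in> carrier SM" by (rule cl(1)) simp
  qed auto
  also have "(\<Oplus>\<^bsub>SM\<^esub>i\<in>Suc ` {..<length u}. ?g (a # u) i) = (\<Oplus>\<^bsub>SM\<^esub>i\<in>{..<length u}. ?g (a # u) (Suc i))"
    by (rule SM.finsum_reindex[OF Pi_I[OF cl(1)]]) auto
  also have "\<dots> = (\<Oplus>\<^bsub>SM\<^esub>i\<in>{..<length u}. tensor_act (?S) M (sym_word R M [a]) (?g u i))"
  proof (rule SM.finsum_cong'[OF refl])
    show "(\<lambda>i. tensor_act (?S) M (sym_word R M [a]) (?g u i)) \<in> {..<length u} \<rightarrow> carrier SM"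
      using cl(2) by (auto intro!: tensor_act_closed[OF alg M a1])
    fix i assume "i \<in> {..<length u}"
    then have "set (take i u) \<subseteq> set u" "set (drop (Suc i) u) \<subseteq> set u" "u ! i \<in> set u"
      by (simp_all add: set_take_subset set_drop_subset)
    then have w: "take i u @ drop (Suc i) u \<in> lists (carrier M)" and ui: "u ! i \<in> carrier M"
      using u by auto
    show "?g (a # u) (Suc i) = tensor_act (?S) M (sym_word R M [a]) (?g u i)"
      using a a1 ui
      by (simp add: tensor_act_tens[OF alg M a1 sym_word_closed[OF M w]] Sym_mult_word[OF M _ w])
  qed
  also have "\<dots> = tensor_act (?S) M (sym_word R M [a]) (sym_deriv_word u)"
    unfolding sym_deriv_word_def using cl(2)
    by (intro linear_maps_finsum[OF SM_module SM_module tensor_act_linear[OF alg M a1], symmetric]) auto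
  finally show ?thesis by simp
qed

lemma sym_deriv_word_closed: "u \<in> lists (carrier M) \<Longrightarrow> sym_deriv_word u \<in> carrier SM"
proof -
  interpret SM: module R SM by (rule SM_module)
  show "u \<in> lists (carrier M) \<Longrightarrow> sym_deriv_word u \<in> carrier SM"
    unfolding sym_deriv_word_def
    by (intro SM.finsum_closed Pi_I sym_deriv_summand_closed) auto
qed

lemma sym_deriv_word_symmetric: "sym_deriv_word \<in> symmetric_maps R M SM"
proof (intro symmetric_mapsI multilinear_mapsI sym_deriv_word_closed)
  let ?S = "Sym R M"
  interpret SM: module R SM by (rule SM_module)
  interpret S: algebra R ?S by (rule Sym_algebra[OF M])
  note alg = Sym_algebra[OF M]
  note wl = multilinear_maps_linear[OF sym_word_multilinear[OF M]]
  note t = tens_bilinear[OF Sym_module[OF M] M]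
  have a1: "sym_word R M [a] \<in> carrier (?S)" if "a \<in> carrier M" for a
    using that by (simp add: sym_word_closed M)
  have w1: "(\<lambda>a. sym_word R M [a]) \<in> linear_maps R M (?S)"
    using wl[of "[]" "[]"] by simp
  fix xs ys assume xs: "xs \<in> lists (carrier M)" and ys: "ys \<in> lists (carrier M)"
  show "(\<lambda>a. sym_deriv_word (xs @ a # ys)) \<in> linear_maps R M SM"
    using xs
  proof (induction xs)
    case Nil
    \<comment> \<open>A letter in front enters twice, as the factor in \<open>M\<close> and as the
      acting element, each time linearly.\<close>
    have "(\<lambda>a. tens R (?S) M (sym_word R M ys) a \<oplus>\<^bsub>SM\<^esub>
        tensor_act (?S) M (sym_word R M [a]) (sym_deriv_word ys)) \<in> linear_maps R M SM"
      by (rule linear_maps_plus[OF SM_module bilinear_maps_right[OF t sym_word_closed[OF M ys]]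
            linear_maps_comp[OF w1 bilinear_maps_left[OF tensor_act_bilinear[OF alg M] sym_deriv_word_closed[OF ys]]]])
    then show ?case
      by (rule linear_maps_cong[OF M]) (simp add: sym_deriv_word_Cons ys)
  next
    case (Cons x xs)
    have "(\<lambda>a. tens R (?S) M (sym_word R M (xs @ a # ys)) x \<oplus>\<^bsub>SM\<^esub>
        tensor_act (?S) M (sym_word R M [x]) (sym_deriv_word (xs @ a # ys))) \<in> linear_maps R M SM"
      by (rule linear_maps_plus[OF SM_module
            linear_maps_comp[OF wl[OF Cons.hyps(2) ys] bilinear_maps_left[OF t Cons.hyps(1)]]
            linear_maps_comp[OF Cons.IH tensor_act_linear[OF alg M a1[OF Cons.hyps(1)]]]])
    then show ?case
      by (rule linear_maps_cong[OF M]) (use Cons.hyps ys in \<open>simp add: sym_deriv_word_Cons\<close>)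
  qed
  fix a b assume a: "a \<in> carrier M" and b: "b \<in> carrier M"
  show "sym_deriv_word (xs @ a # b # ys) = sym_deriv_word (xs @ b # a # ys)"
    using xs
  proof (induction xs)
    case Nil
    \<comment> \<open>After two steps of the recursion, the swap exchanges the terms deleting
      \<open>a\<close> and \<open>b\<close>, and the last term depends only on the product of the
      two letters.\<close>
    have expand: "sym_deriv_word (a # b # ys) =
      tens R (?S) M (sym_word R M (b # ys)) a \<oplus>\<^bsub>SM\<^esub> (tens R (?S) M (sym_word R M (a # ys)) b \<oplus>\<^bsub>SM\<^esub>
      tensor_act (?S) M (sym_word R M [a] \<otimes>\<^bsub>?S\<^esub> sym_word R M [b]) (sym_deriv_word ys))"
      if "a \<in> carrier M" "b \<in> carrier M" for a b
      using that ys a1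
      by (simp add: sym_deriv_word_Cons linear_maps_add[OF tensor_act_linear[OF alg M]] tensor_act_tens[OF alg M]
          tens_closed[OF Sym_module[OF M] M] sym_word_closed[OF M] tensor_act_closed[OF alg M]
          sym_deriv_word_closed Sym_mult_word[OF M] tensor_act_mult[OF alg M, symmetric])
    show ?case
      using a b ys a1
      by (simp add: expand S.m_comm[of "sym_word R M [a]" "sym_word R M [b]"] SM.a_lcomm
          tens_closed[OF Sym_module[OF M] M] sym_word_closed[OF M] tensor_act_closed[OF alg M] sym_deriv_word_closed)
  next
    case (Cons x xs)
    then show ?case
      using a b ys symmetric_maps_swap[OF sym_word_symmetric[OF M] Cons.hyps(2) a b ys]
      by (simp add: sym_deriv_word_Cons)
  qed
qed auto

lemma sym_deriv_linear: "sym_deriv R M \<in> linear_maps R (Sym R M) SM"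
  unfolding sym_deriv_def
  by (rule sym_lift_linear[OF M SM_module sym_deriv_word_symmetric[unfolded sym_deriv_word_def[abs_def]]])

lemma sym_deriv_word: "u \<in> lists (carrier M) \<Longrightarrow> sym_deriv R M (sym_word R M u) = sym_deriv_word u"
  unfolding sym_deriv_def sym_deriv_word_def
  by (rule sym_lift_word[OF M SM_module sym_deriv_word_symmetric[unfolded sym_deriv_word_def[abs_def]]])

lemma sym_deriv_Nil: "sym_deriv R M (sym_word R M []) = \<zero>\<^bsub>SM\<^esub>"
  by (simp add: sym_deriv_word sym_deriv_word_Nil)

lemma sym_deriv_Cons:
  "a \<in> carrier M \<Longrightarrow> u \<in> lists (carrier M) \<Longrightarrow>
    sym_deriv R M (sym_word R M (a # u)) = tens R (Sym R M) M (sym_word R M u) a \<oplus>\<^bsub>SM\<^esub>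
      tensor_act (Sym R M) M (sym_word R M [a]) (sym_deriv R M (sym_word R M u))"
  by (simp add: sym_deriv_word sym_deriv_word_Cons)

lemma sym_deriv_generator:
  assumes a: "a \<in> carrier M"
  shows "sym_deriv R M (sym_word R M [a]) = tens R (Sym R M) M \<one>\<^bsub>Sym R M\<^esub> a"
proof -
  interpret SM: module R SM by (rule SM_module)
  have "sym_word R M [a] \<in> carrier (Sym R M)" using a by (simp add: sym_word_closed M)
  from linear_maps_zero[OF SM_module SM_module tensor_act_linear[OF Sym_algebra[OF M] M this]]
  show ?thesis using a
    by (simp add: sym_deriv_Cons sym_deriv_Nil Sym_one tens_closed[OF Sym_module[OF M] M] sym_word_closed[OF M])
qed

lemma sym_deriv_derivation: "derivation (Sym R M) M (sym_deriv R M)"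
proof -
  interpret SM: module R SM by (rule SM_module)
  interpret S: algebra R "Sym R M" by (rule Sym_algebra[OF M])
  let ?d = "sym_deriv R M" and ?S = "Sym R M"
  let ?act = "tensor_act ?S M"
  note alg = Sym_algebra[OF M]
  note dl = sym_deriv_linear and bS = algebra_mult_bilinear[OF alg]
  note l = bilinear_maps_left[OF bS] and r = bilinear_maps_right[OF bS]
  note act = tensor_act_bilinear[OF alg M]
  note dc = linear_maps_closed[OF dl] and ac = bilinear_maps_closed[OF act]
  note wc = sym_word_closed[OF M] and tc = tens_closed[OF Sym_module[OF M] M]
  have words: "?d (sym_word R M u \<otimes>\<^bsub>?S\<^esub> sym_word R M v) =
      ?act (sym_word R M u) (?d (sym_word R M v)) \<oplus>\<^bsub>SM\<^esub> ?act (sym_word R M v) (?d (sym_word R M u))"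
    if "u \<in> lists (carrier M)" and v: "v \<in> lists (carrier M)" for u v
    using that(1)
  proof (induction u)
    case Nil
    have "?act (sym_word R M v) \<zero>\<^bsub>SM\<^esub> = \<zero>\<^bsub>SM\<^esub>"
      by (rule linear_maps_zero[OF SM_module SM_module bilinear_maps_right[OF act wc[OF v]]])
    then show ?case
      using v by (simp add: Sym_one[symmetric] sym_deriv_Nil[folded Sym_one] tensor_act_one[OF alg M] dc wc)
  next
    case (Cons a u)
    let ?a = "sym_word R M [a]" and ?u = "sym_word R M u" and ?v = "sym_word R M v"
    let ?t = "tens R ?S M ?u a"
    have a: "?a \<in> carrier ?S" and u: "?u \<in> carrier ?S" and vc: "?v \<in> carrier ?S"
      using Cons.hyps v by (simp_all add: wc)
    have t: "?t \<in> carrier SM" using u Cons.hyps by (simp add: tc)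
    have du: "?d ?u \<in> carrier SM" and dv: "?d ?v \<in> carrier SM" using u vc by (simp_all add: dc)
    have au: "sym_word R M (a # u) = ?a \<otimes>\<^bsub>?S\<^esub> ?u" using Cons.hyps by (simp add: Sym_mult_word[OF M])
    have "?d (sym_word R M (a # u) \<otimes>\<^bsub>?S\<^esub> ?v) = ?d (sym_word R M (a # (u @ v)))"
      using Cons.hyps v by (simp add: Sym_mult_word[OF M])
    also have "\<dots> = tens R ?S M (sym_word R M (u @ v)) a \<oplus>\<^bsub>SM\<^esub> ?act ?a (?d (sym_word R M (u @ v)))"
      using Cons.hyps v by (simp add: sym_deriv_Cons)
    \<comment> \<open>The term that deletes \<open>a\<close> is \<open>v\<close> acting on
      \<open>u \<otimes> a\<close>. Thus it joins the action of \<open>a\<close> on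
      \<open>d u\<close> under the action of \<open>v\<close>, and together they form
      \<open>d (a # u)\<close>.\<close>
    also have "tens R ?S M (sym_word R M (u @ v)) a = ?act ?v ?t"
      using Cons.hyps v u vc
      by (simp add: tensor_act_tens[OF alg M] Sym_mult_word[OF M]
          sym_word_append_commute[OF M, of "[]" u v, simplified])
    also have "?d (sym_word R M (u @ v)) = ?act ?u (?d ?v) \<oplus>\<^bsub>SM\<^esub> ?act ?v (?d ?u)"
      using Cons.IH Cons.hyps v by (simp add: Sym_mult_word[OF M])
    also have "?act ?a (?act ?u (?d ?v) \<oplus>\<^bsub>SM\<^esub> ?act ?v (?d ?u)) =
        ?act (?a \<otimes>\<^bsub>?S\<^esub> ?u) (?d ?v) \<oplus>\<^bsub>SM\<^esub> ?act ?v (?act ?a (?d ?u))"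
      using a u vc du dv
      by (simp add: linear_maps_add[OF bilinear_maps_right[OF act]] ac tensor_act_mult[OF alg M, symmetric]
          S.m_comm[of ?v ?a])
    also have "?act ?v ?t \<oplus>\<^bsub>SM\<^esub> (?act (?a \<otimes>\<^bsub>?S\<^esub> ?u) (?d ?v) \<oplus>\<^bsub>SM\<^esub> ?act ?v (?act ?a (?d ?u))) =
        ?act (?a \<otimes>\<^bsub>?S\<^esub> ?u) (?d ?v) \<oplus>\<^bsub>SM\<^esub> ?act ?v (?t \<oplus>\<^bsub>SM\<^esub> ?act ?a (?d ?u))"
      using a u vc du dv t
      by (simp add: linear_maps_add[OF bilinear_maps_right[OF act]] ac SM.a_lcomm)
    finally show ?case
      unfolding au[symmetric] using Cons.hyps by (simp add: sym_deriv_Cons)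
  qed
  have "?d (x \<otimes>\<^bsub>?S\<^esub> y) = ?act x (?d y) \<oplus>\<^bsub>SM\<^esub> ?act y (?d x)"
    if x: "x \<in> carrier ?S" and y: "y \<in> carrier ?S" for x y
  proof (rule sym_ext[OF M SM_module linear_maps_comp[OF l[OF y] dl]
        linear_maps_plus[OF SM_module bilinear_maps_left[OF act dc[OF y]]
          linear_maps_comp[OF dl bilinear_maps_right[OF act y]]] _ x])
    fix u assume u: "u \<in> lists (carrier M)"
    note uc = wc[OF u]
    show "?d (sym_word R M u \<otimes>\<^bsub>?S\<^esub> y) = ?act (sym_word R M u) (?d y) \<oplus>\<^bsub>SM\<^esub> ?act y (?d (sym_word R M u))"
      by (rule sym_ext[OF M SM_module linear_maps_comp[OF r[OF uc] dl]
        linear_maps_plus[OF SM_module linear_maps_comp[OF dl bilinear_maps_right[OF act uc]]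
          bilinear_maps_left[OF act dc[OF uc]]] _ y])
        (rule words[OF u])
  qed
  then show ?thesis using dl by (simp add: derivation_def)
qed

end

lemma
  assumes M: "module R M" and N: "module R N" and f: "f \<in> linear_maps R M N"
  shows Sym_map_linear: "Sym_map R N f \<in> linear_maps R (Sym R M) (Sym R N)"
    and Sym_map_word: "u \<in> lists (carrier M) \<Longrightarrow> Sym_map R N f (sym_word R M u) = sym_word R N (map f u)"
  unfolding Sym_map_def
  using sym_lift_linear[OF M Sym_module[OF N] symmetric_maps_map[OF sym_word_symmetric[OF N] f]]
    sym_lift_word[OF M Sym_module[OF N] symmetric_maps_map[OF sym_word_symmetric[OF N] f]]
  by simp_all

lemma sym_deriv_natural:
  assumes M: "module R M" and N: "module R N" and f: "f \<in> linear_maps R M N"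
    and x: "x \<in> carrier (Sym R M)"
  shows "sym_deriv R N (Sym_map R N f x) = tensor_map R (Sym R N) N (Sym_map R N f) f (sym_deriv R M x)"
proof -
  let ?A = "Sym R M" and ?B = "Sym R N"
  let ?SM = "tensor_module R (?A) M" and ?SN = "tensor_module R (?B) N"
  let ?F = "Sym_map R N f" and ?T = "tensor_map R (?B) N (Sym_map R N f) f"
  note mM = Sym_module[OF M] and mN = Sym_module[OF N]
  note SM = tensor_module_module[OF mM M] and SN = tensor_module_module[OF mN N]
  note aM = Sym_algebra[OF M] and aN = Sym_algebra[OF N]
  note Fl = Sym_map_linear[OF M N f]
  note Tl = tensor_map_linear[OF mM M mN N Fl f] and Tt = tensor_map_tens[OF mM M mN N Fl f]
  note Fc = linear_maps_closed[OF Fl] and fc = linear_maps_closed[OF f]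
  \<comment> \<open>\<open>Sym_map\<close> is multiplicative, so \<open>?T\<close> turns the action
    of the letter \<open>a\<close> into that of \<open>f a\<close>. This carries the recursion for
    \<open>d\<close> from \<open>Sym M\<close> to \<open>Sym N\<close>.\<close>
  have act: "?T (tensor_act (?A) M (sym_word R M [a]) t) =
      tensor_act (?B) N (sym_word R N [f a]) (?T t)"
    if a: "a \<in> carrier M" and t: "t \<in> carrier ?SM" for a t
  proof -
    have a1: "sym_word R M [a] \<in> carrier (?A)" "sym_word R N [f a] \<in> carrier (?B)"
      using a by (simp_all add: sym_word_closed M N fc)
    note rM = bilinear_maps_right[OF algebra_mult_bilinear[OF aM] a1(1)]
    note rN = bilinear_maps_right[OF algebra_mult_bilinear[OF aN] a1(2)]
    have F: "?F (sym_word R M [a] \<otimes>\<^bsub>?A\<^esub> y) = sym_word R N [f a] \<otimes>\<^bsub>?B\<^esub> ?F y"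
      if y: "y \<in> carrier (?A)" for y
      by (rule sym_ext[OF M mN linear_maps_comp[OF rM Fl] linear_maps_comp[OF Fl rN] _ y])
         (use a map_in_lists[OF f] in \<open>simp add: Sym_mult_word M N Sym_map_word[OF M N f] fc\<close>)
    show ?thesis
      by (rule tensor_ext[OF mM M SN linear_maps_comp[OF tensor_act_linear[OF aM M a1(1)] Tl]
            linear_maps_comp[OF Tl tensor_act_linear[OF aN N a1(2)]] _ t])
         (use a1 in \<open>simp add: tensor_act_tens[OF aM M] tensor_act_tens[OF aN N] Tt Fc fc F
            linear_maps_closed[OF rM]\<close>)
  qed
  show ?thesis
  proof (rule sym_ext[OF M SN linear_maps_comp[OF Fl sym_deriv_linear[OF N]]
        linear_maps_comp[OF sym_deriv_linear[OF M] Tl] _ x])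
    fix u assume "u \<in> lists (carrier M)"
    then show "sym_deriv R N (?F (sym_word R M u)) = ?T (sym_deriv R M (sym_word R M u))"
    proof (induction u)
      case Nil
      then show ?case
        by (simp add: Sym_map_word[OF M N f] sym_deriv_Nil M N linear_maps_zero[OF SM SN Tl])
    next
      case (Cons a u)
      have wc: "sym_word R M u \<in> carrier (?A)" "sym_word R M [a] \<in> carrier (?A)"
        using Cons.hyps by (simp_all add: sym_word_closed M)
      have dc: "sym_deriv R M (sym_word R M u) \<in> carrier ?SM"
        by (rule linear_maps_closed[OF sym_deriv_linear[OF M] wc(1)])
      have "?T (sym_deriv R M (sym_word R M (a # u))) =
          ?T (tens R (?A) M (sym_word R M u) a) \<oplus>\<^bsub>?SN\<^esub>
          ?T (tensor_act (?A) M (sym_word R M [a]) (sym_deriv R M (sym_word R M u)))"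
        using Cons.hyps wc dc
        by (simp add: sym_deriv_Cons M linear_maps_add[OF Tl] tens_closed[OF mM M] tensor_act_closed[OF aM M])
      also have "\<dots> = tens R (?B) N (sym_word R N (map f u)) (f a) \<oplus>\<^bsub>?SN\<^esub>
          tensor_act (?B) N (sym_word R N [f a]) (sym_deriv R N (sym_word R N (map f u)))"
        using Cons.hyps wc dc Cons.IH by (simp add: act Tt Sym_map_word[OF M N f])
      also have "\<dots> = sym_deriv R N (sym_word R N (map f (a # u)))"
        using Cons.hyps map_in_lists[OF f Cons.hyps(2)] by (simp add: sym_deriv_Cons[OF N] fc)
      finally show ?case using Cons.hyps by (simp add: Sym_map_word[OF M N f])
    qed
  qed
qed

end


section \<open>Derivations of tensor products\<close>

lemma tensor_algebra_prod_map_simps [simp]: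
  "tensor_lift R (tensor_algebra_prod R A B) = tensor_lift R (tensor_module R A B)"
  "tensor_map R (tensor_algebra_prod R A B) N = tensor_map R (tensor_module R A B) N"
  "tensor_map R N (tensor_algebra_prod R A B) = tensor_map R N (tensor_module R A B)"
  "tensor_assoc R (tensor_algebra_prod R A B) N L = tensor_assoc R (tensor_module R A B) N L"
  "tensor_assoc_inv R (tensor_algebra_prod R A B) N L = tensor_assoc_inv R (tensor_module R A B) N L"
proof -
  show lift: "tensor_lift R (tensor_algebra_prod R A B) = tensor_lift R (tensor_module R A B)" for A B
    by (simp add: tensor_algebra_prod_def Let_def)
  show "tensor_map R (tensor_algebra_prod R A B) N = tensor_map R (tensor_module R A B) N"
    "tensor_map R N (tensor_algebra_prod R A B) = tensor_map R N (tensor_module R A B)"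
    "tensor_assoc R (tensor_algebra_prod R A B) N L = tensor_assoc R (tensor_module R A B) N L"
    "tensor_assoc_inv R (tensor_algebra_prod R A B) N L = tensor_assoc_inv R (tensor_module R A B) N L"
    by (simp_all add: tensor_map_def tensor_assoc_def tensor_assoc_inv_def Let_def fun_eq_iff)
qed

context base_ring
begin

text \<open>The map \<open>1 \<otimes> \<sigma>\<close> of the interchange rule, together with the
  associators that surround it.\<close>

definition swap_last ::
  "('r, 'a) module \<Rightarrow> ('r, 'm) module \<Rightarrow> ('r, ('r, 'a, 'm) tensor, 'm) tensor \<Rightarrow>
    ('r, ('r, 'a, 'm) tensor, 'm) tensor" where
  "swap_last A M z = tensor_assoc_inv R A M M
    (tensor_map R A (tensor_module R M M) id (tensor_swap R M M) (tensor_assoc R A M M z))"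

lemma interchange_rule_swap_last:
  "interchange_rule R M A d \<longleftrightarrow>
    (\<forall>x\<in>carrier A. tensor_map R (tensor_module R A M) M d id (d x) =
      swap_last A M (tensor_map R (tensor_module R A M) M d id (d x)))"
  by (simp add: interchange_rule_def swap_last_def Let_def)

lemma
  assumes A: "module R A" and M: "module R M"
  defines "AM \<equiv> tensor_module R A M"
  shows swap_last_linear: "swap_last A M \<in> linear_maps R (tensor_module R AM M) (tensor_module R AM M)"
    and swap_last_tens: "a \<in> carrier A \<Longrightarrow> m \<in> carrier M \<Longrightarrow> n \<in> carrier M \<Longrightarrow>
      swap_last A M (tens R AM M (tens R A M a m) n) = tens R AM M (tens R A M a n) m"
proof -
  have MM: "module R (tensor_module R M M)" by (rule tensor_module_module[OF M M])
  note sw = tensor_swap_linear[OF M M]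
  have "(\<lambda>z. swap_last A M z) \<in> linear_maps R (tensor_module R AM M) (tensor_module R AM M)"
    unfolding swap_last_def AM_def
    by (rule linear_maps_comp[OF linear_maps_comp[OF tensor_assoc_linear[OF A M M]
          tensor_map_linear[OF A MM A MM linear_maps_id(1) sw]] tensor_assoc_inv_linear[OF A M M]])
  then show "swap_last A M \<in> linear_maps R (tensor_module R AM M) (tensor_module R AM M)" by simp
  show "swap_last A M (tens R AM M (tens R A M a m) n) = tens R AM M (tens R A M a n) m"
    if "a \<in> carrier A" "m \<in> carrier M" "n \<in> carrier M"
    using that unfolding swap_last_def AM_def
    by (simp add: tensor_assoc_tens[OF A M M] tensor_assoc_inv_tens[OF A M M]
        tensor_map_tens[OF A MM A MM linear_maps_id(1) sw] tens_closed[OF M M] tensor_swap_tens[OF M M])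
qed

lemma tensor_ext_left:
  assumes A: "module R A" and B: "module R B" and C: "module R C" and L: "module R L"
    and f: "f \<in> linear_maps R (tensor_module R (tensor_module R A B) C) L"
    and g: "g \<in> linear_maps R (tensor_module R (tensor_module R A B) C) L"
    and eq: "\<And>a b c. a \<in> carrier A \<Longrightarrow> b \<in> carrier B \<Longrightarrow> c \<in> carrier C \<Longrightarrow>
      f (tens R (tensor_module R A B) C (tens R A B a b) c) = g (tens R (tensor_module R A B) C (tens R A B a b) c)"
    and z: "z \<in> carrier (tensor_module R (tensor_module R A B) C)"
  shows "f z = g z"
proof (rule tensor_ext[OF tensor_module_module[OF A B] C L f g _ z])
  fix t c assume t: "t \<in> carrier (tensor_module R A B)" and c: "c \<in> carrier C"
  note l = bilinear_maps_left[OF tens_bilinear[OF tensor_module_module[OF A B] C] c]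
  show "f (tens R (tensor_module R A B) C t c) = g (tens R (tensor_module R A B) C t c)"
    by (rule tensor_ext[OF A B L linear_maps_comp[OF l f] linear_maps_comp[OF l g] eq[OF _ _ c] t])
qed

text \<open>Applied to two kinds of maps: \<open>a \<mapsto> x \<otimes> a\<close> with
  \<open>x\<close> fixed, which reduces the interchange rule for \<open>b\<close> to that for
  \<open>d\<close>, and multiplication by a letter in \<open>Sym M\<close>.\<close>

lemma swap_last_natural:
  assumes A: "module R A" and B: "module R B" and M: "module R M" and f: "f \<in> linear_maps R A B"
    and z: "z \<in> carrier (tensor_module R (tensor_module R A M) M)"
  shows "swap_last B M (tensor_map R (tensor_module R B M) M (tensor_map R B M f id) id z) =
    tensor_map R (tensor_module R B M) M (tensor_map R B M f id) id (swap_last A M z)"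
proof -
  note AM = tensor_module_module[OF A M] and BM = tensor_module_module[OF B M]
  note f1 = tensor_map_linear[OF A M B M f linear_maps_id(1)]
    and t1 = tensor_map_tens[OF A M B M f linear_maps_id(1)]
  note f2 = tensor_map_linear[OF AM M BM M f1 linear_maps_id(1)]
    and t2 = tensor_map_tens[OF AM M BM M f1 linear_maps_id(1)]
  show ?thesis
    by (rule tensor_ext_left[OF A M M tensor_module_module[OF BM M]
          linear_maps_comp[OF f2 swap_last_linear[OF B M]] linear_maps_comp[OF swap_last_linear[OF A M] f2] _ z])
       (simp add: t1 t2 swap_last_tens[OF A M] swap_last_tens[OF B M] tens_closed[OF A M] linear_maps_closed[OF f])
qed

text \<open>The map \<open>1 \<otimes> d\<close> for arbitrary \<open>S\<close>, \<open>A\<close>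
  and \<open>d\<close>; \<open>RBSym_deriv\<close> is its instance at \<open>Sh (Sym M)\<close>,
  \<open>Sym M\<close> and \<open>sym_deriv\<close>.\<close>

definition tensor_deriv ::
  "('r, 's) module \<Rightarrow> ('r, 'a) module \<Rightarrow> ('r, 'm) module \<Rightarrow> ('a \<Rightarrow> ('r, 'a, 'm) tensor) \<Rightarrow>
    ('r, 's, 'a) tensor \<Rightarrow> ('r, ('r, 's, 'a) tensor, 'm) tensor" where
  "tensor_deriv S A M d t =
    tensor_assoc_inv R S A M (tensor_map R S (tensor_module R A M) id d t)"

context
  fixes S :: "('r, 's) module" and A :: "('r, 'a) module" and M :: "('r, 'm) module"
    and d :: "'a \<Rightarrow> ('r, 'a, 'm) tensor"
  assumes S: "module R S" and A: "module R A" and M: "module R M"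
    and d: "d \<in> linear_maps R A (tensor_module R A M)"
begin

abbreviation (input) "W \<equiv> tensor_module R S A"
abbreviation (input) "WM \<equiv> tensor_module R W M"

lemma tensor_deriv_linear: "tensor_deriv S A M d \<in> linear_maps R W WM"
proof -
  have "(\<lambda>t. tensor_deriv S A M d t) \<in> linear_maps R W WM"
    unfolding tensor_deriv_def
    by (rule linear_maps_comp[OF tensor_map_linear[OF S A S tensor_module_module[OF A M] linear_maps_id(1) d]
          tensor_assoc_inv_linear[OF S A M]])
  then show ?thesis by simp
qed

lemma tens_map_linear:
  "x \<in> carrier S \<Longrightarrow> tensor_map R W M (tens R S A x) id \<in> linear_maps R (tensor_module R A M) WM"
  by (rule tensor_map_linear[OF A M tensor_module_module[OF S A] M
        bilinear_maps_right[OF tens_bilinear[OF S A]] linear_maps_id(1)])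

lemma tens_map_tens:
  "x \<in> carrier S \<Longrightarrow> a \<in> carrier A \<Longrightarrow> m \<in> carrier M \<Longrightarrow>
    tensor_map R W M (tens R S A x) id (tens R A M a m) = tens R W M (tens R S A x a) m"
  by (simp add: tensor_map_tens[OF A M tensor_module_module[OF S A] M
        bilinear_maps_right[OF tens_bilinear[OF S A]] linear_maps_id(1)])

text \<open>With \<open>x\<close> fixed, the inverse associator \<open>x \<otimes> (a \<otimes> m)
  \<mapsto> (x \<otimes> a) \<otimes> m\<close> is the map \<open>tens x\<close> on the first
  factor. This is the identity through which all properties of \<open>d\<close> pass to
  \<open>1 \<otimes> d\<close>.\<close>

lemma tensor_deriv_tens:
  assumes x: "x \<in> carrier S" and u: "u \<in> carrier A"
  shows "tensor_deriv S A M d (tens R S A x u) = tensor_map R W M (tens R S A x) id (d u)"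
proof -
  note AM = tensor_module_module[OF A M] and WM = tensor_module_module[OF tensor_module_module[OF S A] M]
  have "tensor_assoc_inv R S A M (tens R S (tensor_module R A M) x t) = tensor_map R W M (tens R S A x) id t"
    if t: "t \<in> carrier (tensor_module R A M)" for t
    by (rule tensor_ext[OF A M WM linear_maps_comp[OF bilinear_maps_right[OF tens_bilinear[OF S AM] x]
            tensor_assoc_inv_linear[OF S A M]] tens_map_linear[OF x] _ t])
       (use x in \<open>simp add: tens_map_tens tensor_assoc_inv_tens[OF S A M]\<close>)
  then show ?thesis
    using x u linear_maps_closed[OF d u]
    by (simp add: tensor_deriv_def tensor_map_tens[OF S A S AM linear_maps_id(1) d])
qed

lemma tensor_deriv_interchange:
  assumes ir: "interchange_rule R M A d"
  shows "interchange_rule R M (tensor_algebra_prod R S A) (tensor_deriv S A M d)"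
proof -
  let ?b = "tensor_deriv S A M d" and ?AM = "tensor_module R A M"
  have mW: "module R W" by (rule tensor_module_module[OF S A])
  note AM = tensor_module_module[OF A M] and WM = tensor_module_module[OF mW M]
  note bl = tensor_deriv_linear
  note b1 = tensor_map_linear[OF mW M WM M bl linear_maps_id(1)]
    and b1t = tensor_map_tens[OF mW M WM M bl linear_maps_id(1)]
  note d1 = tensor_map_linear[OF A M AM M d linear_maps_id(1)]
    and d1t = tensor_map_tens[OF A M AM M d linear_maps_id(1)]
  note bb = linear_maps_comp[OF bl b1]
  have "tensor_map R WM M ?b id (?b t) = swap_last W M (tensor_map R WM M ?b id (?b t))"
    if t: "t \<in> carrier W" for t
  proof (rule tensor_ext[OF S A tensor_module_module[OF WM M] bb
        linear_maps_comp[OF bb swap_last_linear[OF mW M]] _ t])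
    fix x u assume x: "x \<in> carrier S" and u: "u \<in> carrier A"
    let ?J = "tensor_map R W M (tens R S A x) id"
    note J = tens_map_linear[OF x] and Jl = bilinear_maps_right[OF tens_bilinear[OF S A] x]
    note J1 = tensor_map_linear[OF AM M WM M J linear_maps_id(1)]
      and J1t = tensor_map_tens[OF AM M WM M J linear_maps_id(1)]
    \<comment> \<open>The second application of \<open>b\<close> also passes the inclusion of
      \<open>A\<close> at \<open>x\<close>. So \<open>b\<close> applied twice to
      \<open>x \<otimes> u\<close> is the image of \<open>d\<close> applied twice to
      \<open>u\<close>, and \<open>swap_last_natural\<close> moves the swap past the
      inclusion.\<close>
    have comm: "tensor_map R WM M ?b id (?J s) = tensor_map R WM M ?J id (tensor_map R ?AM M d id s)"
      if s: "s \<in> carrier ?AM" for s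
      by (rule tensor_ext[OF A M tensor_module_module[OF WM M] linear_maps_comp[OF J b1] linear_maps_comp[OF d1 J1] _ s])
         (use x in \<open>simp add: tens_map_tens b1t tens_closed[OF S A] d1t J1t linear_maps_closed[OF d] tensor_deriv_tens\<close>)
    have du: "d u \<in> carrier ?AM" by (rule linear_maps_closed[OF d u])
    have "tensor_map R ?AM M d id (d u) = swap_last A M (tensor_map R ?AM M d id (d u))"
      using ir u by (simp add: interchange_rule_swap_last)
    then show "tensor_map R WM M ?b id (?b (tens R S A x u)) =
        swap_last W M (tensor_map R WM M ?b id (?b (tens R S A x u)))"
      using swap_last_natural[OF A mW M Jl linear_maps_closed[OF d1 du]]
      by (simp add: tensor_deriv_tens x u comm du)
  qed
  then show ?thesis
    by (simp add: interchange_rule_swap_last) (simp add: swap_last_def)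
qed

end

lemma tensor_deriv_derivation:
  assumes S: "algebra R S" and A: "algebra R A" and M: "module R M" and d: "derivation A M d"
  shows "derivation (tensor_algebra_prod R S A) M (tensor_deriv S A M d)"
proof -
  interpret S: algebra R S by (rule S)
  interpret A: algebra R A by (rule A)
  let ?W = "tensor_module R S A" and ?T = "tensor_algebra_prod R S A" and ?AM = "tensor_module R A M"
  let ?b = "tensor_deriv S A M d"
  note mS = S.module and mA = A.module
  note mW = tensor_module_module[OF mS mA]
  let ?WM = "tensor_module R ?W M"
  note WM = tensor_module_module[OF mW M]
  have dl: "d \<in> linear_maps R A ?AM" using d by (simp add: derivation_def)
  note T = tensor_algebra_prod_algebra[OF S A] and Tm = tensor_algebra_prod_mult[OF S A]
  note bT = algebra_mult_bilinear[OF T]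
  note bl = tensor_deriv_linear[OF mS mA M dl] and bt = tensor_deriv_tens[OF mS mA M dl]
  note act = tensor_act_bilinear[OF T M] and act_tens = tensor_act_tens[OF T M]
  note J = tens_map_linear[OF mS mA M] and Jt = tens_map_tens[OF mS mA M]
  note tc = tens_closed[OF mS mA]
  have blT: "?b \<in> linear_maps R ?T (tensor_module R ?T M)" using bl by simp
  note bc = linear_maps_closed[OF blT]
  have WMT: "module R (tensor_module R ?T M)" using WM by simp
  \<comment> \<open>Elements of \<open>S\<close> behave as constants: \<open>x \<otimes> u\<close>
    acts on the image of \<open>y\<close> by multiplying the constants and letting \<open>u\<close>
    act in \<open>A \<otimes> M\<close>. Both Leibniz terms thus lie in the image of the same
    constant, \<open>x\<close> times \<open>y\<close>, as \<open>S\<close> is commutative.\<close>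
  have act_J: "tensor_act ?T M (tens R S A x u) (tensor_map R ?W M (tens R S A y) id t) =
      tensor_map R ?W M (tens R S A (x \<otimes>\<^bsub>S\<^esub> y)) id (tensor_act A M u t)"
    if x: "x \<in> carrier S" and y: "y \<in> carrier S" and u: "u \<in> carrier A" and t: "t \<in> carrier ?AM" for x y u t
  proof -
    have xu: "tens R S A x u \<in> carrier ?T" using tc[OF x u] by simp
    have Jy: "tensor_map R ?W M (tens R S A y) id \<in> linear_maps R ?AM (tensor_module R ?T M)"
      using J[OF dl y] by simp
    have Jxy: "tensor_map R ?W M (tens R S A (x \<otimes>\<^bsub>S\<^esub> y)) id \<in> linear_maps R ?AM (tensor_module R ?T M)"
      using J[OF dl, of "x \<otimes>\<^bsub>S\<^esub> y"] x y by simp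
    show ?thesis
      by (rule tensor_ext[OF mA M WMT linear_maps_comp[OF Jy bilinear_maps_right[OF act xu]]
            linear_maps_comp[OF tensor_act_linear[OF A M u] Jxy] _ t])
         (use x y u tc act_tens in \<open>simp add: Jt[OF dl] Tm tensor_act_tens[OF A M]\<close>)
  qed
  have "?b (p \<otimes>\<^bsub>?T\<^esub> q) = tensor_act ?T M p (?b q) \<oplus>\<^bsub>tensor_module R ?T M\<^esub> tensor_act ?T M q (?b p)"
    if p: "p \<in> carrier ?T" and q: "q \<in> carrier ?T" for p q
  proof (rule tensor_ext[OF mS mA WMT _ _ _ p[unfolded tensor_algebra_prod_module_simps]])
    show "(\<lambda>p. ?b (p \<otimes>\<^bsub>?T\<^esub> q)) \<in> linear_maps R ?W (tensor_module R ?T M)"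
      using linear_maps_comp[OF bilinear_maps_left[OF bT q] blT] by simp
    show "(\<lambda>p. tensor_act ?T M p (?b q) \<oplus>\<^bsub>tensor_module R ?T M\<^esub> tensor_act ?T M q (?b p))
        \<in> linear_maps R ?W (tensor_module R ?T M)"
      using linear_maps_plus[OF WMT bilinear_maps_left[OF act bc[OF q]]
          linear_maps_comp[OF blT bilinear_maps_right[OF act q]]] by simp
    fix x u assume x: "x \<in> carrier S" and u: "u \<in> carrier A"
    let ?p = "tens R S A x u"
    have p: "?p \<in> carrier ?T" using tc[OF x u] by simp
    show "?b (?p \<otimes>\<^bsub>?T\<^esub> q) = tensor_act ?T M ?p (?b q) \<oplus>\<^bsub>tensor_module R ?T M\<^esub> tensor_act ?T M q (?b ?p)"
    proof (rule tensor_ext[OF mS mA WMT _ _ _ q[unfolded tensor_algebra_prod_module_simps]])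
      show "(\<lambda>q. ?b (?p \<otimes>\<^bsub>?T\<^esub> q)) \<in> linear_maps R ?W (tensor_module R ?T M)"
        using linear_maps_comp[OF bilinear_maps_right[OF bT p] blT] by simp
      show "(\<lambda>q. tensor_act ?T M ?p (?b q) \<oplus>\<^bsub>tensor_module R ?T M\<^esub> tensor_act ?T M q (?b ?p))
          \<in> linear_maps R ?W (tensor_module R ?T M)"
        using linear_maps_plus[OF WMT linear_maps_comp[OF blT bilinear_maps_right[OF act p]]
            bilinear_maps_left[OF act bc[OF p]]] by simp
      fix y v assume y: "y \<in> carrier S" and v: "v \<in> carrier A"
      let ?q = "tens R S A y v" and ?J = "tensor_map R ?W M (tens R S A (x \<otimes>\<^bsub>S\<^esub> y)) id"
      have xy: "x \<otimes>\<^bsub>S\<^esub> y \<in> carrier S" using x y by simp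
      note du = linear_maps_closed[OF dl u] and dv = linear_maps_closed[OF dl v]
      have "?b (?p \<otimes>\<^bsub>?T\<^esub> ?q) = ?J (d (u \<otimes>\<^bsub>A\<^esub> v))"
        using x y u v by (simp add: Tm bt)
      also have "\<dots> = ?J (tensor_act A M u (d v) \<oplus>\<^bsub>?AM\<^esub> tensor_act A M v (d u))"
        using d u v by (simp add: derivation_def)
      also have "\<dots> = ?J (tensor_act A M u (d v)) \<oplus>\<^bsub>?WM\<^esub> ?J (tensor_act A M v (d u))"
        by (rule linear_maps_add[OF J[OF dl xy]]) (use u v du dv in \<open>simp_all add: tensor_act_closed[OF A M]\<close>)
      also have "\<dots> = tensor_act ?T M ?p (?b ?q) \<oplus>\<^bsub>?WM\<^esub> tensor_act ?T M ?q (?b ?p)"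
        using x y u v du dv by (simp add: bt act_J S.m_comm[of y x])
      finally show "?b (?p \<otimes>\<^bsub>?T\<^esub> ?q) =
          tensor_act ?T M ?p (?b ?q) \<oplus>\<^bsub>tensor_module R ?T M\<^esub> tensor_act ?T M ?q (?b ?p)"
        by simp
    qed
  qed
  then show ?thesis using blT unfolding derivation_def by blast
qed

text \<open>Deriving \<open>a u\<close> twice gives three terms: \<open>a\<close> removed first,
  \<open>a\<close> removed second, and \<open>a\<close> acting on the second derivative of
  \<open>u\<close>. The swap exchanges the first two and fixes the third by the induction
  hypothesis.\<close>

lemma sym_deriv_interchange:
  assumes M: "module R M"
  shows "interchange_rule R M (Sym R M) (sym_deriv R M)"
proof -
  let ?S = "Sym R M" and ?SM = "tensor_module R (Sym R M) M" and ?d = "sym_deriv R M"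
  note mS = Sym_module[OF M] and alg = Sym_algebra[OF M]
  interpret S: algebra R ?S by (rule alg)
  note SM = tensor_module_module[OF mS M]
  let ?SMM = "tensor_module R ?SM M"
  note SMM = tensor_module_module[OF SM M]
  interpret SMM: module R ?SMM by (rule SMM)
  note dl = sym_deriv_linear[OF M]
  note dc = linear_maps_closed[OF dl]
  let ?sw = "swap_last ?S M"
  define D where "D = tensor_map R ?SM M ?d id"
  note Dl = tensor_map_linear[OF mS M SM M dl linear_maps_id(1), folded D_def]
    and Dt = tensor_map_tens[OF mS M SM M dl linear_maps_id(1), folded D_def]
  note sl = swap_last_linear[OF mS M] and st = swap_last_tens[OF mS M]
  note tc = tens_closed[OF mS M] and tc2 = tens_closed[OF SM M]
  note tl = bilinear_maps_left[OF tens_bilinear[OF mS M]] and tl2 = bilinear_maps_left[OF tens_bilinear[OF SM M]]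
  have words: "D (?d (sym_word R M u)) = ?sw (D (?d (sym_word R M u)))"
    if "u \<in> lists (carrier M)" for u
    using that
  proof (induction u)
    case Nil
    show ?case
      unfolding sym_deriv_Nil[OF M] linear_maps_zero[OF SM SMM Dl] linear_maps_zero[OF SMM SMM sl] ..
  next
    case (Cons a u)
    then have a: "a \<in> carrier M" by simp
    let ?a = "sym_word R M [a]" and ?t = "?d (sym_word R M u)"
    \<comment> \<open>\<open>?i\<close> inserts \<open>a\<close> as the middle factor, whereas
      tensoring with \<open>a\<close> on the right puts it last; \<open>sw1\<close> and
      \<open>sw2\<close> say that the swap exchanges the two.\<close>
    let ?i = "tensor_map R ?SM M (\<lambda>w. tens R ?S M w a) id"
    let ?act = "tensor_act ?S M ?a"
    let ?act2 = "tensor_map R ?SM M ?act id"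
    have ac: "?a \<in> carrier ?S" using a by (simp add: sym_word_closed M)
    have uc: "sym_word R M u \<in> carrier ?S" using Cons.hyps by (simp add: sym_word_closed M)
    have t: "?t \<in> carrier ?SM" by (rule dc[OF uc])
    note al = tensor_act_linear[OF alg M ac] and at = tensor_act_tens[OF alg M ac]
    note il = tensor_map_linear[OF mS M SM M tl[OF a] linear_maps_id(1)]
      and it = tensor_map_tens[OF mS M SM M tl[OF a] linear_maps_id(1)]
    note a2l = tensor_map_linear[OF SM M SM M al linear_maps_id(1)]
      and a2t = tensor_map_tens[OF SM M SM M al linear_maps_id(1)]
    have one: "tensor_act ?S M w (tens R ?S M \<one>\<^bsub>?S\<^esub> a) = tens R ?S M w a" if "w \<in> carrier ?S" for w
      using that a by (simp add: tensor_act_tens[OF alg M])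
    \<comment> \<open>The recursion is needed for every element \<open>w\<close>, because
      \<open>tensor_ext\<close> in \<open>Da\<close> presents arbitrary first factors; the Leibniz
      rule provides it beyond words.\<close>
    have da: "?d (?a \<otimes>\<^bsub>?S\<^esub> w) = tens R ?S M w a \<oplus>\<^bsub>?SM\<^esub> ?act (?d w)" if w: "w \<in> carrier ?S" for w
    proof -
      interpret SM: module R ?SM by (rule SM)
      have "?d (?a \<otimes>\<^bsub>?S\<^esub> w) = ?act (?d w) \<oplus>\<^bsub>?SM\<^esub> tensor_act ?S M w (?d ?a)"
        using sym_deriv_derivation[OF M] ac w unfolding derivation_def by blast
      then show ?thesis
        using w a linear_maps_closed[OF al dc[OF w]]
        by (simp add: sym_deriv_generator[OF M] one SM.a_comm tc)
    qed
    have Da: "D (?act s) = ?i s \<oplus>\<^bsub>?SMM\<^esub> ?act2 (D s)" if s: "s \<in> carrier ?SM" for s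
      by (rule tensor_ext[OF mS M SMM linear_maps_comp[OF al Dl]
            linear_maps_plus[OF SMM il linear_maps_comp[OF Dl a2l]] _ s])
         (use a ac in \<open>simp add: at Dt it a2t da dc tc linear_maps_closed[OF al] linear_maps_add[OF tl2]\<close>)
    have sw1: "?sw (tens R ?SM M s a) = ?i s" if s: "s \<in> carrier ?SM" for s
      by (rule tensor_ext[OF mS M SMM linear_maps_comp[OF tl2[OF a] sl] il _ s])
         (use a in \<open>simp add: it st\<close>)
    have sw2: "?sw (?i s) = tens R ?SM M s a" if s: "s \<in> carrier ?SM" for s
      by (rule tensor_ext[OF mS M SMM linear_maps_comp[OF il sl] tl2[OF a] _ s])
         (use a in \<open>simp add: it st\<close>)
    have sw3: "?sw (?act2 z) = ?act2 (?sw z)" if "z \<in> carrier ?SMM" for z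
      unfolding tensor_act_def
      by (rule swap_last_natural[OF mS mS M bilinear_maps_right[OF algebra_mult_bilinear[OF alg] ac] that])
    have Dt': "D ?t \<in> carrier ?SMM" by (rule linear_maps_closed[OF Dl t])
    have eq: "D (?d (sym_word R M (a # u))) = tens R ?SM M ?t a \<oplus>\<^bsub>?SMM\<^esub> (?i ?t \<oplus>\<^bsub>?SMM\<^esub> ?act2 (D ?t))"
      using Cons.hyps uc t
      by (simp add: sym_deriv_Cons[OF M] linear_maps_add[OF Dl] tc linear_maps_closed[OF al] Dt Da)
    have cl: "tens R ?SM M ?t a \<in> carrier ?SMM" "?i ?t \<in> carrier ?SMM" "?act2 (D ?t) \<in> carrier ?SMM"
      by (rule tc2[OF t a] linear_maps_closed[OF il t] linear_maps_closed[OF a2l Dt'])+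
    have "?sw (D (?d (sym_word R M (a # u)))) = ?i ?t \<oplus>\<^bsub>?SMM\<^esub> (tens R ?SM M ?t a \<oplus>\<^bsub>?SMM\<^esub> ?act2 (?sw (D ?t)))"
      unfolding eq using cl t Dt' by (simp add: linear_maps_add[OF sl] sw1 sw2 sw3)
    also have "\<dots> = tens R ?SM M ?t a \<oplus>\<^bsub>?SMM\<^esub> (?i ?t \<oplus>\<^bsub>?SMM\<^esub> ?act2 (D ?t))"
      using cl by (simp add: Cons.IH[symmetric] SMM.a_lcomm)
    finally show ?case unfolding eq ..
  qed
  note DD = linear_maps_comp[OF dl Dl]
  show ?thesis
    unfolding interchange_rule_swap_last D_def[symmetric]
    by (intro ballI, rule sym_ext[OF M SMM DD linear_maps_comp[OF DD sl]]) (rule words)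
qed

end


section \<open>The chain rule\<close>

context base_ring
begin

lemma Sh_map_linear:
  assumes N: "module R N" and N': "module R N'" and f: "f \<in> linear_maps R N N'"
  shows "Sh_map R N' f \<in> linear_maps R (Sh R N) (Sh R N')"
  unfolding Sh_map_def
  by (rule sh_lift_linear[OF N Sh_module[OF N'] multilinear_maps_map[OF sh_word_multilinear[OF N'] f]])

lemma foldr_mult_symmetric:
  assumes T: "algebra R T"
  shows "(\<lambda>u. foldr (mult T) u \<one>\<^bsub>T\<^esub>) \<in> symmetric_maps R T T"
proof -
  interpret T: algebra R T by (rule T)
  note bil = algebra_mult_bilinear[OF T]
  have cl: "foldr (mult T) u \<one>\<^bsub>T\<^esub> \<in> carrier T" if "u \<in> lists (carrier T)" for u
    using that by (induction u) auto
  show ?thesis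
  proof (intro symmetric_mapsI multilinear_mapsI cl)
    fix xs ys assume xs: "xs \<in> lists (carrier T)" and ys: "ys \<in> lists (carrier T)"
    from xs show "(\<lambda>a. foldr (mult T) (xs @ a # ys) \<one>\<^bsub>T\<^esub>) \<in> linear_maps R T T"
    proof (induction xs)
      case Nil
      show ?case using bilinear_maps_left[OF bil cl[OF ys]] by simp
    next
      case (Cons x xs)
      show ?case using linear_maps_comp[OF Cons.IH bilinear_maps_right[OF bil Cons.hyps(1)]] by simp
    qed
    fix a b assume "a \<in> carrier T" "b \<in> carrier T"
    with xs cl[OF ys] show "foldr (mult T) (xs @ a # b # ys) \<one>\<^bsub>T\<^esub> = foldr (mult T) (xs @ b # a # ys) \<one>\<^bsub>T\<^esub>"
      by (induction xs) (auto simp: T.m_lcomm)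
  qed
qed

lemma
  assumes T: "algebra R T"
  shows Sym_counit_linear: "Sym_counit R T \<in> linear_maps R (Sym R T) T"
    and Sym_counit_word: "u \<in> lists (carrier T) \<Longrightarrow>
      Sym_counit R T (sym_word R T u) = foldr (mult T) u \<one>\<^bsub>T\<^esub>"
proof -
  note mT = algebra.module[OF T]
  show "Sym_counit R T \<in> linear_maps R (Sym R T) T"
    "u \<in> lists (carrier T) \<Longrightarrow> Sym_counit R T (sym_word R T u) = foldr (mult T) u \<one>\<^bsub>T\<^esub>"
    unfolding Sym_counit_def
    using sym_lift_linear[OF mT mT foldr_mult_symmetric[OF T]] sym_lift_word[OF mT mT foldr_mult_symmetric[OF T]]
    by simp_all
qed

context
  fixes T :: "('r, 't) module" and M :: "('r, 'm) module" and d :: "'t \<Rightarrow> ('r, 't, 'm) tensor"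
  assumes T: "algebra R T" and M: "module R M" and d: "derivation T M d"
begin

interpretation T: algebra R T by (rule T)

abbreviation (input) "TM \<equiv> tensor_module R T M"

text \<open>\<open>(\<nu> \<otimes> d)(\<nabla> \<otimes> 1)\<close>, the second half of the right-hand side of the chain rule.\<close>
definition chain_map :: "('u \<Rightarrow> 't) \<Rightarrow> ('r, 'u, 't) tensor \<Rightarrow> ('r, 't, 'm) tensor" where
  "chain_map \<nu> s = tensor_map R T M (alg_mult_map R T) id
    (tensor_assoc_inv R T T M (tensor_map R T TM \<nu> d s))"

lemma chain_map_linear:
  assumes B: "module R B" and \<nu>: "\<nu> \<in> linear_maps R B T"
  shows "chain_map \<nu> \<in> linear_maps R (tensor_module R B T) TM"
proof -
  have dl: "d \<in> linear_maps R T TM" using d by (simp add: derivation_def)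
  have "(\<lambda>s. chain_map \<nu> s) \<in> linear_maps R (tensor_module R B T) TM"
    unfolding chain_map_def
    by (rule linear_maps_comp[OF tensor_map_linear[OF B T.module T.module tensor_module_module[OF T.module M] \<nu> dl]
          assoc_mult_linear[OF T M]])
  then show ?thesis by simp
qed

lemma chain_map_tens:
  assumes B: "module R B" and \<nu>: "\<nu> \<in> linear_maps R B T" and z: "z \<in> carrier B" and t: "t \<in> carrier T"
  shows "chain_map \<nu> (tens R B T z t) = tensor_act T M (\<nu> z) (d t)"
proof -
  have dl: "d \<in> linear_maps R T TM" using d by (simp add: derivation_def)
  show ?thesis
    unfolding chain_map_def
    using tensor_map_tens[OF B T.module T.module tensor_module_module[OF T.module M] \<nu> dl z t]
      assoc_mult_tens[OF T M linear_maps_closed[OF \<nu> z] linear_maps_closed[OF dl t]]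
    by simp
qed

text \<open>The Leibniz rule for a product of several factors: the summand of
  \<open>sym_deriv\<close> that removes \<open>t\<close> becomes the product of the other factors
  acting on \<open>d t\<close>.\<close>

lemma sym_chain_rule:
  assumes x: "x \<in> carrier (Sym R T)"
  shows "d (Sym_counit R T x) = chain_map (Sym_counit R T) (sym_deriv R T x)"
proof -
  let ?S = "Sym R T" and ?\<epsilon> = "Sym_counit R T" and ?ST = "tensor_module R (Sym R T) T"
  note mT = T.module
  note mS = Sym_module[OF mT] and aS = Sym_algebra[OF mT]
  note ST = tensor_module_module[OF mS mT] and TMm = tensor_module_module[OF mT M]
  interpret TM: module R TM by (rule TMm)
  have dl: "d \<in> linear_maps R T TM" using d by (simp add: derivation_def)
  note el = Sym_counit_linear[OF T] and ec = linear_maps_closed[OF Sym_counit_linear[OF T]]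
  note cl = chain_map_linear[OF mS el] and ct = chain_map_tens[OF mS el]
  note sl = sym_deriv_linear[OF mT]
  show ?thesis
  proof (rule sym_ext[OF mT TMm linear_maps_comp[OF el dl] linear_maps_comp[OF sl cl] _ x])
    fix u assume "u \<in> lists (carrier T)"
    then show "d (?\<epsilon> (sym_word R T u)) = chain_map ?\<epsilon> (sym_deriv R T (sym_word R T u))"
    proof (induction u)
      case Nil
      show ?case
        by (simp add: Sym_counit_word[OF T] derivation_one[OF T M d] sym_deriv_Nil[OF mT] linear_maps_zero[OF ST TMm cl])
    next
      case (Cons t u)
      then have t: "t \<in> carrier T" by simp
      let ?u = "sym_word R T u" and ?t = "sym_word R T [t]"
      have u: "?u \<in> carrier ?S" and tc: "?t \<in> carrier ?S"
        using Cons.hyps by (simp_all add: sym_word_closed mT)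
      note al = tensor_act_linear[OF aS mT tc] and rS = bilinear_maps_right[OF algebra_mult_bilinear[OF aS] tc]
      have \<epsilon>t: "?\<epsilon> (?t \<otimes>\<^bsub>?S\<^esub> w) = t \<otimes>\<^bsub>T\<^esub> ?\<epsilon> w" if w: "w \<in> carrier ?S" for w
        by (rule sym_ext[OF mT mT linear_maps_comp[OF rS el]
              linear_maps_comp[OF el bilinear_maps_right[OF algebra_mult_bilinear[OF T] t]] _ w])
           (use t in \<open>simp add: Sym_mult_word mT Sym_counit_word[OF T]\<close>)
      \<comment> \<open>As \<open>\<epsilon>\<close> is multiplicative, multiplying by the
        one-letter word \<open>[t]\<close> before \<open>chain_map\<close> amounts to acting by
        \<open>t\<close> after it.\<close>
      have act: "chain_map ?\<epsilon> (tensor_act ?S T ?t s) = tensor_act T M t (chain_map ?\<epsilon> s)"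
        if s: "s \<in> carrier ?ST" for s
        by (rule tensor_ext[OF mS mT TMm linear_maps_comp[OF al cl] linear_maps_comp[OF cl tensor_act_linear[OF T M t]] _ s])
           (use t tc in \<open>simp add: tensor_act_tens[OF aS mT] ct \<epsilon>t tensor_act_mult[OF T M] ec linear_maps_closed[OF dl]
              linear_maps_closed[OF rS]\<close>)
      note du = linear_maps_closed[OF sl u] and \<epsilon>u = ec[OF u]
      have "chain_map ?\<epsilon> (sym_deriv R T (sym_word R T (t # u))) =
          chain_map ?\<epsilon> (tens R ?S T ?u t) \<oplus>\<^bsub>TM\<^esub> chain_map ?\<epsilon> (tensor_act ?S T ?t (sym_deriv R T ?u))"
        using Cons.hyps t u du
        by (simp add: sym_deriv_Cons[OF mT] linear_maps_add[OF cl] tens_closed[OF mS mT] linear_maps_closed[OF al])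
      also have "\<dots> = tensor_act T M (?\<epsilon> ?u) (d t) \<oplus>\<^bsub>TM\<^esub> tensor_act T M t (d (?\<epsilon> ?u))"
        using t u du Cons.IH by (simp add: ct act)
      also have "\<dots> = d (t \<otimes>\<^bsub>T\<^esub> ?\<epsilon> ?u)"
        using d t \<epsilon>u linear_maps_closed[OF dl t] linear_maps_closed[OF dl \<epsilon>u]
        by (simp add: derivation_def TM.a_comm tensor_act_closed[OF T M])
      also have "t \<otimes>\<^bsub>T\<^esub> ?\<epsilon> ?u = ?\<epsilon> (sym_word R T (t # u))"
        using Cons.hyps by (simp add: Sym_counit_word[OF T])
      finally show ?case ..
    qed
  qed
qed

end

lemma foldl_multilinear:
  assumes T: "algebra R T" and Q: "Q \<in> linear_maps R T T"
  shows "foldl (\<lambda>c x. Q (c \<otimes>\<^bsub>T\<^esub> x)) \<one>\<^bsub>T\<^esub> \<in> multilinear_maps R T T"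
proof -
  interpret T: algebra R T by (rule T)
  let ?f = "\<lambda>c x. Q (c \<otimes>\<^bsub>T\<^esub> x)"
  note bil = algebra_mult_bilinear[OF T] and Qc = linear_maps_closed[OF Q]
  have cl: "foldl ?f c w \<in> carrier T" if "w \<in> lists (carrier T)" "c \<in> carrier T" for w c
    using that by (induction w arbitrary: c) (auto simp: Qc)
  \<comment> \<open>A letter in the middle of the word reaches the rest of the fold only through the
    accumulator, so linearity in the start value is what has to be known.\<close>
  have lin: "(\<lambda>c. foldl ?f c w) \<in> linear_maps R T T" if "w \<in> lists (carrier T)" for w
    using that
  proof (induction w)
    case Nil
    show ?case by (simp add: linear_maps_id)
  next
    case (Cons x w)
    show ?case
      using linear_maps_comp[OF linear_maps_comp[OF bilinear_maps_left[OF bil Cons.hyps(1)] Q] Cons.IH] by simp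
  qed
  show ?thesis
  proof (rule multilinear_mapsI)
    fix xs ys assume xs: "xs \<in> lists (carrier T)" and ys: "ys \<in> lists (carrier T)"
    show "(\<lambda>a. foldl ?f \<one>\<^bsub>T\<^esub> (xs @ a # ys)) \<in> linear_maps R T T"
      using linear_maps_comp[OF linear_maps_comp[OF bilinear_maps_right[OF bil cl[OF xs T.one_closed]] Q] lin[OF ys]]
      by simp
  qed (simp add: cl)
qed

lemma rota_baxter_chain_rule:
  fixes T :: "('r, 't) module"
  assumes T: "algebra R T" and M: "module R M" and d: "derivation T M d"
    and Q: "Q \<in> linear_maps R T T"
    and dQ: "\<And>z. z \<in> carrier T \<Longrightarrow> d (Q z) = \<zero>\<^bsub>tensor_module R T M\<^esub>"
  shows "chain_rule R M T (RBSym R T)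
    (tensor_map R (Sh R T) T (Sh_map R T (Sym_counit R T)) (Sym_counit R T) \<circ>> RB_counit R T Q)
    d (RBSym_deriv R T)"
proof -
  interpret T: algebra R T by (rule T)
  let ?S = "Sym R T" and ?\<epsilon> = "Sym_counit R T" and ?TM = "tensor_module R T M"
  let ?Sh = "Sh R (Sym R T)"
  note mT = T.module
  note mS = Sym_module[OF mT] and aS = Sym_algebra[OF mT]
  note mSh = Sh_module[OF mS] and mShT = Sh_module[OF mT]
  note TMm = tensor_module_module[OF mT M] and ST = tensor_module_module[OF mS mT]
  let ?TT = "tensor_module R ?Sh ?S"
  note TT = tensor_module_module[OF mSh mS]
  interpret TM: module R ?TM by (rule TMm)
  have dl: "d \<in> linear_maps R T ?TM" using d by (simp add: derivation_def)
  note bil = algebra_mult_bilinear[OF T]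
  note el = Sym_counit_linear[OF T] and ec = linear_maps_closed[OF Sym_counit_linear[OF T]]
  \<comment> \<open>The factor of the counit that comes from the shuffle algebra; the counit sends
    \<open>w \<otimes> b\<close> to \<open>g w\<close> times \<open>b\<close>.\<close>
  define g where "g = pres_lift R T (foldl (\<lambda>c x. Q (c \<otimes>\<^bsub>T\<^esub> x)) \<one>\<^bsub>T\<^esub>)"
  note fm = foldl_multilinear[OF T Q]
  have gl: "g \<in> linear_maps R (Sh R T) T" unfolding g_def by (rule sh_lift_linear[OF mT mT fm])
  have gw: "g (sh_word R T w) = foldl (\<lambda>c x. Q (c \<otimes>\<^bsub>T\<^esub> x)) \<one>\<^bsub>T\<^esub> w" if "w \<in> lists (carrier T)" for w
    unfolding g_def by (rule sh_lift_word[OF mT mT fm that])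
  have dg: "d (g w) = \<zero>\<^bsub>?TM\<^esub>" if w: "w \<in> carrier (Sh R T)" for w
  proof (rule sh_ext[OF mT TMm linear_maps_comp[OF gl dl] linear_maps_const_zero[OF TMm] _ w])
    fix w assume w: "w \<in> lists (carrier T)"
    show "d (g (sh_word R T w)) = \<zero>\<^bsub>?TM\<^esub>"
    \<comment> \<open>The fold runs from the left, so the outermost \<open>Q\<close> belongs to the
      last letter. A nonempty word gives a value of \<open>Q\<close>, the empty word gives
      \<open>1\<close>, and \<open>d\<close> kills both.\<close>
    proof (cases w rule: rev_cases)
      case Nil
      then show ?thesis by (simp add: gw derivation_one[OF T M d])
    next
      case (snoc v a)
      have "foldl (\<lambda>c x. Q (c \<otimes>\<^bsub>T\<^esub> x)) \<one>\<^bsub>T\<^esub> v \<in> carrier T"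
        using w snoc by (intro multilinear_maps_closed[OF fm]) simp
      then show ?thesis using w snoc by (simp add: gw dQ)
    qed
  qed
  have bil2: "(\<lambda>w b. g w \<otimes>\<^bsub>T\<^esub> b) \<in> bilinear_maps R (Sh R T) T T"
    by (rule bilinear_maps_comp[OF bil gl linear_maps_id(2)])
  note counit = RB_counit_def[of R T Q, folded g_def]
  have cl: "RB_counit R T Q \<in> linear_maps R (tensor_module R (Sh R T) T) T"
    unfolding counit by (rule tensor_lift_linear[OF mShT mT mT bil2])
  have ct: "RB_counit R T Q (tens R (Sh R T) T w b) = g w \<otimes>\<^bsub>T\<^esub> b"
    if "w \<in> carrier (Sh R T)" "b \<in> carrier T" for w b
    unfolding counit by (rule tensor_lift_tens[OF mShT mT mT bil2 that])
  note Sl = Sh_map_linear[OF mS mT el]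
  note ml = tensor_map_linear[OF mSh mS mShT mT Sl el] and mt = tensor_map_tens[OF mSh mS mShT mT Sl el]
  define \<nu> where "\<nu> = (\<lambda>z. RB_counit R T Q (tensor_map R (Sh R T) T (Sh_map R T ?\<epsilon>) ?\<epsilon> z))"
  have nl: "\<nu> \<in> linear_maps R ?TT T" unfolding \<nu>_def by (rule linear_maps_comp[OF ml cl])
  have nt: "\<nu> (tens R ?Sh ?S W U) = g (Sh_map R T ?\<epsilon> W) \<otimes>\<^bsub>T\<^esub> ?\<epsilon> U"
    if "W \<in> carrier ?Sh" "U \<in> carrier ?S" for W U
    unfolding \<nu>_def using that by (simp add: mt ct ec linear_maps_closed[OF Sl])
  let ?bT = "tensor_deriv ?Sh ?S T (sym_deriv R T)"
  note sl = sym_deriv_linear[OF mT]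
  note bTl = tensor_deriv_linear[OF mSh mS mT sl] and bTt = tensor_deriv_tens[OF mSh mS mT sl]
  let ?ch = "chain_map T M d"
  note chl = chain_map_linear[OF T M d TT nl] and cht = chain_map_tens[OF T M d TT nl]
  note chl' = chain_map_linear[OF T M d mS el] and cht' = chain_map_tens[OF T M d mS el]
  have main: "d (\<nu> z) = ?ch \<nu> (?bT z)" if z: "z \<in> carrier ?TT" for z
  proof (rule tensor_ext[OF mSh mS TMm linear_maps_comp[OF nl dl] linear_maps_comp[OF bTl chl] _ z])
    fix W U assume W: "W \<in> carrier ?Sh" and U: "U \<in> carrier ?S"
    let ?c = "g (Sh_map R T ?\<epsilon> W)"
    have W': "Sh_map R T ?\<epsilon> W \<in> carrier (Sh R T)" by (rule linear_maps_closed[OF Sl W])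
    have c: "?c \<in> carrier T" by (rule linear_maps_closed[OF gl W'])
    note eU = ec[OF U]
    let ?J = "tensor_map R ?TT T (tens R ?Sh ?S W) id"
    note Jl = tens_map_linear[OF mSh mS mT sl W] and Jt = tens_map_tens[OF mSh mS mT sl W]
    \<comment> \<open>On \<open>W \<otimes> U\<close> the multiplication is \<open>?c\<close> times
      \<open>\<epsilon> U\<close>, with \<open>?c\<close> depending on \<open>W\<close> alone; so
      \<open>?c\<close> factors out of the right-hand side and leaves the chain rule along
      \<open>\<epsilon>\<close>.\<close>
    have chJ: "?ch \<nu> (?J s) = tensor_act T M ?c (?ch ?\<epsilon> s)" if s: "s \<in> carrier (tensor_module R ?S T)" for s
      by (rule tensor_ext[OF mS mT TMm linear_maps_comp[OF Jl chl] linear_maps_comp[OF chl' tensor_act_linear[OF T M c]] _ s])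
         (use W c in \<open>simp add: Jt cht cht' nt ec tens_closed[OF mSh mS] tensor_act_mult[OF T M] linear_maps_closed[OF dl]\<close>)
    have "?ch \<nu> (?bT (tens R ?Sh ?S W U)) = tensor_act T M ?c (d (?\<epsilon> U))"
      using W U by (simp add: bTt chJ linear_maps_closed[OF sl] sym_chain_rule[OF T M d])
    \<comment> \<open>Leibniz rule read backwards: the other term is \<open>\<epsilon> U\<close>
      acting on \<open>d ?c\<close>, which is zero by \<open>dg\<close>.\<close>
    also have "\<dots> = d (?c \<otimes>\<^bsub>T\<^esub> ?\<epsilon> U)"
      using d c eU dg[OF W'] linear_maps_zero[OF TMm TMm tensor_act_linear[OF T M eU]] linear_maps_closed[OF dl eU]
      by (simp add: derivation_def tensor_act_closed[OF T M])
    finally show "d (\<nu> (tens R ?Sh ?S W U)) = ?ch \<nu> (?bT (tens R ?Sh ?S W U))"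
      using W U by (simp add: nt)
  qed
  show ?thesis
    unfolding chain_rule_def
  proof (intro ballI)
    fix x assume "x \<in> carrier (RBSym R T)"
    then have x: "x \<in> carrier ?TT" by (simp add: RBSym_def RB_def)
    show "((tensor_map R (Sh R T) T (Sh_map R T ?\<epsilon>) ?\<epsilon> \<circ>> RB_counit R T Q) \<circ>> d) x =
      (RBSym_deriv R T \<circ>> tensor_map R T ?TM
          (tensor_map R (Sh R T) T (Sh_map R T ?\<epsilon>) ?\<epsilon> \<circ>> RB_counit R T Q) d
        \<circ>> tensor_assoc_inv R T T M \<circ>> tensor_map R T M (alg_mult_map R T) id) x"
      using main[OF x] unfolding RBSym_deriv_def \<nu>_def tensor_deriv_def chain_map_def[OF T M d]
      by (simp add: fcomp_def)
  qed
qed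


section \<open>The free Rota-Baxter monad\<close>

lemma RBSym_deriv_tensor_deriv:
  "RBSym_deriv R M = tensor_deriv (Sh R (Sym R M)) (Sym R M) M (sym_deriv R M)"
  by (simp add: RBSym_deriv_def tensor_deriv_def fun_eq_iff)

lemma sh_append_bilinear:
  assumes N: "module R N"
  shows "sh_append R N \<in> bilinear_maps R (Sh R N) N (Sh R N)"
proof -
  interpret N: module R N by (rule N)
  note Sh = Sh_module[OF N] and wm = sh_word_multilinear[OF N]
  interpret S: module R "Sh R N" by (rule Sh)
  have ml: "(\<lambda>u. sh_word R N (u @ [b])) \<in> multilinear_maps R N (Sh R N)" if b: "b \<in> carrier N" for b
  proof (rule multilinear_mapsI)
    show "(\<lambda>a. sh_word R N ((xs @ a # ys) @ [b])) \<in> linear_maps R N (Sh R N)"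
      if "xs \<in> lists (carrier N)" "ys \<in> lists (carrier N)" for xs ys
      using multilinear_maps_linear[OF wm, of xs "ys @ [b]"] that b by simp
  qed (use b in \<open>simp add: sh_word_closed N\<close>)
  have lin: "(\<lambda>w. sh_append R N w b) \<in> linear_maps R (Sh R N) (Sh R N)" if "b \<in> carrier N" for b
    using sh_lift_linear[OF N Sh ml[OF that]] by (simp add: sh_append_def)
  have word: "sh_append R N (sh_word R N u) b = sh_word R N (u @ [b])"
    if "b \<in> carrier N" "u \<in> lists (carrier N)" for b u
    using sh_lift_word[OF N Sh ml[OF that(1)] that(2)] by (simp add: sh_append_def)
  show ?thesis
  proof (intro bilinear_mapsI lin linear_mapsI)
    fix w a assume w: "w \<in> carrier (Sh R N)" and a: "a \<in> carrier N"
    show "sh_append R N w a \<in> carrier (Sh R N)" by (rule linear_maps_closed[OF lin[OF a] w])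
    show "sh_append R N w (a \<oplus>\<^bsub>N\<^esub> b) = sh_append R N w a \<oplus>\<^bsub>Sh R N\<^esub> sh_append R N w b"
      if b: "b \<in> carrier N" for b
      by (rule sh_ext[OF N Sh lin linear_maps_plus[OF Sh lin lin] _ w])
         (use a b in \<open>simp_all add: word linear_maps_add[OF multilinear_maps_linear[OF wm, of _ "[]"]]\<close>)
    show "sh_append R N w (r \<odot>\<^bsub>N\<^esub> a) = r \<odot>\<^bsub>Sh R N\<^esub> sh_append R N w a" if r: "r \<in> carrier R" for r
      by (rule sh_ext[OF N Sh lin linear_maps_scale[OF Sh lin] _ w])
         (use a r in \<open>simp_all add: word linear_maps_smult[OF multilinear_maps_linear[OF wm, of _ "[]"]]\<close>)
  qed
qed

lemma
  assumes A: "algebra R A"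
  shows RB_op_linear: "RB_op R A \<in> linear_maps R (RB R A) (RB R A)"
    and RB_op_tens: "w \<in> carrier (Sh R A) \<Longrightarrow> b \<in> carrier A \<Longrightarrow>
      RB_op R A (tens R (Sh R A) A w b) = tens R (Sh R A) A (sh_append R A w b) \<one>\<^bsub>A\<^esub>"
proof -
  interpret A: algebra R A by (rule A)
  note mA = A.module
  note Sh = Sh_module[OF mA]
  note W = tensor_module_module[OF Sh mA]
  have bil: "(\<lambda>w b. tens R (Sh R A) A (sh_append R A w b) \<one>\<^bsub>A\<^esub>) \<in>
      bilinear_maps R (Sh R A) A (tensor_module R (Sh R A) A)"
    by (rule linear_maps_bilinear_comp[OF sh_append_bilinear[OF mA] bilinear_maps_left[OF tens_bilinear[OF Sh mA]]]) simp
  show "RB_op R A \<in> linear_maps R (RB R A) (RB R A)"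
    using tensor_lift_linear[OF Sh mA W bil] by (simp add: RB_op_def RB_def)
  show "RB_op R A (tens R (Sh R A) A w b) = tens R (Sh R A) A (sh_append R A w b) \<one>\<^bsub>A\<^esub>"
    if "w \<in> carrier (Sh R A)" "b \<in> carrier A"
    using tensor_lift_tens[OF Sh mA W bil that] by (simp add: RB_op_def RB_def)
qed

section \<open>The axioms at a single module \<open>M\<close>\<close>

context
  fixes M :: "('r, 'm) module"
  assumes M: "module R M"
begin

interpretation M: module R M by (rule M)
interpretation S: algebra R "Sym R M" by (rule Sym_algebra[OF M])

lemma RBSym_algebra: "algebra R (RBSym R M)"
  unfolding RBSym_def RB_def
  by (rule tensor_algebra_prod_algebra[OF Sh_algebra[OF S.module] Sym_algebra[OF M]])

lemma RBSym_deriv_derivation: "derivation (RBSym R M) M (RBSym_deriv R M)"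
  unfolding RBSym_def RB_def RBSym_deriv_tensor_deriv
  by (rule tensor_deriv_derivation[OF Sh_algebra[OF S.module] Sym_algebra[OF M] M sym_deriv_derivation[OF M]])

lemma RBSym_deriv_tens:
  "x \<in> carrier (Sh R (Sym R M)) \<Longrightarrow> u \<in> carrier (Sym R M) \<Longrightarrow>
    RBSym_deriv R M (tens R (Sh R (Sym R M)) (Sym R M) x u) =
      tensor_map R (tensor_module R (Sh R (Sym R M)) (Sym R M)) M
        (tens R (Sh R (Sym R M)) (Sym R M) x) id (sym_deriv R M u)"
  unfolding RBSym_deriv_tensor_deriv
  by (rule tensor_deriv_tens[OF Sh_module[OF S.module] S.module M sym_deriv_linear[OF M]])

lemma RBSym_deriv_RB_op:
  assumes z: "z \<in> carrier (RBSym R M)"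
  shows "RBSym_deriv R M (RB_op R (Sym R M) z) = \<zero>\<^bsub>tensor_module R (RBSym R M) M\<^esub>"
proof -
  let ?A = "Sym R M" and ?S = "Sh R (Sym R M)"
  let ?W = "tensor_module R ?S ?A"
  note mA = S.module
  note Sh = Sh_module[OF mA]
  note W = tensor_module_module[OF Sh mA]
  note WM = tensor_module_module[OF W M] and AM = tensor_module_module[OF mA M]
  note sl = sym_deriv_linear[OF M]
  have bl: "RBSym_deriv R M \<in> linear_maps R ?W (tensor_module R ?W M)"
    unfolding RBSym_deriv_tensor_deriv by (rule tensor_deriv_linear[OF Sh mA M sl])
  have Pl: "RB_op R ?A \<in> linear_maps R ?W ?W"
    using RB_op_linear[OF Sym_algebra[OF M]] by (simp add: RB_def)
  have z': "z \<in> carrier ?W" using z by (simp add: RBSym_def RB_def)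
  have "RBSym_deriv R M (RB_op R (Sym R M) z) = \<zero>\<^bsub>tensor_module R ?W M\<^esub>"
  proof (rule tensor_ext[OF Sh mA WM linear_maps_comp[OF Pl bl] linear_maps_const_zero[OF WM] _ z'])
    fix w b assume w: "w \<in> carrier ?S" and b: "b \<in> carrier ?A"
    have wb: "sh_append R ?A w b \<in> carrier ?S"
      by (rule bilinear_maps_closed[OF sh_append_bilinear[OF mA] w b])
    show "RBSym_deriv R M (RB_op R ?A (tens R ?S ?A w b)) = \<zero>\<^bsub>tensor_module R ?W M\<^esub>"
      using linear_maps_zero[OF AM WM tens_map_linear[OF Sh mA M sl wb]]
      by (simp add: RB_op_tens[OF Sym_algebra[OF M] w b] RBSym_deriv_tens wb Sym_one sym_word_closed[OF M]
          derivation_one[OF Sym_algebra[OF M] M sym_deriv_derivation[OF M], unfolded Sym_one])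
  qed
  then show ?thesis by (simp add: RBSym_def RB_def)
qed

lemma RBSym_chain_rule:
  "chain_rule R M (RBSym R M) (RBSym R (RBSym R M)) (RBSym_mult R M)
    (RBSym_deriv R M) (RBSym_deriv R (RBSym R M))"
proof -
  have "RB_op R (Sym R M) \<in> linear_maps R (RBSym R M) (RBSym R M)"
    unfolding RBSym_def by (rule RB_op_linear[OF Sym_algebra[OF M]])
  from rota_baxter_chain_rule[OF RBSym_algebra M RBSym_deriv_derivation this RBSym_deriv_RB_op]
  show ?thesis unfolding RBSym_mult_def Let_def .
qed

lemma RBSym_interchange_rule: "interchange_rule R M (RBSym R M) (RBSym_deriv R M)"
  unfolding RBSym_def RB_def RBSym_deriv_tensor_deriv
  by (rule tensor_deriv_interchange[OF Sh_module[OF S.module] S.module M sym_deriv_linear[OF M] sym_deriv_interchange[OF M]])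

text \<open>Both sides equal \<open>(1 \<otimes> 1) \<otimes> m\<close>: on the left because
  \<open>d\<close> sends a letter \<open>m\<close> to \<open>1 \<otimes> m\<close>, on the right
  because the unit map sends the scalar one to \<open>1 \<otimes> 1\<close>.\<close>

lemma RBSym_linear_rule: "linear_rule R M (RBSym R M) (RBSym_unit R M) (RBSym_deriv R M)"
proof -
  let ?A = "Sym R M" and ?S = "Sh R (Sym R M)"
  let ?W = "tensor_module R ?S ?A"
  interpret Sh: algebra R ?S by (rule Sh_algebra[OF S.module])
  note mA = S.module and Sh = Sh.module
  note W = tensor_module_module[OF Sh mA]
  interpret W: module R ?W by (rule W)
  have one: "tens R ?S ?A \<one>\<^bsub>?S\<^esub> \<one>\<^bsub>?A\<^esub> \<in> carrier ?W" by (simp add: tens_closed[OF Sh mA])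
  \<comment> \<open>The inverse unitor takes values in the tensor product of \<open>R\<close> with
    \<open>M\<close>, so \<open>R\<close> must be known to be a module over itself before
    \<open>tensor_map\<close> can be evaluated.\<close>
  have reg: "module R (regular_module R)"
    by (rule moduleI) (auto simp: regular_module_def l_distr r_distr m_assoc is_cring
        intro!: abelian_groupI add.m_closed a_assoc a_comm exI intro: l_neg)
  have u: "alg_unit_map (RBSym R M) \<in> linear_maps R (regular_module R) ?W"
    by (rule linear_mapsI)
       (use one in \<open>auto simp: alg_unit_map_def regular_module_def RBSym_def RB_def W.smult_l_distr W.smult_assoc1\<close>)
  have one_reg: "\<one> \<in> carrier (regular_module R)" by (simp add: regular_module_def)
  note ut = tensor_map_tens[OF reg M W M u linear_maps_id(1) one_reg]
  have "RBSym_deriv R M (RBSym_unit R M m) =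
      tensor_map R ?W M (alg_unit_map (RBSym R M)) id (tensor_lunit_inv R M m)" if m: "m \<in> carrier M" for m
    using m one
    by (simp add: RBSym_unit_def RBSym_deriv_tens sym_word_closed[OF M] sym_deriv_generator[OF M]
        tens_map_tens[OF Sh mA M sym_deriv_linear[OF M]] tensor_lunit_inv_def ut)
       (simp add: alg_unit_map_def RBSym_def RB_def)
  then show ?thesis
    by (simp add: linear_rule_def RBSym_def RB_def)
qed

end

lemma RBSym_deriv_natural:
  assumes M: "module R M" and N: "module R N"
  shows "deriv_natural R M N (RBSym R M) (RBSym R N) (RBSym_map R N) (RBSym_deriv R M) (RBSym_deriv R N)"
  unfolding deriv_natural_def
proof (intro ballI)
  fix f x assume f: "f \<in> linear_maps R M N" and x: "x \<in> carrier (RBSym R M)"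
  let ?A = "Sym R M" and ?S = "Sh R (Sym R M)" and ?A' = "Sym R N" and ?S' = "Sh R (Sym R N)"
  let ?W = "tensor_module R ?S ?A" and ?W' = "tensor_module R ?S' ?A'"
  let ?f = "Sym_map R N f" and ?F = "Sh_map R (Sym R N) (Sym_map R N f)" and ?T = "RBSym_map R N f"
  note mA = Sym_module[OF M] and mA' = Sym_module[OF N]
  note mS = Sh_module[OF mA] and mS' = Sh_module[OF mA']
  note W = tensor_module_module[OF mS mA] and W' = tensor_module_module[OF mS' mA']
  note WM = tensor_module_module[OF W M] and WN = tensor_module_module[OF W' N] and AM = tensor_module_module[OF mA M]
  note fl = Sym_map_linear[OF M N f]
  note Fl = Sh_map_linear[OF mA mA' fl]
  have Tl: "?T \<in> linear_maps R ?W ?W'"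
    unfolding RBSym_map_def by (rule tensor_map_linear[OF mS mA mS' mA' Fl fl])
  have Tt: "?T (tens R ?S ?A w u) = tens R ?S' ?A' (?F w) (?f u)" if "w \<in> carrier ?S" "u \<in> carrier ?A" for w u
    unfolding RBSym_map_def by (rule tensor_map_tens[OF mS mA mS' mA' Fl fl that])
  note Tf = tensor_map_linear[OF W M W' N Tl f] and Tft = tensor_map_tens[OF W M W' N Tl f]
  note ff = tensor_map_linear[OF mA M mA' N fl f] and fft = tensor_map_tens[OF mA M mA' N fl f]
  have bM: "RBSym_deriv R M \<in> linear_maps R ?W (tensor_module R ?W M)"
    unfolding RBSym_deriv_tensor_deriv by (rule tensor_deriv_linear[OF mS mA M sym_deriv_linear[OF M]])
  have bN: "RBSym_deriv R N \<in> linear_maps R ?W' (tensor_module R ?W' N)"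
    unfolding RBSym_deriv_tensor_deriv by (rule tensor_deriv_linear[OF mS' mA' N sym_deriv_linear[OF N]])
  have x': "x \<in> carrier ?W" using x by (simp add: RBSym_def RB_def)
  have "RBSym_deriv R N (?T x) = tensor_map R ?W' N ?T f (RBSym_deriv R M x)"
  proof (rule tensor_ext[OF mS mA WN linear_maps_comp[OF Tl bN] linear_maps_comp[OF bM Tf] _ x'])
    fix w u assume w: "w \<in> carrier ?S" and u: "u \<in> carrier ?A"
    have Fw: "?F w \<in> carrier ?S'" by (rule linear_maps_closed[OF Fl w])
    have fu: "?f u \<in> carrier ?A'" by (rule linear_maps_closed[OF fl u])
    note J = tens_map_linear[OF mS mA M sym_deriv_linear[OF M] w]
      and J' = tens_map_linear[OF mS' mA' N sym_deriv_linear[OF N] Fw]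
    \<comment> \<open>The functor carries the inclusion at \<open>w\<close> to the inclusion at its
      image \<open>?F w\<close>, which reduces naturality to
      \<open>sym_deriv_natural\<close>.\<close>
    have "tensor_map R ?W' N ?T f (tensor_map R ?W M (tens R ?S ?A w) id t) =
        tensor_map R ?W' N (tens R ?S' ?A' (?F w)) id (tensor_map R ?A' N ?f f t)"
      if t: "t \<in> carrier (tensor_module R ?A M)" for t
      by (rule tensor_ext[OF mA M WN linear_maps_comp[OF J Tf] linear_maps_comp[OF ff J'] _ t])
         (use w Fw in \<open>simp add: tens_map_tens[OF mS mA M sym_deriv_linear[OF M]] Tft fft Tt
            tens_map_tens[OF mS' mA' N sym_deriv_linear[OF N]] linear_maps_closed[OF fl] linear_maps_closed[OF f]
            tens_closed[OF mS mA]\<close>)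
    then show "RBSym_deriv R N (?T (tens R ?S ?A w u)) =
        tensor_map R ?W' N ?T f (RBSym_deriv R M (tens R ?S ?A w u))"
      using w u Fw fu
      by (simp add: Tt RBSym_deriv_tens[OF M] RBSym_deriv_tens[OF N] sym_deriv_natural[OF M N f]
          linear_maps_closed[OF sym_deriv_linear[OF M]])
  qed
  then show "(?T \<circ>> RBSym_deriv R N) x = (RBSym_deriv R M \<circ>> tensor_map R (RBSym R N) N ?T f) x"
    by (simp add: RBSym_def RB_def)
qed

end

theorem proposition9p9:
  fixes R :: "'r ring" and M :: "('r, 'a) module" and N :: "('r, 'b) module"
  assumes "cring R" and "module R M" and "module R N"
  shows "RBSym_deriv R M \<in> linear_maps R (RBSym R M) (tensor_module R (RBSym R M) M) \<and>
    deriv_natural R M N (RBSym R M) (RBSym R N) (RBSym_map R N) (RBSym_deriv R M) (RBSym_deriv R N) \<and>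
    constant_rule R M (RBSym R M) (RBSym_deriv R M) \<and>
    product_rule R M (RBSym R M) (RBSym_deriv R M) \<and>
    linear_rule R M (RBSym R M) (RBSym_unit R M) (RBSym_deriv R M) \<and>
    chain_rule R M (RBSym R M) (RBSym R (RBSym R M)) (RBSym_mult R M)
      (RBSym_deriv R M) (RBSym_deriv R (RBSym R M)) \<and>
    interchange_rule R M (RBSym R M) (RBSym_deriv R M)"
proof -
  interpret base_ring R by (intro base_ring.intro assms)
  note M = assms(2)
  \<comment> \<open>\<open>derivation\<close> includes linearity, so \<open>b\<close> yields the
    first conjunct as well as the constant and the product rule.\<close>
  note T = RBSym_algebra[OF M] and b = RBSym_deriv_derivation[OF M]
  show ?thesis
    using b RBSym_deriv_natural[OF M assms(3)] derivation_constant_rule[OF T M b]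
      derivation_product_rule[OF T M b] RBSym_linear_rule[OF M] RBSym_chain_rule[OF M]
      RBSym_interchange_rule[OF M]
    by (simp add: derivation_def)
qed

end
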